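(* Let $k$ be a field and $G$ a finite group. Then $\widehat\iota_{x=1}:\widehat{\mathrm H}^*(G,k)\hookrightarrow\widehat{\mathrm{HH}}^*(kG,kG)$ is a unitary embedding of Batalin-Vilkovisky algebras; that is, $\widehat\iota_{x=1}$ is injective and its image contains the unit and is closed under the cup product $\cup$, the operator $\widehat\Delta$ and the Lie bracket $[\cdot,\cdot]$ of $\widehat{\mathrm{HH}}^*(kG,kG)$, so that $\widehat{\mathrm H}^*(G,k)$ with the induced operations is a BV subalgebra of $\widehat{\mathrm{HH}}^*(kG,kG)$.
   Context: Notation. $\overline G=G\setminus\{1\}$; $g_{i,j}$ denotes the sequence $g_i,\dots,g_j$ (empty if $j<i$). $C^n(kG,kG)=\mathrm{Map}(\overline G^{\times n},kG)$ and $C_n(kG,kG)=k[G\times\overline G^{\times n}]$, $n\ge0$. Cochains are extended by $0$ to tuples having an entry equal to $1$; a chain $(g_0,g_{1,n})$ with some $g_i=1$, $i\ge1$, is $0$; chains are extended linearly in the first entry to $kG$. Differentials: $\delta(\varphi)(g_{1,n+1})=g_1\varphi(g_{2,n+1})+\sum_{i=1}^n(-1)^i\varphi(g_{1,i-1},g_ig_{i+1},g_{i+2,n+1})+(-1)^{n+1}\varphi(g_{1,n})g_{n+1}$, $\partial_n(g_0,g_{1,n})=(g_0g_1,g_{2,n})+\sum_{i=1}^{n-1}(-1)^i(g_0,g_{1,i-1},g_ig_{i+1},g_{i+2,n})+(-1)^n(g_ng_0,g_{1,n-1})$. The Tate-Hochschild cochain complex $\mathcal D^*(kG,kG)$ has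 $\mathcal D^m=C^m(kG,kG)$ $(m\ge0)$, $\mathcal D^{-p-1}=C_p(kG,kG)$ $(p\ge0)$; its differential is $\delta$ in degrees $\ge0$, $(-1)^p\partial_p$ on $C_p$, $p\ge1$, and $\tau:C_0=kG\to C^0=kG$, $\tau(h)=\sum_{g\in G}ghg^{-1}$ in degree $-1$. Its cohomology is the Tate-Hochschild cohomology $\widehat{\mathrm{HH}}^*(kG,kG)$. Cup product on $\mathcal D^*(kG,kG)$, $\alpha\in\mathcal D^n$, $\beta\in\mathcal D^m$: (1) $n,m\ge0$: $(\alpha\cup\beta)(g_{1,n+m})=\alpha(g_{1,n})\beta(g_{n+1,n+m})$. (2) $\alpha=(g_0,g_{1,s})\in C_s$, $\beta=(h_0,h_{1,t})\in C_t$: $\alpha\cup\beta=\sum_{g\in G}(gh_0,h_{1,t},g^{-1}g_0,g_{1,s})\in C_{s+t+1}$. (3) $\alpha\in C^n$, $\beta=(h_0,h_{1,t})$, $n\le t$: $\alpha\cup\beta=(\alpha(h_{t-n+1,t})h_0,h_{1,t-n})$. (4) $\alpha\in C^n$, $\beta=(g_0,g_{1,t})$, $n\ge t+1$: $(\alpha\cup\beta)(h_{1,n-t-1})=\sum_{g\in G}\alpha(h_{1,n-t-1},g^{-1},g_{1,t})g_0g$. (5) $\alpha=(g_0,g_{1,s})$, $\beta\in C^m$, $m\le s$: $\alpha\cup\beta=(g_0\beta(g_{1,m}),g_{m+1,s})$. (6) $\alpha=(g_0,g_{1,s})$, $\beta\in C^m$, $m\ge s+1$: $(\alpha\cup\beta)(h_{1,m-s-1})=\sum_{g\in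 G}gg_0\beta(g_{1,s},g^{-1},h_{1,m-s-1})$. BV-operator $\widehat\Delta:\mathcal D^*\to\mathcal D^{*-1}$: on $C_s$ it is Connes' operator $B(g_0,g_{1,s})=\sum_{i=0}^s(-1)^{is}(1,g_{i,s},g_{0,i-1})$; on $C^0$ it is $0$; on $C^n$, $n\ge1$, it is $\Delta(\alpha)(g_{1,n-1})=\sum_{g_n\in G}\sum_{i=1}^n(-1)^{i(n-1)}\langle\alpha(g_{i,n-1},g_n,g_{1,i-1}),1\rangle g_n^{-1}$, where $\langle a,1\rangle$ is the coefficient of $1$ in $a\in kG$. A BV-algebra (in the sign convention used here) is a graded commutative associative algebra $(A,\cup)$ with a Lie bracket $[\cdot,\cdot]$ of degree $-1$ making it a Gerstenhaber algebra and an operator $\widehat\Delta$ of degree $-1$ with $\widehat\Delta^2=0$ and $[\alpha,\beta]=-(-1)^{(|\alpha|-1)|\beta|}\bigl(\widehat\Delta(\alpha\cup\beta)-\widehat\Delta(\alpha)\cup\beta-(-1)^{|\alpha|}\alpha\cup\widehat\Delta(\beta)\bigr)$. It is known and may be assumed that $\cup$ and $\widehat\Delta$ descend to $\widehat{\mathrm{HH}}^*(kG,kG)$ and make it a (unital) BV-algebra, with bracket given by this formula. Tate cohomology. The Tate cochain complex $\widehat C^*(G,k)$ has $\widehat C^n=\mathrm{Map}(\overline G^{\times n},k)$ $(n\ge0)$, $\widehat C^{-s-1}=k[\overline G^{\times s}]$ $(s\ge0)$: normalized group cochains and group chains with trivial coefficients, spliced in degree $-1$ by multiplication by $|G|$ (with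 the same signs in negative degrees as for $\mathcal D^*$); its cohomology is $\widehat{\mathrm H}^*(G,k)$. The map $\widehat\iota_{x=1}:\widehat C^*(G,k)\to\mathcal D^*(kG,kG)$ sends $\varphi:\overline G^{\times n}\to k$ to $\bigl(g_{1,n}\mapsto\varphi(g_{1,n})g_1\cdots g_n\bigr)$ and $(g_{1,s})$ to $(g_s^{-1}\cdots g_1^{-1},g_{1,s})$; the induced map on cohomology is also denoted $\widehat\iota_{x=1}$. *)

theory Defs
  imports "HOL-Algebra.Group" "HOL-Library.Function_Algebras"
begin

section \<open>Graded algebras with a BV-operator\<close>

text \<open>
  A \<open>\<int>\<close>-graded object is given by its homogeneous parts, and every operation carries the
  degrees of its arguments: \<open>hcup A a b\<close> is the product of degree-\<open>a\<close> and degree-\<open>b\<close> elements.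
\<close>

record ('a, 'k) graded_space =
  homog :: "int \<Rightarrow> 'a set"
  hadd :: "int \<Rightarrow> 'a \<Rightarrow> 'a \<Rightarrow> 'a"
  hzero :: "int \<Rightarrow> 'a"
  hscale :: "int \<Rightarrow> 'k \<Rightarrow> 'a \<Rightarrow> 'a"

record ('a, 'k) bv_structure = "('a, 'k) graded_space" +
  hcup :: "int \<Rightarrow> int \<Rightarrow> 'a \<Rightarrow> 'a \<Rightarrow> 'a"
  hunit :: 'a
  hdelta :: "int \<Rightarrow> 'a \<Rightarrow> 'a"
  hbracket :: "int \<Rightarrow> int \<Rightarrow> 'a \<Rightarrow> 'a \<Rightarrow> 'a"

abbreviation ksign :: "int \<Rightarrow> 'k::field"
  where "ksign e \<equiv> (-1) powi e"

locale graded_vector_space =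
  fixes A :: "('a, 'k::field, 'x) graded_space_scheme"
  assumes hadd_comm_group:
      "comm_group \<lparr>carrier = homog A n, mult = hadd A n, one = hzero A n\<rparr>"
    and hscale_closed: "x \<in> homog A n \<Longrightarrow> hscale A n c x \<in> homog A n"
    and hscale_hadd: "x \<in> homog A n \<Longrightarrow> y \<in> homog A n \<Longrightarrow>
      hscale A n c (hadd A n x y) = hadd A n (hscale A n c x) (hscale A n c y)"
    and hscale_plus: "x \<in> homog A n \<Longrightarrow>
      hscale A n (c + d) x = hadd A n (hscale A n c x) (hscale A n d x)"
    and hscale_hscale: "x \<in> homog A n \<Longrightarrow> hscale A n c (hscale A n d x) = hscale A n (c * d) x"
    and hscale_one: "x \<in> homog A n \<Longrightarrow> hscale A n 1 x = x"

definition linear_on ::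
  "('a, 'k, 'x) graded_space_scheme \<Rightarrow> int \<Rightarrow> ('b, 'k, 'y) graded_space_scheme \<Rightarrow> int \<Rightarrow> ('a \<Rightarrow> 'b) \<Rightarrow> bool"
  where "linear_on A n B m f \<longleftrightarrow>
    (\<forall>x\<in>homog A n. f x \<in> homog B m) \<and>
    (\<forall>x\<in>homog A n. \<forall>y\<in>homog A n. f (hadd A n x y) = hadd B m (f x) (f y)) \<and>
    (\<forall>c. \<forall>x\<in>homog A n. f (hscale A n c x) = hscale B m c (f x))"

definition bilinear_on ::
  "('a, 'k, 'x) graded_space_scheme \<Rightarrow> int \<Rightarrow> int \<Rightarrow> int \<Rightarrow> ('a \<Rightarrow> 'a \<Rightarrow> 'a) \<Rightarrow> bool"
  where "bilinear_on A a b c f \<longleftrightarrow>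
    (\<forall>x\<in>homog A a. linear_on A b A c (f x)) \<and>
    (\<forall>y\<in>homog A b. linear_on A a A c (\<lambda>x. f x y))"

locale graded_comm_algebra = graded_vector_space A
  for A :: "('a, 'k::field, 'x) bv_structure_scheme" +
  assumes hcup_bilinear: "bilinear_on A a b (a + b) (hcup A a b)"
    and hcup_assoc: "x \<in> homog A a \<Longrightarrow> y \<in> homog A b \<Longrightarrow> z \<in> homog A c \<Longrightarrow>
      hcup A (a + b) c (hcup A a b x y) z = hcup A a (b + c) x (hcup A b c y z)"
    and hcup_comm: "x \<in> homog A a \<Longrightarrow> y \<in> homog A b \<Longrightarrow>
      hcup A a b x y = hscale A (a + b) (ksign (a * b)) (hcup A b a y x)"
    and hunit_closed: "hunit A \<in> homog A 0"
    and hunit_left: "x \<in> homog A a \<Longrightarrow> hcup A 0 a (hunit A) x = x"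
    and hunit_right: "x \<in> homog A a \<Longrightarrow> hcup A a 0 x (hunit A) = x"

text \<open>
  The Leibniz rule below is Gerstenhaber's,
  \<open>[x \<union> y, z] = [x, z] \<union> y + (-1)^(|x|(|z|-1)) x \<union> [y, z]\<close>; it is the form that belongs to the
  sign \<open>-(-1)^((|x|-1)|y|)\<close> in the BV formula (other sign conventions for the bracket put the sign
  differently).
\<close>

locale gerstenhaber_algebra = graded_comm_algebra A
  for A :: "('a, 'k::field, 'x) bv_structure_scheme" +
  assumes hbracket_bilinear: "bilinear_on A a b (a + b - 1) (hbracket A a b)"
    and hbracket_antisym: "x \<in> homog A a \<Longrightarrow> y \<in> homog A b \<Longrightarrow>
      hbracket A a b x y = hscale A (a + b - 1) (- ksign ((a - 1) * (b - 1))) (hbracket A b a y x)"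
    and hbracket_jacobi: "x \<in> homog A a \<Longrightarrow> y \<in> homog A b \<Longrightarrow> z \<in> homog A c \<Longrightarrow>
      hbracket A a (b + c - 1) x (hbracket A b c y z) =
      hadd A (a + b + c - 2)
        (hbracket A (a + b - 1) c (hbracket A a b x y) z)
        (hscale A (a + b + c - 2) (ksign ((a - 1) * (b - 1)))
          (hbracket A b (a + c - 1) y (hbracket A a c x z)))"
    and hbracket_leibniz: "x \<in> homog A a \<Longrightarrow> y \<in> homog A b \<Longrightarrow> z \<in> homog A c \<Longrightarrow>
      hbracket A (a + b) c (hcup A a b x y) z =
      hadd A (a + b + c - 1)
        (hcup A (a + c - 1) b (hbracket A a c x z) y)
        (hscale A (a + b + c - 1) (ksign (a * (c - 1)))
          (hcup A a (b + c - 1) x (hbracket A b c y z)))"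

text \<open>
  \<open>-(-1)^((|x|-1)|y|) (\<Delta>(x \<union> y) - \<Delta>x \<union> y - (-1)^|x| x \<union> \<Delta>y)\<close>; the arguments are addition,
  scalar multiplication, product and BV-operator.
\<close>

definition bv_bracket ::
  "(int \<Rightarrow> 'a \<Rightarrow> 'a \<Rightarrow> 'a) \<Rightarrow> (int \<Rightarrow> 'k::field \<Rightarrow> 'a \<Rightarrow> 'a) \<Rightarrow>
   (int \<Rightarrow> int \<Rightarrow> 'a \<Rightarrow> 'a \<Rightarrow> 'a) \<Rightarrow> (int \<Rightarrow> 'a \<Rightarrow> 'a) \<Rightarrow> int \<Rightarrow> int \<Rightarrow> 'a \<Rightarrow> 'a \<Rightarrow> 'a"
  where "bv_bracket add scale cup del a b x y =
    scale (a + b - 1) (- ksign ((a - 1) * b))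
      (add (a + b - 1) (del (a + b) (cup a b x y))
        (add (a + b - 1)
          (scale (a + b - 1) (- 1) (cup (a - 1) b (del a x) y))
          (scale (a + b - 1) (- ksign a) (cup a (b - 1) x (del b y)))))"

locale bv_algebra = gerstenhaber_algebra A
  for A :: "('a, 'k::field, 'x) bv_structure_scheme" +
  assumes hdelta_linear: "linear_on A a A (a - 1) (hdelta A a)"
    and hdelta_hdelta: "x \<in> homog A a \<Longrightarrow> hdelta A (a - 1) (hdelta A a x) = hzero A (a - 2)"
    and hbracket_bv: "x \<in> homog A a \<Longrightarrow> y \<in> homog A b \<Longrightarrow>
      hbracket A a b x y = bv_bracket (hadd A) (hscale A) (hcup A) (hdelta A) a b x y"

definition bv_hom ::
  "('a, 'k::field, 'x) bv_structure_scheme \<Rightarrow> ('b, 'k, 'y) bv_structure_scheme \<Rightarrow> (int \<Rightarrow> 'a \<Rightarrow> 'b) \<Rightarrow> bool"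
  where "bv_hom A B f \<longleftrightarrow>
    (\<forall>n. linear_on A n B n (f n)) \<and>
    f 0 (hunit A) = hunit B \<and>
    (\<forall>a b. \<forall>x\<in>homog A a. \<forall>y\<in>homog A b.
      f (a + b) (hcup A a b x y) = hcup B a b (f a x) (f b y)) \<and>
    (\<forall>a. \<forall>x\<in>homog A a. f (a - 1) (hdelta A a x) = hdelta B a (f a x)) \<and>
    (\<forall>a b. \<forall>x\<in>homog A a. \<forall>y\<in>homog A b.
      f (a + b - 1) (hbracket A a b x y) = hbracket B a b (f a x) (f b y))"

text \<open>
  The operations induced on the source of a map \<open>f\<close> that is injective in every degree and whose
  image is closed under the operations of the target.
\<close>

definition induced_bv_structure ::
  "('a, 'k, 'x) graded_space_scheme \<Rightarrow> ('b, 'k, 'y) bv_structure_scheme \<Rightarrow> (int \<Rightarrow> 'a \<Rightarrow> 'b) \<Rightarrow>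
   ('a, 'k) bv_structure"
  where "induced_bv_structure V B f =
    (let pull = (\<lambda>n. inv_into (homog V n) (f n)) in
     \<lparr> homog = homog V, hadd = hadd V, hzero = hzero V, hscale = hscale V,
       hcup = (\<lambda>a b x y. pull (a + b) (hcup B a b (f a x) (f b y))),
       hunit = pull 0 (hunit B),
       hdelta = (\<lambda>a x. pull (a - 1) (hdelta B a (f a x))),
       hbracket = (\<lambda>a b x y. pull (a + b - 1) (hbracket B a b (f a x) (f b y))) \<rparr>)"


section \<open>Cohomology of a complex of function spaces\<close>

text \<open>
  A complex is a family of subspaces \<open>C n\<close> of one type with differentials
  \<open>d n\<close> from \<open>C n\<close> to \<open>C (n + 1)\<close>. Cohomology classes are equivalence classes of cocycles, and
  operations on classes are lifted in the usual way for quotients: the union of the classes of all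
  values on representatives, which is a single class when the operation respects the relation.
\<close>

definition cocycles :: "(int \<Rightarrow> 'c::ab_group_add set) \<Rightarrow> (int \<Rightarrow> 'c \<Rightarrow> 'c) \<Rightarrow> int \<Rightarrow> 'c set"
  where "cocycles C d n = {a \<in> C n. d n a = 0}"

definition cohomologous :: "(int \<Rightarrow> 'c::ab_group_add set) \<Rightarrow> (int \<Rightarrow> 'c \<Rightarrow> 'c) \<Rightarrow> int \<Rightarrow> ('c \<times> 'c) set"
  where "cohomologous C d n =
    {(a, b). a \<in> cocycles C d n \<and> b \<in> cocycles C d n \<and> a - b \<in> d (n - 1) ` C (n - 1)}"

definition cohomology_space ::
  "(int \<Rightarrow> 'c::ab_group_add set) \<Rightarrow> (int \<Rightarrow> 'c \<Rightarrow> 'c) \<Rightarrow> ('k \<Rightarrow> 'c \<Rightarrow> 'c) \<Rightarrow> ('c set, 'k) graded_space"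
  where "cohomology_space C d scale =
    \<lparr> homog = (\<lambda>n. cocycles C d n // cohomologous C d n),
      hadd = (\<lambda>n X Y. \<Union>a\<in>X. \<Union>b\<in>Y. cohomologous C d n `` {a + b}),
      hzero = (\<lambda>n. cohomologous C d n `` {0}),
      hscale = (\<lambda>n c X. \<Union>a\<in>X. cohomologous C d n `` {scale c a}) \<rparr>"


section \<open>The group algebra and normalized tuples\<close>

text \<open>Elements of the group algebra are coefficient functions vanishing outside \<open>carrier G\<close>.\<close>

definition ga_of :: "'g \<Rightarrow> 'g \<Rightarrow> 'k::field"
  where "ga_of g = (\<lambda>x. if x = g then 1 else 0)"

definition ga_mult :: "('g, 'm) monoid_scheme \<Rightarrow> ('g \<Rightarrow> 'k::field) \<Rightarrow> ('g \<Rightarrow> 'k) \<Rightarrow> 'g \<Rightarrow> 'k"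
  where "ga_mult G a b =
    (\<lambda>x. \<Sum>(g, h)\<in>{(g, h). g \<in> carrier G \<and> h \<in> carrier G \<and> g \<otimes>\<^bsub>G\<^esub> h = x}. a g * b h)"

definition simplices :: "('g, 'm) monoid_scheme \<Rightarrow> nat \<Rightarrow> 'g list set"
  where "simplices G n = {gs. length gs = n \<and> set gs \<subseteq> carrier G - {\<one>\<^bsub>G\<^esub>}}"

text \<open>The entry \<open>g\<^sub>i\<close> of a tuple is \<open>gs ! (i - 1)\<close>; \<open>merge G i\<close> multiplies \<open>g\<^sub>i\<close> and \<open>g\<^sub>i\<^sub>+\<^sub>1\<close>.\<close>

definition merge :: "('g, 'm) monoid_scheme \<Rightarrow> nat \<Rightarrow> 'g list \<Rightarrow> 'g list"
  where "merge G i gs = take (i - 1) gs @ [gs ! (i - 1) \<otimes>\<^bsub>G\<^esub> gs ! i] @ drop (i + 1) gs"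

definition group_prod :: "('g, 'm) monoid_scheme \<Rightarrow> 'g list \<Rightarrow> 'g"
  where "group_prod G gs = foldr (\<otimes>\<^bsub>G\<^esub>) gs \<one>\<^bsub>G\<^esub>"

text \<open>The length of the tuples indexing degree \<open>m\<close>: degree \<open>-p - 1\<close> is spanned by \<open>p\<close>-tuples.\<close>

definition arity :: "int \<Rightarrow> nat"
  where "arity m = nat (if m \<ge> 0 then m else - m - 1)"


section \<open>The Tate-Hochschild complex\<close>

text \<open>
  Cochains and chains share one type so that they form a single graded family. A cochain \<open>f\<close> is
  read as \<open>gs \<mapsto> f gs\<close> with values in the group algebra; a chain \<open>f\<close> is read as the sum
  of \<open>f gs g\<^sub>0 \<cdot> (g\<^sub>0, gs)\<close>. Both vanish on tuples having an entry \<open>1\<close>, which is the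
  extension by \<open>0\<close> of cochains, and for chains the normalization.
\<close>

type_synonym ('g, 'k) hoch = "'g list \<Rightarrow> 'g \<Rightarrow> 'k"

definition hoch_space :: "('g, 'm) monoid_scheme \<Rightarrow> nat \<Rightarrow> ('g, 'k::field) hoch set"
  where "hoch_space G n = {f. \<forall>gs x. f gs x \<noteq> 0 \<longrightarrow> gs \<in> simplices G n \<and> x \<in> carrier G}"

text \<open>The chain \<open>(a, gs)\<close> with \<open>a\<close> in the group algebra; it is \<open>0\<close> if \<open>gs\<close> has an entry \<open>1\<close>.\<close>

definition hoch_chain :: "('g, 'm) monoid_scheme \<Rightarrow> ('g \<Rightarrow> 'k::field) \<Rightarrow> 'g list \<Rightarrow> ('g, 'k) hoch"
  where "hoch_chain G a gs = (\<lambda>xs x. if xs = gs \<and> \<one>\<^bsub>G\<^esub> \<notin> set gs then a x else 0)"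

text \<open>Linear extension to \<open>p\<close>-chains of a map \<open>F\<close> given on the basis elements \<open>(g\<^sub>0, gs)\<close>.\<close>

definition hoch_lin ::
  "('g, 'm) monoid_scheme \<Rightarrow> nat \<Rightarrow> ('g \<Rightarrow> 'g list \<Rightarrow> ('g, 'k::field) hoch) \<Rightarrow> ('g, 'k) hoch \<Rightarrow> ('g, 'k) hoch"
  where "hoch_lin G p F c = (\<lambda>xs x. \<Sum>gs\<in>simplices G p. \<Sum>g0\<in>carrier G. c gs g0 * F g0 gs xs x)"

definition hoch_delta :: "('g, 'm) monoid_scheme \<Rightarrow> nat \<Rightarrow> ('g, 'k::field) hoch \<Rightarrow> ('g, 'k) hoch"
  where "hoch_delta G n f = (\<lambda>gs x. if gs \<in> simplices G (n + 1) then
      ga_mult G (ga_of (hd gs)) (f (tl gs)) x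
      + (\<Sum>i=1..n. (-1) ^ i * f (merge G i gs) x)
      + (-1) ^ (n + 1) * ga_mult G (f (butlast gs)) (ga_of (last gs)) x
    else 0)"

definition hoch_boundary :: "('g, 'm) monoid_scheme \<Rightarrow> nat \<Rightarrow> ('g, 'k::field) hoch \<Rightarrow> ('g, 'k) hoch"
  where "hoch_boundary G p = hoch_lin G p (\<lambda>g0 gs xs x.
      hoch_chain G (ga_of (g0 \<otimes>\<^bsub>G\<^esub> hd gs)) (tl gs) xs x
      + (\<Sum>i=1..<p. (-1) ^ i * hoch_chain G (ga_of g0) (merge G i gs) xs x)
      + (-1) ^ p * hoch_chain G (ga_of (last gs \<otimes>\<^bsub>G\<^esub> g0)) (butlast gs) xs x)"

definition hoch_tau :: "('g, 'm) monoid_scheme \<Rightarrow> ('g, 'k::field) hoch \<Rightarrow> ('g, 'k) hoch"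
  where "hoch_tau G c = (\<lambda>gs x. if gs = [] then
      \<Sum>h\<in>carrier G. c [] h * (\<Sum>g\<in>carrier G. ga_of (g \<otimes>\<^bsub>G\<^esub> h \<otimes>\<^bsub>G\<^esub> inv\<^bsub>G\<^esub> g) x)
    else 0)"

definition th_space :: "('g, 'm) monoid_scheme \<Rightarrow> int \<Rightarrow> ('g, 'k::field) hoch set"
  where "th_space G m = hoch_space G (arity m)"

definition th_diff :: "('g, 'm) monoid_scheme \<Rightarrow> int \<Rightarrow> ('g, 'k::field) hoch \<Rightarrow> ('g, 'k) hoch"
  where "th_diff G m f =
    (if m \<ge> 0 then hoch_delta G (nat m) f
     else if m = -1 then hoch_tau G f
     else (\<lambda>gs x. (-1) ^ arity m * hoch_boundary G (arity m) f gs x))"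

definition th_scale :: "'k::field \<Rightarrow> ('g, 'k) hoch \<Rightarrow> ('g, 'k) hoch"
  where "th_scale c f = (\<lambda>gs x. c * f gs x)"

text \<open>
  The six cases of the cup product; \<open>take (t - n) hs\<close> and \<open>drop (t - n) hs\<close> are
  \<open>h\<^sub>1, \<dots>, h\<^sub>t\<^sub>-\<^sub>n\<close> and \<open>h\<^sub>t\<^sub>-\<^sub>n\<^sub>+\<^sub>1, \<dots>, h\<^sub>t\<close>.
\<close>

definition th_cup ::
  "('g, 'm) monoid_scheme \<Rightarrow> int \<Rightarrow> int \<Rightarrow> ('g, 'k::field) hoch \<Rightarrow> ('g, 'k) hoch \<Rightarrow> ('g, 'k) hoch"
  where "th_cup G a b \<alpha> \<beta> = (let n = arity a; m = arity b in
    if a \<ge> 0 \<and> b \<ge> 0 then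
      (\<lambda>gs x. if gs \<in> simplices G (n + m) then ga_mult G (\<alpha> (take n gs)) (\<beta> (drop n gs)) x else 0)
    else if a < 0 \<and> b < 0 then
      hoch_lin G n (\<lambda>g0 gs. hoch_lin G m (\<lambda>h0 hs. \<Sum>g\<in>carrier G.
        hoch_chain G (ga_of (g \<otimes>\<^bsub>G\<^esub> h0)) (hs @ [inv\<^bsub>G\<^esub> g \<otimes>\<^bsub>G\<^esub> g0] @ gs)) \<beta>) \<alpha>
    else if a \<ge> 0 then
      (if n \<le> m then
        hoch_lin G m (\<lambda>h0 hs.
          hoch_chain G (ga_mult G (\<alpha> (drop (m - n) hs)) (ga_of h0)) (take (m - n) hs)) \<beta>
       else
        hoch_lin G m (\<lambda>g0 gs hs x. if hs \<in> simplices G (n - m - 1) then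
          \<Sum>g\<in>carrier G. ga_mult G (\<alpha> (hs @ [inv\<^bsub>G\<^esub> g] @ gs)) (ga_of (g0 \<otimes>\<^bsub>G\<^esub> g)) x
          else 0) \<beta>)
    else
      (if m \<le> n then
        hoch_lin G n (\<lambda>g0 gs.
          hoch_chain G (ga_mult G (ga_of g0) (\<beta> (take m gs))) (drop m gs)) \<alpha>
       else
        hoch_lin G n (\<lambda>g0 gs hs x. if hs \<in> simplices G (m - n - 1) then
          \<Sum>g\<in>carrier G. ga_mult G (ga_of (g \<otimes>\<^bsub>G\<^esub> g0)) (\<beta> (gs @ [inv\<^bsub>G\<^esub> g] @ hs)) x
          else 0) \<alpha>))"

text \<open>
  On chains this is Connes' operator: \<open>(g\<^sub>i, \<dots>, g\<^sub>s, g\<^sub>0, \<dots>, g\<^sub>i\<^sub>-\<^sub>1)\<close> is the rotation by \<open>i\<close> of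
  \<open>g\<^sub>0, \<dots>, g\<^sub>s\<close>.
\<close>

definition th_Delta :: "('g, 'm) monoid_scheme \<Rightarrow> int \<Rightarrow> ('g, 'k::field) hoch \<Rightarrow> ('g, 'k) hoch"
  where "th_Delta G a \<alpha> = (let n = arity a in
    if a < 0 then
      hoch_lin G n (\<lambda>g0 gs xs x. \<Sum>i\<le>n. (-1) ^ (i * n) *
        hoch_chain G (ga_of \<one>\<^bsub>G\<^esub>) (drop i (g0 # gs) @ take i (g0 # gs)) xs x) \<alpha>
    else if a = 0 then 0
    else
      (\<lambda>gs x. if gs \<in> simplices G (n - 1) then
        \<Sum>g\<in>carrier G. \<Sum>i=1..n. (-1) ^ (i * (n - 1)) *
          \<alpha> (drop (i - 1) gs @ [g] @ take (i - 1) gs) \<one>\<^bsub>G\<^esub> * ga_of (inv\<^bsub>G\<^esub> g) x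
        else 0))"

definition th_unit :: "('g, 'm) monoid_scheme \<Rightarrow> ('g, 'k::field) hoch"
  where "th_unit G = (\<lambda>gs. if gs = [] then ga_of \<one>\<^bsub>G\<^esub> else 0)"

abbreviation th_cocycles :: "('g, 'm) monoid_scheme \<Rightarrow> int \<Rightarrow> ('g, 'k::field) hoch set"
  where "th_cocycles G \<equiv> cocycles (th_space G) (th_diff G)"

abbreviation th_rel :: "('g, 'm) monoid_scheme \<Rightarrow> int \<Rightarrow> (('g, 'k::field) hoch \<times> ('g, 'k) hoch) set"
  where "th_rel G \<equiv> cohomologous (th_space G) (th_diff G)"

text \<open>
  Known facts about \<open>\<union>\<close> and \<open>\<Delta>\<close>, not proved here: they send cocycles to cocycles and their
  values on cocycles depend, up to coboundaries, only on the classes of the arguments.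
\<close>

definition th_operations_descend :: "'k::field itself \<Rightarrow> ('g, 'm) monoid_scheme \<Rightarrow> bool"
  where "th_operations_descend k G \<longleftrightarrow>
    (\<forall>a b. (\<forall>\<alpha>\<in>th_cocycles G a. \<forall>\<beta>\<in>th_cocycles G b.
        (th_cup G a b \<alpha> \<beta> :: ('g, 'k) hoch) \<in> th_cocycles G (a + b)) \<and>
      congruent2 (th_rel G a) (th_rel G b)
        (\<lambda>\<alpha> \<beta>. th_rel G (a + b) `` {th_cup G a b \<alpha> \<beta> :: ('g, 'k) hoch})) \<and>
    (\<forall>a. (\<forall>\<alpha>\<in>th_cocycles G a. (th_Delta G a \<alpha> :: ('g, 'k) hoch) \<in> th_cocycles G (a - 1)) \<and>
      congruent (th_rel G a) (\<lambda>\<alpha>. th_rel G (a - 1) `` {th_Delta G a \<alpha> :: ('g, 'k) hoch}))"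

definition tate_hochschild ::
  "'k::field itself \<Rightarrow> ('g, 'm) monoid_scheme \<Rightarrow> (('g, 'k) hoch set, 'k) bv_structure"
  where "tate_hochschild k G =
    (let V = cohomology_space (th_space G) (th_diff G) th_scale;
         cup = (\<lambda>a b X Y. \<Union>\<alpha>\<in>X. \<Union>\<beta>\<in>Y. th_rel G (a + b) `` {th_cup G a b \<alpha> \<beta>});
         del = (\<lambda>a X. \<Union>\<alpha>\<in>X. th_rel G (a - 1) `` {th_Delta G a \<alpha>})
     in \<lparr> homog = homog V, hadd = hadd V, hzero = hzero V, hscale = hscale V,
          hcup = cup, hunit = th_rel G 0 `` {th_unit G}, hdelta = del,
          hbracket = bv_bracket (hadd V) (hscale V) cup del \<rparr>)"


section \<open>Tate cohomology and its embedding\<close>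

text \<open>As before, cochains and chains share one type: a chain \<open>f\<close> is the sum of \<open>f gs \<cdot> gs\<close>.\<close>

type_synonym ('g, 'k) tate = "'g list \<Rightarrow> 'k"

definition tate_space :: "('g, 'm) monoid_scheme \<Rightarrow> int \<Rightarrow> ('g, 'k::field) tate set"
  where "tate_space G m = {f. \<forall>gs. f gs \<noteq> 0 \<longrightarrow> gs \<in> simplices G (arity m)}"

definition tate_chain :: "('g, 'm) monoid_scheme \<Rightarrow> 'g list \<Rightarrow> ('g, 'k::field) tate"
  where "tate_chain G gs = (\<lambda>xs. if xs = gs \<and> \<one>\<^bsub>G\<^esub> \<notin> set gs then 1 else 0)"

definition tate_delta :: "('g, 'm) monoid_scheme \<Rightarrow> nat \<Rightarrow> ('g, 'k::field) tate \<Rightarrow> ('g, 'k) tate"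
  where "tate_delta G n f = (\<lambda>gs. if gs \<in> simplices G (n + 1) then
      f (tl gs) + (\<Sum>i=1..n. (-1) ^ i * f (merge G i gs)) + (-1) ^ (n + 1) * f (butlast gs)
    else 0)"

definition tate_boundary :: "('g, 'm) monoid_scheme \<Rightarrow> nat \<Rightarrow> ('g, 'k::field) tate \<Rightarrow> ('g, 'k) tate"
  where "tate_boundary G p c = (\<lambda>xs. \<Sum>gs\<in>simplices G p. c gs *
      (tate_chain G (tl gs) xs
       + (\<Sum>i=1..<p. (-1) ^ i * tate_chain G (merge G i gs) xs)
       + (-1) ^ p * tate_chain G (butlast gs) xs))"

definition tate_diff :: "('g, 'm) monoid_scheme \<Rightarrow> int \<Rightarrow> ('g, 'k::field) tate \<Rightarrow> ('g, 'k) tate"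
  where "tate_diff G m f =
    (if m \<ge> 0 then tate_delta G (nat m) f
     else if m = -1 then (\<lambda>gs. of_nat (card (carrier G)) * f gs)
     else (\<lambda>gs. (-1) ^ arity m * tate_boundary G (arity m) f gs))"

definition tate_cohomology ::
  "'k::field itself \<Rightarrow> ('g, 'm) monoid_scheme \<Rightarrow> (('g, 'k) tate set, 'k) graded_space"
  where "tate_cohomology k G =
    cohomology_space (tate_space G) (tate_diff G) (\<lambda>c f gs. c * f gs)"

definition tate_iota :: "('g, 'm) monoid_scheme \<Rightarrow> int \<Rightarrow> ('g, 'k::field) tate \<Rightarrow> ('g, 'k) hoch"
  where "tate_iota G m f =
    (if m \<ge> 0 then
      (\<lambda>gs x. if gs \<in> simplices G (arity m) then f gs * ga_of (group_prod G gs) x else 0)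
     else
      (\<lambda>xs x. \<Sum>gs\<in>simplices G (arity m). f gs *
        hoch_chain G (ga_of (group_prod G (map (\<lambda>g. inv\<^bsub>G\<^esub> g) (rev gs)))) gs xs x))"

definition iota_class ::
  "'k::field itself \<Rightarrow> ('g, 'm) monoid_scheme \<Rightarrow> int \<Rightarrow> ('g, 'k) tate set \<Rightarrow> ('g, 'k) hoch set"
  where "iota_class k G m X = (\<Union>f\<in>X. th_rel G m `` {tate_iota G m f})"

end

theory Submission
  imports Defs "HOL.Vector_Spaces"
begin

text \<open>
  The proof rests on one fact: in cohomology, the BV-operator vanishes on the image of
  \<open>\<iota>\<close>. Under \<open>\<iota>\<close> it becomes the cyclic operator \<open>B\<close> which sends \<open>[g\<^sub>1, \<dots>, g\<^sub>s]\<close> to the signed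
  sum of the rotations of \<open>(g\<^sub>0, g\<^sub>1, \<dots>, g\<^sub>s)\<close> with \<open>g\<^sub>0 = (g\<^sub>1 \<cdots> g\<^sub>s)\<^sup>-\<^sup>1\<close>: on chains this is
  Connes' operator, on cochains its transpose (\<open>th_Delta_iota\<close>). On the normalized bar complex \<open>B\<close>
  is null-homotopic. To see this, pass to homogeneous tuples \<open>x\<^sub>0 = 1, x\<^sub>i = g\<^sub>1 \<cdots> g\<^sub>i\<close>, where
  \<open>B (x\<^sub>0, \<dots>, x\<^sub>s) = \<Sum>\<^sub>j \<plusminus> (x\<^sub>j, \<dots>, x\<^sub>s, x\<^sub>0, \<dots>, x\<^sub>j)\<close>. The operator \<open>B\<close> anticommutes with the boundary,
  and the cone with apex \<open>x\<^sub>0\<close> contracts the complex of all tuples, so the method of acyclic models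
  produces a homotopy \<open>h\<close> with \<open>B = d h - h d\<close> (\<open>hom_B_null_homotopic\<close>). Because \<open>h\<close>
  respects translations and degenerate tuples, it descends to normalized bar chains
  (\<open>bar_B_null_homotopic\<close>), and composing cochains with \<open>h\<close> gives the homotopy for the transpose.
  Hence \<open>B\<close> sends Tate cocycles to coboundaries (\<open>tate_B_exact\<close>).

  The image of \<open>\<iota>\<close> itself is described by supports: a Hochschild (co)chain comes from a Tate
  (co)chain iff on each tuple it is concentrated at a single group element, the product of
  the entries or, for chains, its inverse. Reading off the coefficient there is a chain map
  (\<open>retract_diff\<close>) that is left inverse to \<open>\<iota>\<close>, so \<open>\<iota>\<close> is injective in cohomology. In each of the
  six cases of the cup product these group elements multiply correctly (\<open>supported_cup\<close>), so
  the image is closed under products.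

  On the image, therefore, products stay in the image and the BV-operator is zero, and the
  defining formula makes the bracket zero too. Every axiom that involves the operator or the
  bracket reads \<open>0 = 0\<close>, and the axioms of a graded commutative algebra are inherited
  through the injection (locale \<open>zero_delta_embedding\<close>).
\<close>

section \<open>Graded algebras with vanishing BV-operator\<close>

context graded_vector_space begin

lemma hzero_closed [simp, intro]: "hzero A n \<in> homog A n"
  using monoid.one_closed[OF group.is_monoid[OF comm_group.axioms(2)[OF hadd_comm_group[of n]]]] by simp

lemma hadd_closed: "x \<in> homog A n \<Longrightarrow> y \<in> homog A n \<Longrightarrow> hadd A n x y \<in> homog A n"
  using monoid.m_closed[OF group.is_monoid[OF comm_group.axioms(2)[OF hadd_comm_group[of n]]]] by simp

lemma hadd_zero: "x \<in> homog A n \<Longrightarrow> hadd A n (hzero A n) x = x"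
  using monoid.l_one[OF group.is_monoid[OF comm_group.axioms(2)[OF hadd_comm_group[of n]]]] by simp

lemma hadd_idem: "x \<in> homog A n \<Longrightarrow> hadd A n x x = x \<Longrightarrow> x = hzero A n"
  using group.l_cancel_one[OF comm_group.axioms(2)[OF hadd_comm_group[of n]], of x x] by simp

end

text \<open>
  A linear map sends the idempotent zero to an idempotent of the additive group, which is zero.
\<close>

lemma linear_on_hzero:
  assumes "graded_vector_space A" "graded_vector_space B" "linear_on A n B m g"
  shows "g (hzero A n) = hzero B m"
proof -
  interpret A: graded_vector_space A by fact
  interpret B: graded_vector_space B by fact
  have "hadd B m (g (hzero A n)) (g (hzero A n)) = g (hadd A n (hzero A n) (hzero A n))"
    using assms(3) by (simp add: linear_on_def)
  then show ?thesis
    using assms(3) A.hzero_closed by (intro B.hadd_idem) (auto simp: linear_on_def A.hadd_zero)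
qed

lemma (in graded_vector_space) hscale_hzero: "hscale A n c (hzero A n) = hzero A n"
proof (rule linear_on_hzero)
  show "linear_on A n A n (hscale A n c)"
    by (simp add: linear_on_def hscale_closed hscale_hadd hscale_hscale mult.commute)
qed (fact graded_vector_space_axioms)+

lemma (in graded_vector_space) linear_on_hzero_const: "linear_on B m A n (\<lambda>_. hzero A n)"
  by (simp add: linear_on_def hadd_zero hscale_hzero)

text \<open>
  Bilinearity of the product makes products with zero vanish, so with operator and bracket zero
  all remaining axioms are equations between zeros.
\<close>

lemma bv_algebra_if_zero_delta:
  fixes A :: "('a, 'k::field, 'x) bv_structure_scheme"
  assumes "graded_comm_algebra A"
    and delta: "\<And>a x. x \<in> homog A a \<Longrightarrow> hdelta A a x = hzero A (a - 1)"
    and bracket: "\<And>a b x y. x \<in> homog A a \<Longrightarrow> y \<in> homog A b \<Longrightarrow>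
      hbracket A a b x y = hzero A (a + b - 1)"
  shows "bv_algebra A"
proof -
  interpret graded_comm_algebra A by fact
  note gvs = graded_vector_space_axioms
  have cup_closed: "hcup A a b x y \<in> homog A (a + b)" if "x \<in> homog A a" "y \<in> homog A b" for a b x y
    using hcup_bilinear[of a b] that by (auto simp: bilinear_on_def linear_on_def)
  have zero_cup: "hcup A a b (hzero A a) y = hzero A (a + b)" if "y \<in> homog A b" for a b y
    using hcup_bilinear[of a b] that by (intro linear_on_hzero[OF gvs gvs]) (auto simp: bilinear_on_def)
  have cup_zero: "hcup A a b x (hzero A b) = hzero A (a + b)" if "x \<in> homog A a" for a b x
    using hcup_bilinear[of a b] that by (intro linear_on_hzero[OF gvs gvs]) (auto simp: bilinear_on_def)
  have lin: "linear_on A a A c g" if "\<And>x. x \<in> homog A a \<Longrightarrow> g x = hzero A c" for a c g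
    using that linear_on_hzero_const[of A a c] hadd_closed hscale_closed
    by (simp add: linear_on_def)
  have deg: "a - 1 + b = a + b - 1" "a + (b - 1) = a + b - 1" for a b :: int by auto
  show ?thesis
  proof
    fix a b show "bilinear_on A a b (a + b - 1) (hbracket A a b)"
      unfolding bilinear_on_def by (intro conjI ballI lin) (auto simp: bracket)
  next
    fix a show "linear_on A a A (a - 1) (hdelta A a)"
      by (rule lin) (simp add: delta)
  next
    fix a b x y assume xy: "x \<in> homog A a" "y \<in> homog A b"
    show "hbracket A a b x y = hscale A (a + b - 1) (- ksign ((a - 1) * (b - 1))) (hbracket A b a y x)"
      using xy by (simp add: bracket add.commute hscale_hzero)
    have "hcup A (a - 1) b (hzero A (a - 1)) y = hzero A (a + b - 1)"
      "hcup A a (b - 1) x (hzero A (b - 1)) = hzero A (a + b - 1)"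
      using zero_cup[of y b "a - 1"] cup_zero[of x a "b - 1"] xy by (simp_all add: deg)
    then show "hbracket A a b x y = bv_bracket (hadd A) (hscale A) (hcup A) (hdelta A) a b x y"
      using xy by (simp add: bv_bracket_def bracket delta cup_closed hscale_hzero hadd_zero)
  next
    fix a b c x y z assume xyz: "x \<in> homog A a" "y \<in> homog A b" "z \<in> homog A c"
    have deg1: "a + (b + c - 1) - 1 = a + b + c - 2" "a + b - 1 + c - 1 = a + b + c - 2"
      "b + (a + c - 1) - 1 = a + b + c - 2" "a + c - 1 + b = a + b + c - 1"
      "a + (b + c - 1) = a + b + c - 1" by auto
    show "hbracket A a (b + c - 1) x (hbracket A b c y z) =
      hadd A (a + b + c - 2) (hbracket A (a + b - 1) c (hbracket A a b x y) z)
        (hscale A (a + b + c - 2) (ksign ((a - 1) * (b - 1)))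
          (hbracket A b (a + c - 1) y (hbracket A a c x z)))"
      using xyz by (simp add: bracket deg1(1-3) hscale_hzero hadd_zero del: diff_add_eq)
    have "hcup A (a + c - 1) b (hzero A (a + c - 1)) y = hzero A (a + b + c - 1)"
      "hcup A a (b + c - 1) x (hzero A (b + c - 1)) = hzero A (a + b + c - 1)"
      using zero_cup[of y b "a + c - 1"] cup_zero[of x a "b + c - 1"] xyz by (simp_all only: deg1)
    then show "hbracket A (a + b) c (hcup A a b x y) z =
      hadd A (a + b + c - 1) (hcup A (a + c - 1) b (hbracket A a c x z) y)
        (hscale A (a + b + c - 1) (ksign (a * (c - 1))) (hcup A a (b + c - 1) x (hbracket A b c y z)))"
      using xyz by (simp add: bracket cup_closed hscale_hzero hadd_zero)
  next
    fix a x assume "x \<in> homog A a"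
    then show "hdelta A (a - 1) (hdelta A a x) = hzero A (a - 2)"
      by (simp add: delta)
  qed
qed

text \<open>
  The situation of the theorem with the complexes forgotten; \<open>V\<close> becomes Tate cohomology, \<open>B\<close>
  Tate-Hochschild cohomology and \<open>f\<close> the map induced by \<open>\<iota>\<close>.
\<close>

locale zero_delta_embedding =
  V: graded_vector_space V + B: graded_comm_algebra B
  for V :: "('a, 'k::field, 'x) graded_space_scheme"
    and B :: "('b, 'k, 'y) bv_structure_scheme" +
  fixes f :: "int \<Rightarrow> 'a \<Rightarrow> 'b"
  assumes lin: "linear_on V n B n (f n)"
    and inj: "inj_on (f n) (homog V n)"
    and unit_in_image: "hunit B \<in> f 0 ` homog V 0"
    and cup_in_image: "x \<in> homog V a \<Longrightarrow> y \<in> homog V b \<Longrightarrow>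
      hcup B a b (f a x) (f b y) \<in> f (a + b) ` homog V (a + b)"
    and delta_zero: "x \<in> homog V a \<Longrightarrow> hdelta B a (f a x) = hzero B (a - 1)"
    and bracket_eq: "hbracket B = bv_bracket (hadd B) (hscale B) (hcup B) (hdelta B)"
begin

abbreviation "S \<equiv> induced_bv_structure V B f"

lemma f_closed: "x \<in> homog V n \<Longrightarrow> f n x \<in> homog B n"
  and f_hadd: "x \<in> homog V n \<Longrightarrow> y \<in> homog V n \<Longrightarrow> f n (hadd V n x y) = hadd B n (f n x) (f n y)"
  and f_hscale: "x \<in> homog V n \<Longrightarrow> f n (hscale V n c x) = hscale B n c (f n x)"
  using lin[of n] by (auto simp: linear_on_def)

lemma f_hzero: "f n (hzero V n) = hzero B n"
  by (rule linear_on_hzero[OF V.graded_vector_space_axioms B.graded_vector_space_axioms lin])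

lemma f_eqI: "x \<in> homog V n \<Longrightarrow> y \<in> homog V n \<Longrightarrow> f n x = f n y \<Longrightarrow> x = y"
  using inj[of n] by (auto dest: inj_onD)

lemma hzero_in_image: "hzero B n \<in> f n ` homog V n"
  using f_hzero[of n] V.hzero_closed by (metis imageI)

text \<open>
  The three terms of the BV formula vanish separately: the first because the product is again
  in the image, the other two because one factor is zero.
\<close>

lemma bracket_zero:
  assumes "x \<in> homog V a" "y \<in> homog V b"
  shows "hbracket B a b (f a x) (f b y) = hzero B (a + b - 1)"
proof -
  have deg: "a - 1 + b = a + b - 1" "a + (b - 1) = a + b - 1" by auto
  note gvs = B.graded_vector_space_axioms
  obtain z where z: "z \<in> homog V (a + b)" "hcup B a b (f a x) (f b y) = f (a + b) z"
    using cup_in_image[OF assms] by blast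
  have "hcup B (a - 1) b (hzero B (a - 1)) (f b y) = hzero B (a - 1 + b)"
    using B.hcup_bilinear[of "a - 1" b] f_closed[OF assms(2)]
    by (intro linear_on_hzero[OF gvs gvs]) (auto simp: bilinear_on_def)
  moreover have "hcup B a (b - 1) (f a x) (hzero B (b - 1)) = hzero B (a + (b - 1))"
    using B.hcup_bilinear[of a "b - 1"] f_closed[OF assms(1)]
    by (intro linear_on_hzero[OF gvs gvs]) (auto simp: bilinear_on_def)
  ultimately show ?thesis
    using assms z by (simp add: bracket_eq bv_bracket_def delta_zero deg B.hscale_hzero B.hadd_zero)
qed

lemma S_simps [simp]:
  "homog S = homog V" "hadd S = hadd V" "hzero S = hzero V" "hscale S = hscale V"
  by (simp_all add: induced_bv_structure_def Let_def)

lemma S_unit: "hunit S \<in> homog V 0" "f 0 (hunit S) = hunit B"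
  using inv_into_into[OF unit_in_image] f_inv_into_f[OF unit_in_image]
  by (simp_all add: induced_bv_structure_def Let_def)

lemma S_cup:
  assumes "x \<in> homog V a" "y \<in> homog V b"
  shows "hcup S a b x y \<in> homog V (a + b)" "f (a + b) (hcup S a b x y) = hcup B a b (f a x) (f b y)"
  using inv_into_into[OF cup_in_image[OF assms]] f_inv_into_f[OF cup_in_image[OF assms]]
  by (simp_all add: induced_bv_structure_def Let_def)

lemma pull_hzero: "inv_into (homog V n) (f n) (hzero B n) = hzero V n"
  using inv_into_f_f[OF inj V.hzero_closed, of n] by (simp add: f_hzero)

lemma S_delta: "x \<in> homog V a \<Longrightarrow> hdelta S a x = hzero V (a - 1)"
  by (simp add: induced_bv_structure_def Let_def delta_zero pull_hzero)

lemma S_bracket: "x \<in> homog V a \<Longrightarrow> y \<in> homog V b \<Longrightarrow> hbracket S a b x y = hzero V (a + b - 1)"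
  by (simp add: induced_bv_structure_def Let_def bracket_zero pull_hzero)

text \<open>
  Each axiom holds after applying the injection, where it is the axiom of the target.
\<close>

lemma graded_comm_algebra_S: "graded_comm_algebra S"
proof (intro graded_comm_algebra.intro graded_comm_algebra_axioms.intro)
  show "graded_vector_space S"
    using V.graded_vector_space_axioms by (simp add: graded_vector_space_def)
next
  fix a b
  have B1: "linear_on B b B (a + b) (hcup B a b u)" if "u \<in> homog B a" for u
    using B.hcup_bilinear[of a b] that by (simp add: bilinear_on_def)
  have B2: "linear_on B a B (a + b) (\<lambda>u. hcup B a b u v)" if "v \<in> homog B b" for v
    using B.hcup_bilinear[of a b] that by (simp add: bilinear_on_def)
  have "linear_on V b V (a + b) (hcup S a b x)" if x: "x \<in> homog V a" for x
    unfolding linear_on_def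
  proof (intro conjI ballI allI)
    fix y y' c assume y: "y \<in> homog V b" and y': "y' \<in> homog V b"
    show "hcup S a b x y \<in> homog V (a + b)" by (rule S_cup[OF x y])
    show "hcup S a b x (hadd V b y y') = hadd V (a + b) (hcup S a b x y) (hcup S a b x y')"
      using B1[OF f_closed[OF x]] x y y'
      by (intro f_eqI[of _ "a + b"]) (simp_all add: S_cup V.hadd_closed f_hadd linear_on_def f_closed)
    show "hcup S a b x (hscale V b c y) = hscale V (a + b) c (hcup S a b x y)"
      using B1[OF f_closed[OF x]] x y
      by (intro f_eqI[of _ "a + b"]) (simp_all add: S_cup V.hscale_closed f_hscale linear_on_def f_closed)
  qed
  moreover have "linear_on V a V (a + b) (\<lambda>x. hcup S a b x y)" if y: "y \<in> homog V b" for y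
    unfolding linear_on_def
  proof (intro conjI ballI allI)
    fix x x' c assume x: "x \<in> homog V a" and x': "x' \<in> homog V a"
    show "hcup S a b x y \<in> homog V (a + b)" by (rule S_cup[OF x y])
    show "hcup S a b (hadd V a x x') y = hadd V (a + b) (hcup S a b x y) (hcup S a b x' y)"
      using B2[OF f_closed[OF y]] x y x'
      by (intro f_eqI[of _ "a + b"]) (simp_all add: S_cup V.hadd_closed f_hadd linear_on_def f_closed)
    show "hcup S a b (hscale V a c x) y = hscale V (a + b) c (hcup S a b x y)"
      using B2[OF f_closed[OF y]] x y
      by (intro f_eqI[of _ "a + b"]) (simp_all add: S_cup V.hscale_closed f_hscale linear_on_def f_closed)
  qed
  ultimately show "bilinear_on S a b (a + b) (hcup S a b)"
    by (simp add: bilinear_on_def linear_on_def)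
next
  fix a b c x y z assume "x \<in> homog S a" "y \<in> homog S b" "z \<in> homog S c"
  then have xyz: "x \<in> homog V a" "y \<in> homog V b" "z \<in> homog V c" by simp_all
  have 1: "hcup S (a + b) c (hcup S a b x y) z \<in> homog V (a + b + c)"
    "f (a + b + c) (hcup S (a + b) c (hcup S a b x y) z) =
      hcup B (a + b) c (hcup B a b (f a x) (f b y)) (f c z)"
    using S_cup[OF S_cup(1)[OF xyz(1,2)] xyz(3)] S_cup(2)[OF xyz(1,2)] by simp_all
  have 2: "hcup S a (b + c) x (hcup S b c y z) \<in> homog V (a + b + c)"
    "f (a + b + c) (hcup S a (b + c) x (hcup S b c y z)) =
      hcup B a (b + c) (f a x) (hcup B b c (f b y) (f c z))"
    using S_cup[OF xyz(1) S_cup(1)[OF xyz(2,3)]] S_cup(2)[OF xyz(2,3)] by (simp_all add: add.assoc)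
  show "hcup S (a + b) c (hcup S a b x y) z = hcup S a (b + c) x (hcup S b c y z)"
    by (rule f_eqI[OF 1(1) 2(1)]) (simp add: 1 2 B.hcup_assoc f_closed xyz)
next
  fix a b x y assume "x \<in> homog S a" "y \<in> homog S b"
  then have xy: "x \<in> homog V a" "y \<in> homog V b" by simp_all
  have yx: "hcup S b a y x \<in> homog V (a + b)" "f (a + b) (hcup S b a y x) = hcup B b a (f b y) (f a x)"
    using S_cup[OF xy(2,1)] by (simp_all add: add.commute)
  have "hcup S a b x y = hscale V (a + b) (ksign (a * b)) (hcup S b a y x)"
    by (rule f_eqI[of _ "a + b"])
      (simp_all add: S_cup xy V.hscale_closed yx f_hscale B.hcup_comm[OF f_closed[OF xy(1)] f_closed[OF xy(2)]])
  then show "hcup S a b x y = hscale S (a + b) (ksign (a * b)) (hcup S b a y x)" by simp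
next
  show "hunit S \<in> homog S 0" using S_unit by simp
next
  fix a x assume "x \<in> homog S a"
  then have x: "x \<in> homog V a" by simp
  show "hcup S 0 a (hunit S) x = x"
    using S_cup[OF S_unit(1) x] x by (intro f_eqI[of _ a]) (simp_all add: S_unit B.hunit_left f_closed)
  show "hcup S a 0 x (hunit S) = x"
    using S_cup[OF x S_unit(1)] x by (intro f_eqI[of _ a]) (simp_all add: S_unit B.hunit_right f_closed)
qed

lemma bv_algebra_S: "bv_algebra S"
  by (rule bv_algebra_if_zero_delta[OF graded_comm_algebra_S]) (simp_all add: S_delta S_bracket)

lemma bv_hom_S: "bv_hom S B f"
  using lin unfolding bv_hom_def
  by (simp add: linear_on_def S_unit S_cup S_delta S_bracket delta_zero bracket_zero f_hzero)

end

section \<open>Cohomology of linear complexes and split chain maps\<close>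

text \<open>
  A family of subspaces with linear differentials, as far as cohomology needs it: classes are taken
  among cocycles, and two of them are identified when they differ by a value of \<open>d\<close>.
\<close>

locale linear_complex = vector_space scale
  for scale :: "'k::field \<Rightarrow> 'c::ab_group_add \<Rightarrow> 'c" +
  fixes C :: "int \<Rightarrow> 'c set" and d :: "int \<Rightarrow> 'c \<Rightarrow> 'c"
  assumes subspace_C: "subspace (C n)"
    and d_add: "a \<in> C n \<Longrightarrow> b \<in> C n \<Longrightarrow> d n (a + b) = d n a + d n b"
    and d_scale: "a \<in> C n \<Longrightarrow> d n (scale c a) = scale c (d n a)"
begin

abbreviation "Z \<equiv> cocycles C d"
abbreviation "R \<equiv> cohomologous C d"
abbreviation "H \<equiv> cohomology_space C d scale"

lemma d_zero: "d n 0 = 0"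
  using d_scale[OF subspace_0[OF subspace_C], of n 0] by simp

lemma subspace_cocycles: "subspace (Z n)"
  using subspace_C[of n] by (auto simp: subspace_def cocycles_def d_zero d_add d_scale)

lemma subspace_coboundaries: "subspace (d n ` C n)"
  unfolding subspace_def
proof (intro conjI ballI allI)
  show "0 \<in> d n ` C n" using d_zero subspace_0[OF subspace_C] by (metis imageI)
  show "x + y \<in> d n ` C n" if "x \<in> d n ` C n" "y \<in> d n ` C n" for x y
    using that subspace_add[OF subspace_C] by (auto simp flip: d_add)
  show "scale c x \<in> d n ` C n" if "x \<in> d n ` C n" for c x
    using that subspace_scale[OF subspace_C] by (auto simp flip: d_scale)
qed

lemma equiv_R: "equiv (Z n) (R n)"
proof (rule equivI)
  note B = subspace_coboundaries[of "n - 1"]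
  show "R n \<subseteq> Z n \<times> Z n" by (auto simp: cohomologous_def)
  show "refl_on (Z n) (R n)"
    using subspace_0[OF B] by (auto simp: refl_on_def cohomologous_def)
  show "sym (R n)"
  proof (rule symI)
    fix a b assume "(a, b) \<in> R n"
    then show "(b, a) \<in> R n" using subspace_neg[OF B, of "a - b"] by (simp add: cohomologous_def)
  qed
  show "trans (R n)"
  proof (rule transI)
    fix a b c assume "(a, b) \<in> R n" "(b, c) \<in> R n"
    then show "(a, c) \<in> R n" using subspace_add[OF B, of "a - b" "b - c"] by (simp add: cohomologous_def)
  qed
qed

lemma class_eq_iff: "a \<in> Z n \<Longrightarrow> b \<in> Z n \<Longrightarrow> R n `` {a} = R n `` {b} \<longleftrightarrow> a - b \<in> d (n - 1) ` C (n - 1)"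
  using eq_equiv_class_iff[OF equiv_R] by (simp add: cohomologous_def)

lemma homog_H: "homog H n = (\<lambda>a. R n `` {a}) ` Z n"
  by (auto simp: cohomology_space_def quotient_def)

lemma hzero_H: "hzero H n = R n `` {0}"
  by (simp add: cohomology_space_def)

lemma hadd_H:
  assumes "a \<in> Z n" "b \<in> Z n"
  shows "hadd H n (R n `` {a}) (R n `` {b}) = R n `` {a + b}"
proof -
  have "congruent2 (R n) (R n) (\<lambda>a b. R n `` {a + b})"
  proof (rule congruent2I')
    fix a a' b b' assume *: "(a, a') \<in> R n" "(b, b') \<in> R n"
    then have "(a - a') + (b - b') \<in> d (n - 1) ` C (n - 1)"
      using subspace_add[OF subspace_coboundaries] by (simp add: cohomologous_def)
    then show "R n `` {a + b} = R n `` {a' + b'}"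
      using * subspace_add[OF subspace_cocycles]
      by (subst class_eq_iff) (auto simp: cohomologous_def algebra_simps)
  qed
  then show ?thesis
    using UN_equiv_class2[OF equiv_R equiv_R _ assms] by (simp add: cohomology_space_def)
qed

lemma hscale_H:
  assumes "a \<in> Z n"
  shows "hscale H n c (R n `` {a}) = R n `` {scale c a}"
proof -
  have "congruent (R n) (\<lambda>a. R n `` {scale c a})"
  proof (rule congruentI)
    fix a a' assume *: "(a, a') \<in> R n"
    then have "scale c (a - a') \<in> d (n - 1) ` C (n - 1)"
      using subspace_scale[OF subspace_coboundaries] by (simp add: cohomologous_def)
    then show "R n `` {scale c a} = R n `` {scale c a'}"
      using * subspace_scale[OF subspace_cocycles]
      by (subst class_eq_iff) (auto simp: cohomologous_def scale_right_diff_distrib)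
  qed
  then show ?thesis
    using UN_equiv_class[OF equiv_R _ assms] by (simp add: cohomology_space_def)
qed

lemma graded_vector_space_H: "graded_vector_space H"
proof (rule graded_vector_space.intro)
  note Z = subspace_0[OF subspace_cocycles] subspace_add[OF subspace_cocycles]
    subspace_scale[OF subspace_cocycles] subspace_neg[OF subspace_cocycles]
  fix n
  show "comm_group \<lparr>carrier = homog H n, mult = hadd H n, one = hzero H n\<rparr>"
  proof (rule comm_groupI, simp_all only: partial_object.select_convs monoid.select_convs)
    fix x y assume "x \<in> homog H n" "y \<in> homog H n"
    then show "hadd H n x y \<in> homog H n" "hadd H n x y = hadd H n y x"
      by (auto simp: homog_H hadd_H Z add.commute)
  next
    fix x y z assume "x \<in> homog H n" "y \<in> homog H n" "z \<in> homog H n"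
    then show "hadd H n (hadd H n x y) z = hadd H n x (hadd H n y z)"
      by (auto simp: homog_H hadd_H Z add.assoc)
  next
    show "hzero H n \<in> homog H n" by (auto simp: homog_H hzero_H Z)
  next
    fix x assume "x \<in> homog H n"
    then obtain a where a: "a \<in> Z n" "x = R n `` {a}" by (auto simp: homog_H)
    then show "hadd H n (hzero H n) x = x" by (simp add: hzero_H hadd_H Z)
    show "\<exists>y\<in>homog H n. hadd H n y x = hzero H n"
      by (rule bexI[of _ "R n `` {- a}"]) (use a in \<open>auto simp: hzero_H hadd_H Z homog_H\<close>)
  qed
  show "hscale H n c x \<in> homog H n" if "x \<in> homog H n" for c x
    using that by (auto simp: homog_H hscale_H Z)
  show "hscale H n 1 x = x" if "x \<in> homog H n" for x
    using that by (auto simp: homog_H hscale_H Z)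
  show "hscale H n (c + e) x = hadd H n (hscale H n c x) (hscale H n e x)"
    if "x \<in> homog H n" for c e x
    using that by (auto simp: homog_H hscale_H hadd_H Z scale_left_distrib)
  show "hscale H n c (hscale H n e x) = hscale H n (c * e) x"
    if "x \<in> homog H n" for c e x
    using that by (auto simp: homog_H hscale_H Z)
  show "hscale H n c (hadd H n x y) = hadd H n (hscale H n c x) (hscale H n c y)"
    if "x \<in> homog H n" "y \<in> homog H n" for c x y
    using that by (auto simp: homog_H hscale_H hadd_H Z scale_right_distrib)
qed

end

text \<open>
  What the retraction is for: if \<open>f a - f b = d z\<close>, then \<open>f (a - b) = d z\<close>,
  and applying the retraction gives \<open>a - b = d (r z)\<close>; so \<open>f\<close> is injective in cohomology.
\<close>

locale split_chain_map =
  src: linear_complex scale C d + tgt: linear_complex scale' C' d'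
  for scale :: "'k::field \<Rightarrow> 'c::ab_group_add \<Rightarrow> 'c" and C d
    and scale' :: "'k \<Rightarrow> 'e::ab_group_add \<Rightarrow> 'e" and C' d' +
  fixes f :: "int \<Rightarrow> 'c \<Rightarrow> 'e" and r :: "int \<Rightarrow> 'e \<Rightarrow> 'c"
  assumes f_closed: "a \<in> C n \<Longrightarrow> f n a \<in> C' n"
    and f_add: "a \<in> C n \<Longrightarrow> b \<in> C n \<Longrightarrow> f n (a + b) = f n a + f n b"
    and f_scale: "a \<in> C n \<Longrightarrow> f n (scale c a) = scale' c (f n a)"
    and f_d: "a \<in> C n \<Longrightarrow> f (n + 1) (d n a) = d' n (f n a)"
    and r_closed: "z \<in> C' n \<Longrightarrow> r n z \<in> C n"
    and r_d: "z \<in> C' n \<Longrightarrow> r (n + 1) (d' n z) = d n (r n z)"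
    and r_f: "a \<in> C n \<Longrightarrow> r n (f n a) = a"
begin

definition induced :: "int \<Rightarrow> 'c set \<Rightarrow> 'e set"
  where "induced n X = (\<Union>a\<in>X. tgt.R n `` {f n a})"

lemma f_diff: "a \<in> C n \<Longrightarrow> b \<in> C n \<Longrightarrow> f n (a - b) = f n a - f n b"
  using f_add[of "a - b" n b] src.subspace_diff[OF src.subspace_C] by (simp add: eq_diff_eq)

lemma f_zero: "f n 0 = 0"
  using f_diff[of 0 n 0] src.subspace_0[OF src.subspace_C] by simp

lemma f_cocycle: "a \<in> src.Z n \<Longrightarrow> f n a \<in> tgt.Z n"
  using f_d[of a n] by (simp add: cocycles_def f_closed f_zero)

lemma induced_class:
  assumes "a \<in> src.Z n"
  shows "induced n (src.R n `` {a}) = tgt.R n `` {f n a}"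
proof -
  have "congruent (src.R n) (\<lambda>a. tgt.R n `` {f n a})"
  proof (rule congruentI)
    fix a b assume *: "(a, b) \<in> src.R n"
    then obtain z where z: "z \<in> C (n - 1)" "a - b = d (n - 1) z" by (auto simp: cohomologous_def)
    have ab: "a \<in> src.Z n" "b \<in> src.Z n" using * by (auto simp: cohomologous_def)
    then have "f n a - f n b = d' (n - 1) (f (n - 1) z)"
      using f_d[OF z(1)] f_diff[of a n b] z(2) by (simp add: cocycles_def)
    then show "tgt.R n `` {f n a} = tgt.R n `` {f n b}"
      using tgt.class_eq_iff[OF f_cocycle[OF ab(1)] f_cocycle[OF ab(2)]] f_closed[OF z(1)] by blast
  qed
  then show ?thesis
    unfolding induced_def by (rule UN_equiv_class[OF src.equiv_R _ assms])
qed

lemma induced_image: "induced n ` homog src.H n = (\<lambda>a. tgt.R n `` {f n a}) ` src.Z n"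
  by (simp add: src.homog_H image_image induced_class cong: image_cong)

lemma linear_on_induced: "linear_on src.H n tgt.H n (induced n)"
  unfolding linear_on_def
proof (intro conjI ballI allI)
  note Z = src.subspace_add[OF src.subspace_cocycles] src.subspace_scale[OF src.subspace_cocycles]
  have C: "a \<in> C n" if "a \<in> src.Z n" for a using that by (simp add: cocycles_def)
  fix x y c assume "x \<in> homog src.H n" "y \<in> homog src.H n"
  then obtain a b where a: "a \<in> src.Z n" "x = src.R n `` {a}" and b: "b \<in> src.Z n" "y = src.R n `` {b}"
    by (auto simp: src.homog_H)
  show "induced n x \<in> homog tgt.H n" using a by (simp add: induced_class tgt.homog_H f_cocycle)
  show "induced n (hadd src.H n x y) = hadd tgt.H n (induced n x) (induced n y)"
    using a b by (simp add: induced_class src.hadd_H tgt.hadd_H f_cocycle Z f_add C)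
  show "induced n (hscale src.H n c x) = hscale tgt.H n c (induced n x)"
    using a by (simp add: induced_class src.hscale_H tgt.hscale_H f_cocycle Z f_scale C)
qed

lemma inj_on_induced: "inj_on (induced n) (homog src.H n)"
proof (rule inj_onI)
  fix x y assume "x \<in> homog src.H n" "y \<in> homog src.H n" and eq: "induced n x = induced n y"
  then obtain a b where a: "a \<in> src.Z n" "x = src.R n `` {a}" and b: "b \<in> src.Z n" "y = src.R n `` {b}"
    by (auto simp: src.homog_H)
  have C: "a \<in> C n" "b \<in> C n" using a b by (simp_all add: cocycles_def)
  obtain z where z: "z \<in> C' (n - 1)" "f n a - f n b = d' (n - 1) z"
    using eq a b tgt.class_eq_iff[OF f_cocycle[OF a(1)] f_cocycle[OF b(1)]] by (auto simp: induced_class)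
  have "a - b = r n (f n (a - b))"
    using r_f src.subspace_diff[OF src.subspace_C C] by simp
  also have "\<dots> = d (n - 1) (r (n - 1) z)"
    using r_d[OF z(1)] z(2) by (simp add: f_diff C)
  finally show "x = y"
    using src.class_eq_iff[OF a(1) b(1)] r_closed[OF z(1)] a b by blast
qed

end

section \<open>The cyclic operator on homogeneous tuples\<close>

definition del_nth :: "nat \<Rightarrow> 'a list \<Rightarrow> 'a list"
  where "del_nth i xs = take i xs @ drop (Suc i) xs"

text \<open>
  For a tuple \<open>x\<^sub>0, \<dots>, x\<^sub>s\<close> this is \<open>x\<^sub>j, \<dots>, x\<^sub>s, x\<^sub>0, \<dots>, x\<^sub>j\<close>: the rotation, closed up by repeating
  its first entry. All operators below act on functions of tuples, so they are the transposes of
  the operators on chains.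
\<close>

definition rot_closed :: "nat \<Rightarrow> 'a list \<Rightarrow> 'a list"
  where "rot_closed j xs = drop j xs @ take (Suc j) xs"

definition hom_d :: "('a list \<Rightarrow> 'k::comm_ring_1) \<Rightarrow> 'a list \<Rightarrow> 'k"
  where "hom_d F xs = (\<Sum>i<length xs. (-1) ^ i * F (del_nth i xs))"

definition hom_B :: "('a list \<Rightarrow> 'k::comm_ring_1) \<Rightarrow> 'a list \<Rightarrow> 'k"
  where "hom_B F xs = (\<Sum>j<length xs. (-1) ^ (Suc j * (length xs - 1)) * F (rot_closed j xs))"

text \<open>
  The acyclic-models recursion on chains is \<open>h \<sigma> = x\<^sub>0 * (B \<sigma> + h (d \<sigma>))\<close>, where \<open>x\<^sub>0 * \<tau>\<close> prefixes the first
  vertex of \<open>\<sigma>\<close>. Modulo degenerate tuples only the face that omits \<open>x\<^sub>0\<close> survives in \<open>h (d \<sigma>)\<close>, since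
  \<open>h\<close> of any other face starts with \<open>x\<^sub>0\<close> already. This gives
  \<open>h (x\<^sub>0, \<dots>, x\<^sub>s) = x\<^sub>0 * B (x\<^sub>0, \<dots>, x\<^sub>s) + x\<^sub>0 * h (x\<^sub>1, \<dots>, x\<^sub>s)\<close>, transposed here.
\<close>

fun hom_h :: "('a list \<Rightarrow> 'k::comm_ring_1) \<Rightarrow> 'a list \<Rightarrow> 'k" where
  "hom_h F [] = 0"
| "hom_h F (x # xs) = hom_B (\<lambda>ys. F (x # ys)) (x # xs) + hom_h (\<lambda>ys. F (x # ys)) xs"

text \<open>
  Functions that vanish on degenerate tuples are the homogeneous form of normalized cochains.
\<close>

definition nondeg :: "('a list \<Rightarrow> 'k::comm_ring_1) \<Rightarrow> bool"
  where "nondeg F \<longleftrightarrow> (\<forall>xs. \<not> distinct_adj xs \<longrightarrow> F xs = 0)"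

lemma hom_d_Nil [simp]: "hom_d F [] = 0"
  by (simp add: hom_d_def)

lemma hom_d_Cons: "hom_d F (x # xs) = F xs - hom_d (\<lambda>ys. F (x # ys)) xs"
  by (simp add: hom_d_def del_nth_def sum.lessThan_Suc_shift sum_negf del: sum.lessThan_Suc)

lemma hom_d_add: "hom_d (\<lambda>ys. F ys + F' ys) xs = hom_d F xs + hom_d F' xs"
  by (simp add: hom_d_def sum.distrib algebra_simps)

lemma hom_B_diff: "hom_B (\<lambda>ys. F ys - F' ys) xs = hom_B F xs - hom_B F' xs"
  by (simp add: hom_B_def sum_subtractf algebra_simps)

lemma hom_h_diff: "hom_h (\<lambda>ys. F ys - F' ys) xs = hom_h F xs - hom_h F' xs"
  by (induction xs arbitrary: F F') (simp_all add: hom_B_diff algebra_simps)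

lemma del_rot_closed:
  assumes "j < i" "i < length xs"
  shows "del_nth (i - j) (rot_closed j xs) = rot_closed j (del_nth i xs)"
  using assms by (simp add: del_nth_def rot_closed_def min_def drop_take)

lemma del_rot_closed':
  assumes "i < j" "j < length xs"
  shows "del_nth (length xs - j + i) (rot_closed j xs) = rot_closed (j - 1) (del_nth i xs)"
  using assms by (simp add: del_nth_def rot_closed_def min_def drop_take)

lemma del_rot_closed_first:
  assumes "j < length xs"
  shows "del_nth 0 (rot_closed j xs) = drop (Suc j) xs @ take (Suc j) xs"
  using assms by (simp add: del_nth_def rot_closed_def drop_Suc tl_drop)

lemma del_rot_closed_last:
  assumes "j < length xs"
  shows "del_nth (length xs) (rot_closed j xs) = drop j xs @ take j xs"
  using assms by (auto simp: del_nth_def rot_closed_def take_Suc_conv_app_nth)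

lemma minus_one_power_parity_neg:
  "odd (m + n) \<Longrightarrow> (-1) ^ m = (- ((-1) ^ n) :: 'k::comm_ring_1)"
  by (cases "even m") auto

text \<open>
  Deleting an inner entry \<open>x\<^sub>i\<close> from the rotation starting at \<open>x\<^sub>j\<close> gives a rotation of the tuple with
  \<open>x\<^sub>i\<close> deleted, and the signs are opposite. Deleting one of the two copies of \<open>x\<^sub>j\<close> gives a plain
  rotation of the tuple; each plain rotation arises twice, once by deleting a first and once by
  deleting a last entry, and these terms telescope around the cycle.
\<close>

lemma hom_B_anticommutes:
  fixes F :: "'a list \<Rightarrow> 'k::comm_ring_1"
  shows "hom_d (hom_B F) xs = - hom_B (hom_d F) xs"
proof (cases "xs = []")
  case True
  then show ?thesis by (simp add: hom_B_def)
next
  case False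
  define n where "n = length xs"
  have n: "n > 0" using False by (simp add: n_def)
  \<comment> \<open>\<open>W j\<close> is the plain rotation, \<open>T j i\<close> the closed rotation at \<open>x\<^sub>j\<close> without \<open>x\<^sub>i\<close>, and \<open>e j i\<close> the sign with
    which the latter occurs; for \<open>i < j\<close> the entry \<open>x\<^sub>i\<close> sits behind the \<open>n - j\<close> entries \<open>x\<^sub>j, \<dots>\<close>.\<close>
  define S :: "nat \<Rightarrow> 'k" where "S j = (-1) ^ (j * (n - 1))" for j
  define W where "W j = F (drop j xs @ take j xs)" for j
  define T where "T j i = F (rot_closed (if i < j then j - 1 else j) (del_nth i xs))" for j i
  define e :: "nat \<Rightarrow> nat \<Rightarrow> 'k" where "e j i = (if i < j then (-1) ^ (n - j + i) else (-1) ^ (i - j))" for j i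
  have d_rot: "hom_d F (rot_closed j xs) =
      W (Suc j) + (-1) ^ n * W j + (\<Sum>i\<in>{..<n} - {j}. e j i * T j i)" if j: "j < n" for j
  proof -
    have len: "length (rot_closed j xs) = Suc n"
      using j by (simp add: rot_closed_def n_def)
    define p where "p i = (if i < j then n - j + i else i - j)" for i
    have bij: "bij_betw p ({..<n} - {j}) {1..<n}"
      by (rule bij_betw_byWitness[where f' = "\<lambda>q. if q < n - j then q + j else q - (n - j)"])
        (use j in \<open>auto simp: p_def\<close>)
    have "(\<Sum>q\<in>{1..<n}. (-1) ^ q * F (del_nth q (rot_closed j xs))) =
        (\<Sum>i\<in>{..<n} - {j}. (-1) ^ p i * F (del_nth (p i) (rot_closed j xs)))"
      by (rule sum.reindex_bij_betw[OF bij, symmetric])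
    also have "\<dots> = (\<Sum>i\<in>{..<n} - {j}. e j i * T j i)"
    proof (rule sum.cong)
      fix i assume i: "i \<in> {..<n} - {j}"
      show "(-1) ^ p i * F (del_nth (p i) (rot_closed j xs)) = e j i * T j i"
      proof (cases "i < j")
        case True
        then show ?thesis using del_rot_closed'[of i j xs] j by (simp add: e_def T_def p_def n_def)
      next
        case False
        then show ?thesis using del_rot_closed[of j i xs] i by (simp add: e_def T_def p_def n_def)
      qed
    qed simp
    finally have mid: "(\<Sum>q\<in>{1..<n}. (-1) ^ q * F (del_nth q (rot_closed j xs))) =
       (\<Sum>i\<in>{..<n} - {j}. e j i * T j i)" .
    have set: "{..<Suc n} = insert 0 (insert n {1..<n})" using n by auto
    show ?thesis
      unfolding hom_d_def len set using n j mid
      by (simp add: del_rot_closed_first del_rot_closed_last n_def W_def)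
  qed
  have "hom_B (hom_d F) xs = (\<Sum>j<n. S (Suc j) * hom_d F (rot_closed j xs))"
    by (simp add: hom_B_def S_def n_def)
  also have "\<dots> = (\<Sum>j<n. S (Suc j) * W (Suc j) - S j * W j)
      + (\<Sum>j<n. \<Sum>i\<in>{..<n} - {j}. S (Suc j) * (e j i * T j i))"
  proof -
    have "S (Suc j) * (-1) ^ n = - S j" for j
      unfolding S_def power_add[symmetric] using n
      by (intro minus_one_power_parity_neg) (cases n, auto)
    then have "S (Suc j) * ((-1) ^ n * W j) = - (S j * W j)" for j
      by (metis mult.assoc mult_minus_left)
    then show ?thesis
      by (simp add: d_rot sum.distrib[symmetric] sum_distrib_left algebra_simps)
  qed
  also have "(\<Sum>j<n. S (Suc j) * W (Suc j) - S j * W j) = S n * W n - S 0 * W 0"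
    by (rule sum_lessThan_telescope)
  also have "\<dots> = 0"
  proof -
    have "S n = 1" unfolding S_def using n by (cases n) auto
    then show ?thesis by (simp add: S_def W_def n_def)
  qed
  finally have Bd: "hom_B (hom_d F) xs =
      (\<Sum>j<n. \<Sum>i\<in>{..<n} - {j}. S (Suc j) * (e j i * T j i))" by simp
  have B_del: "hom_B F (del_nth i xs) =
      (\<Sum>j\<in>{..<n} - {i}. (-1) ^ (Suc (if i < j then j - 1 else j) * (n - 2)) * T j i)" if i: "i < n" for i
  proof -
    have len: "length (del_nth i xs) = n - 1"
      using i by (simp add: del_nth_def n_def)
    have bij: "bij_betw (\<lambda>j. if i < j then j - 1 else j) ({..<n} - {i}) {..<n - 1}"
      by (rule bij_betw_byWitness[where f' = "\<lambda>q. if q < i then q else Suc q"])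
        (use i in \<open>auto\<close>)
    show ?thesis
      unfolding hom_B_def len T_def sum.reindex_bij_betw[OF bij, symmetric]
      by (simp add: numeral_2_eq_2)
  qed
  have "hom_d (hom_B F) xs = (\<Sum>i<n. \<Sum>j\<in>{..<n} - {i}.
      (-1) ^ i * ((-1) ^ (Suc (if i < j then j - 1 else j) * (n - 2)) * T j i))"
    by (simp add: hom_d_def n_def[symmetric] B_del sum_distrib_left)
  also have "\<dots> = (\<Sum>i<n. \<Sum>j\<in>{..<n} - {i}. - (S (Suc j) * (e j i * T j i)))"
  proof (intro sum.cong refl)
    fix i j assume "i \<in> {..<n}" "j \<in> {..<n} - {i}"
    then have ij: "i < n" "j < n" "i \<noteq> j" by auto
    then have "2 \<le> n" by linarith
    then obtain r where r: "n = r + 2" by (metis add.commute le_Suc_ex)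
    have "(-1) ^ i * (-1) ^ (Suc (if i < j then j - 1 else j) * (n - 2)) = - (S (Suc j) * e j i)"
    proof (cases "i < j")
      case True
      obtain q where q: "j = Suc q" using True by (cases j) auto
      obtain m where m: "r + 2 = Suc q + m"
        using ij(2) r q by (metis less_imp_le le_Suc_ex)
      have "even m \<longleftrightarrow> even (r + q + 1)" using m by presburger
      then have "odd ((i + Suc q * r) + (Suc (Suc q) * Suc r + (m + i)))"
        by (cases "even r"; cases "even q") simp_all
      then have "(-1) ^ (i + Suc q * r) = - ((-1) ^ (Suc (Suc q) * Suc r + (m + i)) :: 'k)"
        by (rule minus_one_power_parity_neg)
      moreover have "n - j = m" "n - 1 = Suc r" using m r q by auto
      ultimately show ?thesis using True q r by (simp add: S_def e_def flip: power_add
            del: power_Suc mult_Suc mult_Suc_right add_Suc add_Suc_right)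
    next
      case False
      then obtain m where m: "i = j + m" using le_Suc_ex not_less by blast
      have "odd ((i + Suc j * r) + (Suc j * Suc r + m))"
        unfolding m by (cases "even r"; cases "even j"; cases "even m") simp_all
      then have "(-1) ^ (i + Suc j * r) = - ((-1) ^ (Suc j * Suc r + m) :: 'k)"
        by (rule minus_one_power_parity_neg)
      moreover have "i - j = m" "n - 1 = Suc r" using m r by auto
      ultimately show ?thesis using False r by (simp add: S_def e_def flip: power_add
            del: power_Suc mult_Suc mult_Suc_right add_Suc add_Suc_right)
    qed
    then show "(-1) ^ i * ((-1) ^ (Suc (if i < j then j - 1 else j) * (n - 2)) * T j i) =
      - (S (Suc j) * (e j i * T j i))"
      by (simp only: mult.assoc[symmetric] mult_minus_left)
  qed
  also have "\<dots> = - (\<Sum>j<n. \<Sum>i\<in>{..<n} - {j}. S (Suc j) * (e j i * T j i))"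
  proof -
    have set: "{..<n} - {i} = {j\<in>{..<n}. j \<noteq> i}" for i by auto
    have "(\<Sum>i<n. \<Sum>j\<in>{j\<in>{..<n}. j \<noteq> i}. - (S (Suc j) * (e j i * T j i))) =
        (\<Sum>j<n. \<Sum>i\<in>{i\<in>{..<n}. j \<noteq> i}. - (S (Suc j) * (e j i * T j i)))"
      by (rule sum.swap_restrict) auto
    moreover have "{i\<in>{..<n}. j \<noteq> i} = {..<n} - {j}" for j by auto
    ultimately show ?thesis by (simp add: set sum_negf)
  qed
  finally show ?thesis using Bd by simp
qed

lemma nondeg_Cons: "nondeg F \<Longrightarrow> nondeg (\<lambda>ys. F (x # ys))"
  unfolding nondeg_def by (metis distinct_adj_ConsD)

text \<open>
  Repeating the first entry at the end keeps together the two neighbours that the rotation would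
  separate, so a repetition in the tuple survives.
\<close>

lemma not_distinct_adj_rot_closed:
  assumes "\<not> distinct_adj xs" "j < length xs"
  shows "\<not> distinct_adj (rot_closed j xs)"
proof -
  define us x vs where "us = take j xs" and "x = xs ! j" and "vs = drop (Suc j) xs"
  have xs: "xs = us @ x # vs" using assms(2) by (simp add: us_def x_def vs_def id_take_nth_drop)
  have rot: "rot_closed j xs = (x # vs) @ us @ [x]"
    using assms(2) by (simp add: rot_closed_def us_def x_def vs_def Cons_nth_drop_Suc take_Suc_conv_app_nth)
  show ?thesis
    unfolding rot using assms(1)[unfolded xs]
    by (auto simp: distinct_adj_append_iff distinct_adj_Cons split: list.splits)
qed

lemma nondeg_hom_B: "nondeg F \<Longrightarrow> nondeg (hom_B F)"
  unfolding nondeg_def hom_B_def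
  by (auto intro!: sum.neutral simp: not_distinct_adj_rot_closed)

lemma hom_h_zero:
  fixes F :: "'a list \<Rightarrow> 'k::comm_ring_1"
  assumes "\<And>ys. F (x # ys) = 0"
  shows "hom_h F (x # xs) = 0"
proof -
  have "hom_h (\<lambda>_. 0 :: 'k) ys = 0" for ys :: "'a list"
    by (induction ys) (simp_all add: hom_B_def)
  then show ?thesis using assms by (simp add: hom_B_def)
qed

lemma nondeg_hom_h:
  assumes "nondeg F" shows "nondeg (hom_h F)"
proof -
  have "\<not> distinct_adj xs \<Longrightarrow> hom_h F xs = 0" for xs
    using assms
  proof (induction xs arbitrary: F)
    case (Cons x xs)
    have "hom_B (\<lambda>ys. F (x # ys)) (x # xs) = 0"
      using nondeg_hom_B[OF nondeg_Cons[OF Cons.prems(2)]] Cons.prems(1) by (simp add: nondeg_def)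
    moreover have "hom_h (\<lambda>ys. F (x # ys)) xs = 0"
    proof (cases "distinct_adj xs")
      case True
      then obtain zs where zs: "xs = x # zs" using Cons.prems(1)
        by (cases xs) auto
      show ?thesis unfolding zs
        by (rule hom_h_zero) (use Cons.prems(2) in \<open>auto simp: nondeg_def\<close>)
    next
      case False
      then show ?thesis by (rule Cons.IH) (rule nondeg_Cons[OF Cons.prems(2)])
    qed
    ultimately show ?case by simp
  qed simp
  then show ?thesis by (simp add: nondeg_def)
qed

text \<open>
  If the first two entries agree, the two faces omitting one of them cancel.
\<close>

lemma nondeg_hom_d:
  assumes "nondeg F" shows "nondeg (hom_d F)"
proof -
  have "\<not> distinct_adj xs \<Longrightarrow> hom_d F xs = 0" for xs
    using assms
  proof (induction xs arbitrary: F)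
    case (Cons x xs)
    show ?case
    proof (cases "distinct_adj xs")
      case True
      then obtain zs where zs: "xs = x # zs" using Cons.prems(1)
        by (cases xs) (auto simp: distinct_adj_Cons)
      have "F (x # x # ys) = 0" for ys using Cons.prems(2) by (auto simp: nondeg_def)
      then show ?thesis by (simp add: zs hom_d_Cons) (simp add: hom_d_def)
    next
      case False
      then show ?thesis using Cons.IH[OF False nondeg_Cons[OF Cons.prems(2)]] Cons.prems(2)
        by (simp add: hom_d_Cons nondeg_def)
    qed
  qed simp
  then show ?thesis by (simp add: nondeg_def)
qed

text \<open>
  Induction on the tuple. With \<open>F\<^sub>x\<close> the function \<open>ys \<mapsto> F (x # ys)\<close>, the recursions for \<open>d\<close> and \<open>h\<close>
  express \<open>h (d F) - d (h F)\<close> on \<open>x # xs\<close> through \<open>B F\<close>, the anticommutator of \<open>d\<close> and \<open>B\<close> on \<open>F\<^sub>x\<close>, which is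
  zero, and the same difference for \<open>F\<^sub>x\<close> on the shorter tuple \<open>xs\<close>, which is \<open>B F\<^sub>x\<close> by
  induction and cancels against a term left over from the recursion for \<open>d\<close>.
\<close>

lemma hom_B_null_homotopic:
  assumes "nondeg F"
  shows "hom_B F xs = hom_h (hom_d F) xs - hom_d (hom_h F) xs"
  using assms
proof (induction xs arbitrary: F)
  case Nil
  then show ?case by (simp add: hom_B_def)
next
  case (Cons x xs)
  define Fx where "Fx = (\<lambda>ys. F (x # ys))"
  have IH: "hom_h (hom_d Fx) xs = hom_B Fx xs + hom_d (hom_h Fx) xs"
    using Cons.IH nondeg_Cons[OF Cons.prems] by (simp add: Fx_def)
  have hd: "hom_h (hom_d F) (x # xs) =
      hom_B F (x # xs) - hom_B (hom_d Fx) (x # xs) + hom_h F xs - hom_h (hom_d Fx) xs"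
    by (simp add: hom_d_Cons[abs_def] hom_B_diff hom_h_diff Fx_def)
  have dh: "hom_d (hom_h F) (x # xs) =
      hom_h F xs - hom_d (\<lambda>ys. hom_B Fx (x # ys)) xs - hom_d (hom_h Fx) xs"
    by (simp add: hom_d_Cons hom_d_add Fx_def)
  have dB: "hom_d (\<lambda>ys. hom_B Fx (x # ys)) xs = hom_B Fx xs + hom_B (hom_d Fx) (x # xs)"
    using hom_B_anticommutes[of Fx "x # xs"] by (simp add: hom_d_Cons algebra_simps)
  show ?case unfolding hd dh dB IH by simp
qed

lemma hom_d_cong:
  assumes "\<And>ys. set ys \<subseteq> set xs \<Longrightarrow> F ys = F' ys"
  shows "hom_d F xs = hom_d F' xs"
  unfolding hom_d_def
  by (intro sum.cong refl arg_cong2[of _ _ _ _ "(*)"] assms)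
    (auto simp: del_nth_def dest: in_set_takeD in_set_dropD)

lemma hom_B_cong:
  assumes "\<And>ys. set ys \<subseteq> set xs \<Longrightarrow> length ys = Suc (length xs) \<Longrightarrow> F ys = F' ys"
  shows "hom_B F xs = hom_B F' xs"
  unfolding hom_B_def
  by (intro sum.cong refl arg_cong2[of _ _ _ _ "(*)"] assms)
    (auto simp: rot_closed_def dest: in_set_takeD in_set_dropD)

lemma hom_h_cong:
  assumes "\<And>ys. set ys \<subseteq> set xs \<Longrightarrow> length ys = length xs + 2 \<Longrightarrow> F ys = F' ys"
  shows "hom_h F xs = hom_h F' xs"
  using assms
proof (induction xs arbitrary: F F')
  case (Cons x xs)
  have "hom_B (\<lambda>ys. F (x # ys)) (x # xs) = hom_B (\<lambda>ys. F' (x # ys)) (x # xs)"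
    by (rule hom_B_cong) (use Cons.prems in auto)
  moreover have "hom_h (\<lambda>ys. F (x # ys)) xs = hom_h (\<lambda>ys. F' (x # ys)) xs"
    by (rule Cons.IH, rule Cons.prems) auto
  ultimately show ?case by simp
qed simp

lemma hom_B_map: "hom_B F (map f xs) = hom_B (\<lambda>ys. F (map f ys)) xs"
  by (simp add: hom_B_def rot_closed_def drop_map take_map)

lemma hom_h_map: "hom_h F (map f xs) = hom_h (\<lambda>ys. F (map f ys)) xs"
proof (induction xs arbitrary: F)
  case (Cons x xs)
  then show ?case using hom_B_map[of "\<lambda>ys. F (f x # ys)" f "x # xs"] by simp
qed simp

lemma hom_h_sum:
  "hom_h (\<lambda>ys. \<Sum>i\<in>I. c i * F i ys) xs = (\<Sum>i\<in>I. c i * hom_h (F i) xs)"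
proof (induction xs arbitrary: F)
  case (Cons x xs)
  have "hom_B (\<lambda>ys. \<Sum>i\<in>I. c i * F i (x # ys)) (x # xs) =
    (\<Sum>i\<in>I. c i * hom_B (\<lambda>ys. F i (x # ys)) (x # xs))"
    unfolding hom_B_def sum_distrib_left by (subst sum.swap) (simp add: mult_ac)
  then show ?case using Cons.IH[of "\<lambda>i ys. F i (x # ys)"]
    by (simp add: algebra_simps sum.distrib)
qed simp

section \<open>The cyclic operator on the bar complex\<close>

text \<open>
  Passage from homogeneous to inhomogeneous tuples: \<open>(x\<^sub>0, \<dots>, x\<^sub>s)\<close> becomes
  \<open>[x\<^sub>0\<^sup>-\<^sup>1 x\<^sub>1, \<dots>, x\<^sub>s\<^sub>-\<^sub>1\<^sup>-\<^sup>1 x\<^sub>s]\<close>, with \<open>partial_products\<close> as inverse once \<open>x\<^sub>0\<close> is prescribed.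
\<close>

fun ratios :: "('g, 'm) monoid_scheme \<Rightarrow> 'g list \<Rightarrow> 'g list" where
  "ratios G (x # y # zs) = (inv\<^bsub>G\<^esub> x \<otimes>\<^bsub>G\<^esub> y) # ratios G (y # zs)"
| "ratios G [x] = []"
| "ratios G [] = []"

fun partial_products :: "('g, 'm) monoid_scheme \<Rightarrow> 'g \<Rightarrow> 'g list \<Rightarrow> 'g list" where
  "partial_products G a [] = [a]"
| "partial_products G a (g # gs) = a # partial_products G (a \<otimes>\<^bsub>G\<^esub> g) gs"

text \<open>
  The value on the empty tuple is set to 0, which removes the augmentation from the homogeneous
  complex; tuples with entries outside the group are sent to 0 so that degenerate tuples of any
  kind are.
\<close>

definition homogenized :: "('g, 'm) monoid_scheme \<Rightarrow> ('g list \<Rightarrow> 'k::comm_ring_1) \<Rightarrow> 'g list \<Rightarrow> 'k"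
  where "homogenized G \<phi> ys = (if ys \<noteq> [] \<and> set ys \<subseteq> carrier G then \<phi> (ratios G ys) else 0)"

definition normalized :: "('g, 'm) monoid_scheme \<Rightarrow> ('g list \<Rightarrow> 'k::comm_ring_1) \<Rightarrow> bool"
  where "normalized G \<phi> \<longleftrightarrow> (\<forall>gs. set gs \<subseteq> carrier G \<longrightarrow> \<one>\<^bsub>G\<^esub> \<in> set gs \<longrightarrow> \<phi> gs = 0)"

text \<open>
  On a cochain of the right degree this is its coboundary, up to the cut-off at normalized
  tuples; on the function that tests for a fixed tuple \<open>xs\<close> it yields the coefficient of \<open>xs\<close> in
  the boundary of a bar chain. This is what lets one homotopy serve both halves of the complex.
\<close>

definition bar_d :: "('g, 'm) monoid_scheme \<Rightarrow> ('g list \<Rightarrow> 'k::comm_ring_1) \<Rightarrow> 'g list \<Rightarrow> 'k"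
  where "bar_d G \<phi> gs = (if gs = [] then 0 else
    \<phi> (tl gs) + (\<Sum>i=1..<length gs. (-1) ^ i * \<phi> (merge G i gs))
    + (-1) ^ length gs * \<phi> (butlast gs))"

definition bar_B :: "('g, 'm) monoid_scheme \<Rightarrow> ('g list \<Rightarrow> 'k::comm_ring_1) \<Rightarrow> 'g list \<Rightarrow> 'k"
  where "bar_B G \<phi> gs = (\<Sum>j\<le>length gs. (-1) ^ (Suc j * length gs) *
    \<phi> (drop j gs @ [inv\<^bsub>G\<^esub> (group_prod G gs)] @ take j gs))"

definition bar_h :: "('g, 'm) monoid_scheme \<Rightarrow> ('g list \<Rightarrow> 'k::comm_ring_1) \<Rightarrow> 'g list \<Rightarrow> 'k"
  where "bar_h G \<phi> gs = hom_h (homogenized G \<phi>) (partial_products G \<one>\<^bsub>G\<^esub> gs)"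

lemma group_prod_Nil [simp]: "group_prod G [] = \<one>\<^bsub>G\<^esub>"
  and group_prod_Cons [simp]: "group_prod G (g # gs) = g \<otimes>\<^bsub>G\<^esub> group_prod G gs"
  by (simp_all add: group_prod_def)

lemma length_ratios [simp]: "length (ratios G ys) = length ys - 1"
  by (induction G ys rule: ratios.induct) auto

lemma ratios_append_overlap:
  "ratios G (us @ x # vs) = ratios G (us @ [x]) @ ratios G (x # vs)"
  by (induction G us rule: ratios.induct) auto

lemma ratios_append:
  "us \<noteq> [] \<Longrightarrow> vs \<noteq> [] \<Longrightarrow>
    ratios G (us @ vs) = ratios G us @ (inv\<^bsub>G\<^esub> (last us) \<otimes>\<^bsub>G\<^esub> hd vs) # ratios G vs"
  by (induction G us rule: ratios.induct; cases vs) auto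

lemma partial_products_not_Nil [simp]: "partial_products G a gs \<noteq> []"
  by (cases gs) auto

lemma hd_partial_products [simp]: "hd (partial_products G a gs) = a"
  by (cases gs) auto

lemma length_partial_products [simp]: "length (partial_products G a gs) = Suc (length gs)"
  by (induction gs arbitrary: a) auto

context group begin

lemma group_prod_closed [simp]: "set gs \<subseteq> carrier G \<Longrightarrow> group_prod G gs \<in> carrier G"
  by (induction gs) auto

lemma group_prod_append:
  "set gs \<subseteq> carrier G \<Longrightarrow> set hs \<subseteq> carrier G \<Longrightarrow>
    group_prod G (gs @ hs) = group_prod G gs \<otimes> group_prod G hs"
  by (induction gs) (auto simp: m_assoc)

lemma ratios_closed: "set ys \<subseteq> carrier G \<Longrightarrow> set (ratios G ys) \<subseteq> carrier G"
  by (induction ys rule: induct_list012) auto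

lemma inv_mult_cancel: "x \<in> carrier G \<Longrightarrow> y \<in> carrier G \<Longrightarrow> x \<otimes> (inv x \<otimes> y) = y"
  by (simp flip: m_assoc)

lemma inv_mult_cancel': "x \<in> carrier G \<Longrightarrow> y \<in> carrier G \<Longrightarrow> inv x \<otimes> (x \<otimes> y) = y"
  by (simp flip: m_assoc)

lemma group_prod_ratios:
  "ys \<noteq> [] \<Longrightarrow> set ys \<subseteq> carrier G \<Longrightarrow> group_prod G (ratios G ys) = inv (hd ys) \<otimes> last ys"
proof (induction ys rule: induct_list012)
  case (3 x y zs)
  then have "group_prod G (ratios G (x # y # zs)) = inv x \<otimes> y \<otimes> (inv y \<otimes> last (y # zs))" by simp
  also have "last (y # zs) \<in> carrier G" using 3(4) last_in_set[of "y # zs"] by (metis list.distinct(1) list.set_intros(2) subsetD)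
  then have "inv x \<otimes> y \<otimes> (inv y \<otimes> last (y # zs)) = inv x \<otimes> last (y # zs)"
    using 3 by (simp add: m_assoc inv_mult_cancel)
  finally show ?case by simp
qed auto

lemma partial_products_closed:
  "a \<in> carrier G \<Longrightarrow> set gs \<subseteq> carrier G \<Longrightarrow> set (partial_products G a gs) \<subseteq> carrier G"
  by (induction gs arbitrary: a) auto

lemma ratios_partial_products:
  "a \<in> carrier G \<Longrightarrow> set gs \<subseteq> carrier G \<Longrightarrow> ratios G (partial_products G a gs) = gs"
proof (induction gs arbitrary: a)
  case (Cons g gs)
  have "ratios G (a # partial_products G (a \<otimes> g) gs) =
      (inv a \<otimes> hd (partial_products G (a \<otimes> g) gs)) # ratios G (partial_products G (a \<otimes> g) gs)"
    by (cases "partial_products G (a \<otimes> g) gs") simp_all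
  then show ?case using Cons by (simp add: inv_mult_cancel')
qed simp

lemma map_partial_products:
  "c \<in> carrier G \<Longrightarrow> a \<in> carrier G \<Longrightarrow> set gs \<subseteq> carrier G \<Longrightarrow>
    map ((\<otimes>) c) (partial_products G a gs) = partial_products G (c \<otimes> a) gs"
  by (induction gs arbitrary: a) (auto simp: m_assoc)

lemma partial_products_ratios:
  "ys \<noteq> [] \<Longrightarrow> set ys \<subseteq> carrier G \<Longrightarrow> partial_products G (hd ys) (ratios G ys) = ys"
  by (induction ys rule: induct_list012) (auto simp: inv_mult_cancel)

lemma ratios_map:
  "c \<in> carrier G \<Longrightarrow> set ys \<subseteq> carrier G \<Longrightarrow> ratios G (map ((\<otimes>) c) ys) = ratios G ys"
proof (induction ys rule: induct_list012)
  case (3 x y zs)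
  then have "inv (c \<otimes> x) \<otimes> (c \<otimes> y) = inv x \<otimes> y"
    by (simp add: inv_mult_group m_assoc inv_mult_cancel')
  then show ?case using 3 by simp
qed auto

lemma one_in_ratios_iff:
  "set ys \<subseteq> carrier G \<Longrightarrow> \<one> \<in> set (ratios G ys) \<longleftrightarrow> \<not> distinct_adj ys"
proof (induction ys rule: induct_list012)
  case (3 x y zs)
  then have "\<one> = inv x \<otimes> y \<longleftrightarrow> x = y"
    by (metis insert_subset inv_closed l_inv list.simps(15) inv_equality inv_inv)
  then show ?case using 3 by simp
qed auto

lemma ratios_del_nth:
  assumes "set ys \<subseteq> carrier G" "0 < i" "Suc i < length ys"
  shows "ratios G (del_nth i ys) = merge G i (ratios G ys)"
proof -
  define us a b c ws where "us = take (i - 1) ys" and "a = ys ! (i - 1)" and "b = ys ! i"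
    and "c = ys ! Suc i" and "ws = drop (i + 2) ys"
  have ys: "ys = us @ a # b # c # ws"
    unfolding us_def a_def b_def c_def ws_def using assms(2,3)
    by (metis (no_types, lifting) Cons_nth_drop_Suc Suc_diff_1 Suc_lessD add_2_eq_Suc' append_take_drop_id)
  have len: "length us = i - 1" using assms by (simp add: us_def)
  have del: "del_nth i ys = us @ a # c # ws"
    using assms(2) len unfolding del_nth_def by (subst (1 2) ys) (cases i, auto)
  have carr: "a \<in> carrier G" "b \<in> carrier G" "c \<in> carrier G" using assms(1) ys by auto
  have "merge G i (ratios G ys) =
      ratios G (us @ [a]) @ (inv a \<otimes> b \<otimes> (inv b \<otimes> c)) # ratios G (c # ws)"
    unfolding ys merge_def using assms(2) len
    by (subst (1 2 3 4) ratios_append_overlap) (cases i, auto simp: nth_append)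
  also have "inv a \<otimes> b \<otimes> (inv b \<otimes> c) = inv a \<otimes> c"
    using carr by (simp add: m_assoc inv_mult_cancel)
  finally show ?thesis unfolding del by (subst ratios_append_overlap) simp
qed

lemma ratios_tl: "ratios G (tl ys) = tl (ratios G ys)"
  by (induction ys rule: induct_list012) auto

lemma ratios_butlast: "ratios G (butlast ys) = butlast (ratios G ys)"
proof (cases ys rule: rev_cases)
  case (snoc us x)
  then show ?thesis by (cases "us = []") (simp_all add: ratios_append butlast_append)
qed simp

text \<open>
  Between the end of the tuple and its beginning a rotation inserts the ratio of the last and the first
  entry, which is the inverse of the product of all ratios. So closed rotations of homogeneous
  tuples are Connes' rotations of \<open>(g\<^sub>0, g\<^sub>1, \<dots>, g\<^sub>s)\<close>.
\<close>

lemma ratios_rot_closed: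
  assumes "set ys \<subseteq> carrier G" "j < length ys"
  shows "ratios G (rot_closed j ys) =
    drop j (ratios G ys) @ [inv (group_prod G (ratios G ys))] @ take j (ratios G ys)"
proof -
  define us x vs where "us = take j ys" and "x = ys ! j" and "vs = drop (Suc j) ys"
  have ys: "ys = us @ x # vs" using assms(2) by (simp add: us_def x_def vs_def id_take_nth_drop)
  have len: "length us = j" using assms(2) by (simp add: us_def)
  have rot: "rot_closed j ys = (x # vs) @ us @ [x]"
    using assms(2) by (simp add: rot_closed_def us_def x_def vs_def Cons_nth_drop_Suc take_Suc_conv_app_nth)
  have carr: "hd ys \<in> carrier G" "last ys \<in> carrier G"
    using assms(1) hd_in_set[of ys] last_in_set[of ys] ys by blast+
  have "ratios G (rot_closed j ys) =
      ratios G (x # vs) @ (inv (last ys) \<otimes> hd ys) # ratios G (us @ [x])"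
    unfolding rot by (subst ratios_append) (simp_all add: ys hd_append)
  moreover have "inv (last ys) \<otimes> hd ys = inv (group_prod G (ratios G ys))"
    using group_prod_ratios[OF _ assms(1)] carr by (simp add: ys inv_mult_group)
  moreover have "drop j (ratios G ys) = ratios G (x # vs)" "take j (ratios G ys) = ratios G (us @ [x])"
    unfolding ys by (subst ratios_append_overlap, simp add: len)+
  ultimately show ?thesis by simp
qed

lemma homogenized_eq:
  "ys \<noteq> [] \<Longrightarrow> set ys \<subseteq> carrier G \<Longrightarrow> homogenized G \<phi> ys = \<phi> (ratios G ys)"
  by (simp add: homogenized_def)

lemma nondeg_homogenized: "normalized G \<phi> \<Longrightarrow> nondeg (homogenized G \<phi>)"
  using one_in_ratios_iff ratios_closed by (auto simp: nondeg_def normalized_def homogenized_def)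

lemma hom_d_homogenized:
  assumes "ys \<noteq> []" "set ys \<subseteq> carrier G"
  shows "hom_d (homogenized G \<phi>) ys = bar_d G \<phi> (ratios G ys)"
proof (cases "length ys = 1")
  case True
  then obtain y where "ys = [y]" by (cases ys) auto
  then show ?thesis by (simp add: hom_d_Cons bar_d_def homogenized_def)
next
  case False
  then obtain n where n: "length ys = Suc (Suc n)" using assms(1)
    by (metis One_nat_def length_0_conv not0_implies_Suc)
  have set: "{..<length ys} = insert 0 (insert (Suc n) {1..<Suc n})" using n by auto
  have sub: "set (del_nth i ys) \<subseteq> carrier G" for i
    using assms(2) by (auto simp: del_nth_def dest: in_set_takeD in_set_dropD)
  have F: "homogenized G \<phi> (del_nth i ys) = \<phi> (ratios G (del_nth i ys))" if "i < length ys" for i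
    by (rule homogenized_eq[OF _ sub]) (use that n in \<open>auto simp: del_nth_def\<close>)
  have "del_nth 0 ys = tl ys" "del_nth (Suc n) ys = butlast ys"
    using n by (simp_all add: del_nth_def drop_Suc butlast_conv_take)
  then have ends: "ratios G (del_nth 0 ys) = tl (ratios G ys)"
     "ratios G (del_nth (Suc n) ys) = butlast (ratios G ys)"
    by (simp_all add: ratios_tl ratios_butlast)
  have "ratios G ys \<noteq> []" using n by (metis length_ratios diff_Suc_1 list.size(3) nat.distinct(1))
  moreover have "hom_d (homogenized G \<phi>) ys = (\<Sum>i<length ys. (-1) ^ i * \<phi> (ratios G (del_nth i ys)))"
    by (simp add: hom_d_def F)
  moreover have "(\<Sum>i=1..<Suc n. (-1) ^ i * \<phi> (ratios G (del_nth i ys))) =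
      (\<Sum>i=1..<Suc n. (-1) ^ i * \<phi> (merge G i (ratios G ys)))"
    by (rule sum.cong) (simp_all add: ratios_del_nth assms(2) n)
  ultimately show ?thesis
    unfolding set by (simp add: bar_d_def ends n add_ac)
qed

lemma hom_B_homogenized:
  assumes "ys \<noteq> []" "set ys \<subseteq> carrier G"
  shows "hom_B (homogenized G \<phi>) ys = bar_B G \<phi> (ratios G ys)"
proof -
  have "{..length (ratios G ys)} = {..<length ys}" using assms(1) by (cases ys) auto
  moreover have "homogenized G \<phi> (rot_closed j ys) = \<phi> (ratios G (rot_closed j ys))"
    if "j < length ys" for j
    using that assms(2) by (intro homogenized_eq)
      (auto simp: rot_closed_def dest: in_set_takeD in_set_dropD)
  ultimately show ?thesis
    unfolding hom_B_def bar_B_def by (simp add: ratios_rot_closed assms(2))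
qed

text \<open>
  Up to a left translation the tuple consists of the partial products of its ratios, and a homogenized
  function is invariant under translations.
\<close>

lemma hom_h_homogenized:
  assumes "ys \<noteq> []" "set ys \<subseteq> carrier G"
  shows "hom_h (homogenized G \<phi>) ys = bar_h G \<phi> (ratios G ys)"
proof -
  define a where "a = hd ys"
  have a: "a \<in> carrier G" using assms hd_in_set[of ys] by (auto simp: a_def)
  define zs where "zs = partial_products G \<one> (ratios G ys)"
  have zs: "set zs \<subseteq> carrier G"
    unfolding zs_def by (intro partial_products_closed ratios_closed assms(2)) simp
  have "ys = partial_products G (a \<otimes> \<one>) (ratios G ys)"
    using partial_products_ratios[OF assms] a by (simp add: a_def)
  also have "\<dots> = map ((\<otimes>) a) zs"
    unfolding zs_def using a ratios_closed[OF assms(2)] by (intro map_partial_products[symmetric]) auto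
  finally have "hom_h (homogenized G \<phi>) ys = hom_h (\<lambda>xs. homogenized G \<phi> (map ((\<otimes>) a) xs)) zs"
    by (simp add: hom_h_map)
  also have "\<dots> = hom_h (homogenized G \<phi>) zs"
  proof (rule hom_h_cong)
    fix xs assume "set xs \<subseteq> set zs"
    then have xs: "set xs \<subseteq> carrier G" using zs by blast
    then have "set (map ((\<otimes>) a) xs) \<subseteq> carrier G" using a by auto
    then show "homogenized G \<phi> (map ((\<otimes>) a) xs) = homogenized G \<phi> xs"
      using xs ratios_map[OF a xs] by (auto simp: homogenized_def)
  qed
  finally show ?thesis by (simp add: bar_h_def zs_def)
qed

lemma normalized_bar_d:
  assumes "normalized G \<phi>" shows "normalized G (bar_d G \<phi>)"
  unfolding normalized_def
proof (intro allI impI)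
  fix gs assume gs: "set gs \<subseteq> carrier G" "\<one> \<in> set gs"
  have "\<not> distinct_adj (partial_products G \<one> gs)"
    using gs by (subst one_in_ratios_iff[symmetric])
      (simp_all add: partial_products_closed ratios_partial_products)
  then have "hom_d (homogenized G \<phi>) (partial_products G \<one> gs) = 0"
    using nondeg_hom_d[OF nondeg_homogenized[OF assms]] by (simp add: nondeg_def)
  then show "bar_d G \<phi> gs = 0"
    using gs by (simp add: hom_d_homogenized partial_products_closed ratios_partial_products)
qed

lemma normalized_bar_h:
  assumes "normalized G \<phi>" shows "normalized G (bar_h G \<phi>)"
  unfolding normalized_def
proof (intro allI impI)
  fix gs assume gs: "set gs \<subseteq> carrier G" "\<one> \<in> set gs"
  have "\<not> distinct_adj (partial_products G \<one> gs)"
    using gs by (subst one_in_ratios_iff[symmetric])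
      (simp_all add: partial_products_closed ratios_partial_products)
  then show "bar_h G \<phi> gs = 0"
    using nondeg_hom_h[OF nondeg_homogenized[OF assms]] by (simp add: nondeg_def bar_h_def)
qed

lemma bar_h_cong:
  assumes "set gs \<subseteq> carrier G"
    and "\<And>hs. set hs \<subseteq> carrier G \<Longrightarrow> length hs = length gs + 2 \<Longrightarrow> \<phi> hs = \<psi> hs"
  shows "bar_h G \<phi> gs = bar_h G \<psi> gs"
  unfolding bar_h_def
proof (rule hom_h_cong)
  fix ys assume "set ys \<subseteq> set (partial_products G \<one> gs)"
    "length ys = length (partial_products G \<one> gs) + 2"
  then show "homogenized G \<phi> ys = homogenized G \<psi> ys"
    using partial_products_closed[OF one_closed assms(1)]
    by (auto simp: homogenized_def intro!: assms(2) dest: subsetD[OF ratios_closed])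
qed

lemma bar_h_sum:
  "bar_h G (\<lambda>hs. \<Sum>i\<in>I. c i * \<phi> i hs) gs = (\<Sum>i\<in>I. c i * bar_h G (\<phi> i) gs)"
proof -
  have "homogenized G (\<lambda>hs. \<Sum>i\<in>I. c i * \<phi> i hs) = (\<lambda>ys. \<Sum>i\<in>I. c i * homogenized G (\<phi> i) ys)"
    by (auto simp: homogenized_def fun_eq_iff)
  then show ?thesis by (simp add: bar_h_def hom_h_sum)
qed

text \<open>
  The homogeneous homotopy formula, evaluated on the partial products of the tuple.
\<close>

lemma bar_B_null_homotopic:
  assumes "normalized G \<phi>" and "set gs \<subseteq> carrier G"
  shows "bar_B G \<phi> gs = bar_h G (bar_d G \<phi>) gs - bar_d G (bar_h G \<phi>) gs"
proof -
  define ys where "ys = partial_products G \<one> gs"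
  have ys: "ys \<noteq> []" "set ys \<subseteq> carrier G" and gs: "ratios G ys = gs"
    using assms(2) by (simp_all add: ys_def partial_products_closed ratios_partial_products)
  have "hom_h (hom_d (homogenized G \<phi>)) ys = hom_h (homogenized G (bar_d G \<phi>)) ys"
    by (rule hom_h_cong) (use ys in \<open>auto simp: homogenized_def intro!: hom_d_homogenized\<close>)
  moreover have "hom_d (hom_h (homogenized G \<phi>)) ys = hom_d (homogenized G (bar_h G \<phi>)) ys"
  proof (rule hom_d_cong)
    fix zs assume "set zs \<subseteq> set ys"
    then have "set zs \<subseteq> carrier G" using ys by blast
    then show "hom_h (homogenized G \<phi>) zs = homogenized G (bar_h G \<phi>) zs"
      by (cases "zs = []") (simp_all add: homogenized_def hom_h_homogenized)
  qed
  ultimately show ?thesis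
    using hom_B_null_homotopic[OF nondeg_homogenized[OF assms(1)], of ys]
    by (simp add: hom_B_homogenized[OF ys] hom_d_homogenized[OF ys] hom_h_homogenized[OF ys] gs)
qed

end

section \<open>The cyclic operator on Tate cocycles\<close>

text \<open>
  The group element at which a (co)chain in the image of \<open>\<iota>\<close> is concentrated, see \<open>supported\<close>.
\<close>

definition weight :: "('g, 'm) monoid_scheme \<Rightarrow> int \<Rightarrow> 'g list \<Rightarrow> 'g"
  where "weight G m gs = (if m \<ge> 0 then group_prod G gs else inv\<^bsub>G\<^esub> (group_prod G gs))"

definition supported :: "('g, 'm) monoid_scheme \<Rightarrow> int \<Rightarrow> ('g, 'k::field) hoch \<Rightarrow> bool"
  where "supported G m z \<longleftrightarrow> (\<forall>gs x. z gs x \<noteq> 0 \<longrightarrow> x = weight G m gs)"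

definition tate_retract :: "('g, 'm) monoid_scheme \<Rightarrow> int \<Rightarrow> ('g, 'k::field) hoch \<Rightarrow> ('g, 'k) tate"
  where "tate_retract G m z = (\<lambda>gs. z gs (weight G m gs))"

text \<open>
  The operator that corresponds to the BV-operator under \<open>\<iota>\<close>. In negative degrees the coefficient
  of \<open>xs\<close> is obtained by pairing the chain with the transpose applied to the test function of \<open>xs\<close>.
\<close>

definition tate_B :: "('g, 'm) monoid_scheme \<Rightarrow> int \<Rightarrow> ('g, 'k::field) tate \<Rightarrow> ('g, 'k) tate"
  where "tate_B G a \<phi> =
    (if a < 0 then (\<lambda>xs. \<Sum>gs\<in>simplices G (arity a). \<phi> gs * bar_B G (\<lambda>ys. tate_chain G ys xs) gs)
     else if a = 0 then 0
     else (\<lambda>gs. if gs \<in> simplices G (arity a - 1) then bar_B G \<phi> gs else 0))"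

lemma simplicesD:
  assumes "gs \<in> simplices G n"
  shows "length gs = n" "set gs \<subseteq> carrier G" "\<one>\<^bsub>G\<^esub> \<notin> set gs"
  using assms by (auto simp: simplices_def)

lemma simplicesI:
  "length gs = n \<Longrightarrow> set gs \<subseteq> carrier G \<Longrightarrow> \<one>\<^bsub>G\<^esub> \<notin> set gs \<Longrightarrow> gs \<in> simplices G n"
  by (auto simp: simplices_def)

lemma hoch_chain_ga_of: "hoch_chain G (ga_of g) ys xs x = tate_chain G ys xs * ga_of g x"
  by (simp add: hoch_chain_def tate_chain_def)

lemma bar_d_sum:
  "bar_d G (\<lambda>hs. \<Sum>i\<in>I. c i * \<phi> i hs) gs = (\<Sum>i\<in>I. c i * bar_d G (\<phi> i) gs)"
proof (cases "gs = []")
  case False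
  have "(\<Sum>j\<in>J. (- 1) ^ j * (\<Sum>i\<in>I. c i * \<phi> i (merge G j gs))) =
      (\<Sum>i\<in>I. c i * (\<Sum>j\<in>J. (- 1) ^ j * \<phi> i (merge G j gs)))" for J
    unfolding sum_distrib_left by (subst sum.swap) (simp add: mult_ac)
  then show ?thesis using False
    by (simp add: bar_d_def sum.distrib distrib_left sum_distrib_left mult_ac)
qed (simp add: bar_d_def)

lemma set_merge_subset:
  assumes "0 < i" "i < length gs"
  shows "set (merge G i gs) \<subseteq> insert (gs ! (i - 1) \<otimes>\<^bsub>G\<^esub> gs ! i) (set gs)"
  unfolding merge_def by (auto dest: in_set_takeD in_set_dropD)

lemma length_merge: "0 < i \<Longrightarrow> i < length gs \<Longrightarrow> length (merge G i gs) = length gs - 1"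
  unfolding merge_def by (auto simp: min_def)

context group begin

lemma merge_closed:
  assumes "set gs \<subseteq> carrier G" "0 < i" "i < length gs"
  shows "set (merge G i gs) \<subseteq> carrier G"
proof -
  have "gs ! (i - 1) \<in> carrier G" "gs ! i \<in> carrier G"
    using assms nth_mem[of _ gs] by (auto simp: subset_iff)
  then show ?thesis using set_merge_subset[OF assms(2,3)] assms(1) by auto
qed

lemma group_prod_merge:
  assumes "set gs \<subseteq> carrier G" "0 < i" "i < length gs"
  shows "group_prod G (merge G i gs) = group_prod G gs"
proof -
  define us a b vs where "us = take (i - 1) gs" and "a = gs ! (i - 1)" and "b = gs ! i"
    and "vs = drop (Suc i) gs"
  have gs: "gs = us @ a # b # vs"
    unfolding us_def a_def b_def vs_def using assms(2,3)
    by (metis (no_types, lifting) Cons_nth_drop_Suc Suc_diff_1 Suc_lessD append_take_drop_id)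
  have merge: "merge G i gs = us @ (a \<otimes> b) # vs"
    by (simp add: merge_def us_def a_def b_def vs_def)
  have "set us \<subseteq> carrier G" "a \<in> carrier G" "b \<in> carrier G" "set vs \<subseteq> carrier G"
    using assms(1) by (auto simp: gs)
  then show ?thesis unfolding merge by (simp add: gs group_prod_append m_assoc)
qed

lemma bar_d_cong:
  assumes "set gs \<subseteq> carrier G"
    and "\<And>hs. set hs \<subseteq> carrier G \<Longrightarrow> Suc (length hs) = length gs \<Longrightarrow> \<phi> hs = \<psi> hs"
  shows "bar_d G \<phi> gs = bar_d G \<psi> gs"
proof (cases "gs = []")
  case False
  have "\<phi> (merge G i gs) = \<psi> (merge G i gs)" if "1 \<le> i" "i < length gs" for i
    using that by (intro assms(2) merge_closed[OF assms(1)]) (simp_all add: length_merge)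
  moreover have "\<phi> (tl gs) = \<psi> (tl gs)" "\<phi> (butlast gs) = \<psi> (butlast gs)"
    using assms(1) False list.set_sel(2)[of gs] in_set_butlastD[of _ gs]
    by (auto intro!: assms(2))
  ultimately show ?thesis by (simp add: bar_d_def)
qed (simp add: bar_d_def)

lemma group_prod_inv_rev:
  "set gs \<subseteq> carrier G \<Longrightarrow> group_prod G (map (\<lambda>g. inv g) (rev gs)) = inv (group_prod G gs)"
proof (induction gs)
  case (Cons g gs)
  have "set (map (\<lambda>g. inv g) (rev gs)) \<subseteq> carrier G" "set [inv g] \<subseteq> carrier G"
    using Cons.prems by auto
  from group_prod_append[OF this] show ?case using Cons by (simp add: inv_mult_group)
qed simp

lemma weight_closed [simp]: "set gs \<subseteq> carrier G \<Longrightarrow> weight G m gs \<in> carrier G"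
  by (simp add: weight_def)

lemma group_prod_butlast:
  assumes "set gs \<subseteq> carrier G" "gs \<noteq> []"
  shows "group_prod G gs = group_prod G (butlast gs) \<otimes> last gs"
proof -
  have "set (butlast gs) \<subseteq> carrier G" "last gs \<in> carrier G"
    using assms in_set_butlastD[of _ gs] last_in_set[of gs] by auto
  moreover have "gs = butlast gs @ [last gs]" using assms by simp
  ultimately show ?thesis
    using group_prod_append[of "butlast gs" "[last gs]"] by simp
qed

lemma group_prod_hd:
  "gs \<noteq> [] \<Longrightarrow> group_prod G gs = hd gs \<otimes> group_prod G (tl gs)"
  by (cases gs) auto

lemma normalized_tate: "\<phi> \<in> tate_space G m \<Longrightarrow> normalized G \<phi>"
  by (auto simp: tate_space_def normalized_def simplices_def)

lemma normalized_tate_chain: "normalized G (\<lambda>ys. tate_chain G ys xs)"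
  by (simp add: normalized_def tate_chain_def)

lemma tate_delta_eq:
  "tate_delta G n \<phi> gs = (if gs \<in> simplices G (Suc n) then bar_d G \<phi> gs else 0)"
  by (auto simp: tate_delta_def bar_d_def simplices_def atLeastLessThanSuc_atLeastAtMost)

lemma tate_boundary_eq:
  assumes "p > 0"
  shows "tate_boundary G p c xs = (\<Sum>gs\<in>simplices G p. c gs * bar_d G (\<lambda>ys. tate_chain G ys xs) gs)"
  unfolding tate_boundary_def
  by (rule sum.cong) (use assms in \<open>auto simp: bar_d_def simplices_def\<close>)

lemma bar_h_zero: "bar_h G (\<lambda>_. 0) gs = 0"
  using bar_h_sum[where I = "{}"] by simp

end

locale finite_group = group G for G :: "('g, 'm) monoid_scheme" (structure) +
  assumes finite_carrier: "finite (carrier G)"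
begin

lemma finite_simplices: "finite (simplices G p)"
  unfolding simplices_def
  by (rule finite_subset[OF _ finite_lists_length_eq[OF finite_carrier, of p]]) auto

text \<open>
  Writing a normalized function as a combination of test functions turns statements about functions
  into statements about chains, as in the two pairings that follow.
\<close>

lemma normalized_expansion:
  assumes "normalized G \<psi>" "set ys \<subseteq> carrier G" "length ys = p"
  shows "\<psi> ys = (\<Sum>hs\<in>simplices G p. \<psi> hs * tate_chain G ys hs)"
proof (cases "\<one> \<in> set ys")
  case True
  then show ?thesis using assms by (simp add: normalized_def tate_chain_def)
next
  case False
  then have ys: "ys \<in> simplices G p" by (rule simplicesI[OF assms(3,2)])
  have "(\<Sum>hs\<in>simplices G p. \<psi> hs * tate_chain G ys hs) =
      (\<Sum>hs\<in>simplices G p. if hs = ys then \<psi> hs else 0)"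
    by (rule sum.cong) (use False in \<open>auto simp: tate_chain_def\<close>)
  then show ?thesis using ys by (simp add: finite_simplices)
qed

lemma bar_d_pairing:
  assumes "p > 0" "normalized G \<psi>"
  shows "(\<Sum>gs\<in>simplices G p. c gs * bar_d G \<psi> gs) =
    (\<Sum>hs\<in>simplices G (p - 1). \<psi> hs * tate_boundary G p c hs)"
proof -
  have "bar_d G \<psi> gs = (\<Sum>hs\<in>simplices G (p - 1). \<psi> hs * bar_d G (\<lambda>ys. tate_chain G ys hs) gs)"
    if "gs \<in> simplices G p" for gs
    unfolding bar_d_sum[symmetric] using simplicesD[OF that]
    by (intro bar_d_cong normalized_expansion[OF assms(2)]) auto
  then show ?thesis
    by (simp add: tate_boundary_eq[OF assms(1)] sum_distrib_left mult_ac) (rule sum.swap)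
qed

lemma bar_h_pairing:
  assumes "normalized G \<psi>" "gs \<in> simplices G n"
  shows "bar_h G \<psi> gs = (\<Sum>hs\<in>simplices G (n + 2). \<psi> hs * bar_h G (\<lambda>ys. tate_chain G ys hs) gs)"
  unfolding bar_h_sum[symmetric] using simplicesD[OF assms(2)]
  by (intro bar_h_cong normalized_expansion[OF assms(1)]) auto

text \<open>
  In degrees at least 2 and at most -2 the bounding element comes from the homotopy; the other
  term of the homotopy formula contains the differential of the given cocycle. In degrees 1 and -1,
  next to the splice, \<open>B\<close> is zero already on the level of (co)chains: the only rotation of the empty
  tuple is \<open>[1]\<close>, which is degenerate.
\<close>

lemma tate_B_exact:
  fixes \<phi> :: "('g, 'k::field) tate"
  assumes "\<phi> \<in> cocycles (tate_space G) (tate_diff G) a"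
  shows "\<exists>\<psi>\<in>tate_space G (a - 2). tate_B G a \<phi> = tate_diff G (a - 2) \<psi>"
proof -
  have \<phi>: "\<phi> \<in> tate_space G a" and cyc: "tate_diff G a \<phi> = 0"
    using assms by (simp_all add: cocycles_def)
  note norm = normalized_tate[OF \<phi>]
  have zero: ?thesis if "tate_B G a \<phi> = 0" "tate_diff G (a - 2) (0 :: ('g, 'k) tate) = 0"
    by (rule bexI[of _ 0]) (use that in \<open>auto simp: tate_space_def\<close>)
  consider "a \<ge> 2" | "a = 1" | "a = 0" | "a = -1" | "a \<le> -2" by linarith
  then show ?thesis
  proof cases
    case 1
    then obtain n where n: "a = int n + 2" by (metis zero_le_imp_eq_int diff_ge_0_iff_ge diff_add_cancel)
    then have ar: "arity a = n + 2" "arity (a - 2) = n" "nat a = n + 2" "nat (a - 2) = n"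
      by (simp_all add: arity_def nat_add_distrib)
    define \<psi> where "\<psi> = (\<lambda>gs. if gs \<in> simplices G n then - bar_h G \<phi> gs else 0)"
    have "tate_B G a \<phi> gs = tate_diff G (a - 2) \<psi> gs" for gs
    proof (cases "gs \<in> simplices G (Suc n)")
      case True
      note gs = simplicesD[OF True]
      have "bar_d G \<phi> hs = 0" if hs: "set hs \<subseteq> carrier G" "length hs = n + 3" for hs
      proof (cases "\<one> \<in> set hs")
        case True
        then show ?thesis using normalized_bar_d[OF norm] hs by (simp add: normalized_def)
      next
        case False
        then have "hs \<in> simplices G (Suc (n + 2))" using hs by (intro simplicesI) auto
        moreover have "tate_delta G (n + 2) \<phi> hs = 0"
          using fun_cong[OF cyc, of hs] n ar by (simp add: tate_diff_def)
        ultimately show ?thesis by (simp add: tate_delta_eq)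
      qed
      then have "bar_h G (bar_d G \<phi>) gs = bar_h G (\<lambda>_. 0) gs"
        using gs by (intro bar_h_cong) auto
      moreover have "bar_d G \<psi> gs = bar_d G (\<lambda>hs. \<Sum>i\<in>{()}. (- 1) * bar_h G \<phi> hs) gs"
      proof (rule bar_d_cong[OF gs(2)])
        fix hs assume hs: "set hs \<subseteq> carrier G" "Suc (length hs) = length gs"
        show "\<psi> hs = (\<Sum>i\<in>{()}. (- 1) * bar_h G \<phi> hs)"
          using hs gs normalized_bar_h[OF norm] simplicesI[of hs n G]
          by (cases "\<one> \<in> set hs") (auto simp: \<psi>_def normalized_def)
      qed
      moreover have "\<dots> = - bar_d G (bar_h G \<phi>) gs" by (subst bar_d_sum) simp
      ultimately show ?thesis
        using bar_B_null_homotopic[OF norm gs(2)] True n ar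
        by (simp add: tate_B_def tate_diff_def tate_delta_eq bar_h_zero)
    next
      case False
      then show ?thesis using n ar by (simp add: tate_B_def tate_diff_def tate_delta_eq)
    qed
    moreover have "\<psi> \<in> tate_space G (a - 2)" by (simp add: tate_space_def \<psi>_def ar)
    ultimately show ?thesis by blast
  next
    case 2
    show ?thesis
    proof (rule zero)
      have "bar_B G \<phi> [] = 0" using norm by (simp add: bar_B_def normalized_def)
      then show "tate_B G a \<phi> = 0"
        using 2 by (auto simp: tate_B_def arity_def simplices_def fun_eq_iff)
      show "tate_diff G (a - 2) (0 :: ('g, 'k) tate) = 0"
        using 2 by (simp add: tate_diff_def fun_eq_iff)
    qed
  next
    case 3
    then show ?thesis
      by (intro zero) (auto simp: tate_B_def tate_diff_def tate_boundary_def fun_eq_iff)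
  next
    case 4
    show ?thesis
    proof (rule zero)
      have "bar_B G (\<lambda>ys. tate_chain G ys xs) [] = (0 :: 'k)" for xs
        by (simp add: bar_B_def tate_chain_def)
      then show "tate_B G a \<phi> = 0"
        using 4 by (auto simp: tate_B_def arity_def simplices_def fun_eq_iff)
      show "tate_diff G (a - 2) (0 :: ('g, 'k) tate) = 0"
        using 4 by (auto simp: tate_diff_def tate_boundary_def fun_eq_iff)
    qed
  next
    case 5
    define n where "n = arity a"
    have ar: "n > 0" "arity (a - 2) = n + 2" using 5 by (simp_all add: n_def arity_def)
    have bd: "tate_boundary G n \<phi> hs = 0" for hs
      using fun_cong[OF cyc, of hs] 5 by (simp add: tate_diff_def n_def)
    \<comment> \<open>The sign of the differential that leaves the degree of the bounding chain.\<close>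
    define s :: 'k where "s = (-1) ^ (n + 2)"
    have s: "s * (s * x) = x" for x
      unfolding s_def mult.assoc[symmetric] power_add[symmetric] by simp
    define \<psi> where "\<psi> = (\<lambda>hs. if hs \<in> simplices G (n + 2) then
      s * (\<Sum>gs\<in>simplices G n. \<phi> gs * bar_h G (\<lambda>ys. tate_chain G ys hs) gs) else 0)"
    have "tate_B G a \<phi> xs = tate_diff G (a - 2) \<psi> xs" for xs
    proof -
      let ?T = "\<lambda>ys. tate_chain G ys xs :: 'k"
      have "tate_diff G (a - 2) \<psi> xs = s * (\<Sum>hs\<in>simplices G (n + 2). \<psi> hs * bar_d G ?T hs)"
        using 5 by (simp add: tate_diff_def ar tate_boundary_eq s_def)
      also have "\<dots> = (\<Sum>hs\<in>simplices G (n + 2). \<Sum>gs\<in>simplices G n.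
          \<phi> gs * (bar_d G ?T hs * bar_h G (\<lambda>ys. tate_chain G ys hs) gs))"
        by (simp add: \<psi>_def sum_distrib_left sum_distrib_right mult_ac s)
      also have "\<dots> = (\<Sum>gs\<in>simplices G n. \<phi> gs * bar_h G (bar_d G ?T) gs)"
        by (subst sum.swap)
          (simp add: bar_h_pairing[OF normalized_bar_d[OF normalized_tate_chain]] sum_distrib_left)
      also have "\<dots> = (\<Sum>gs\<in>simplices G n. \<phi> gs * bar_B G ?T gs)
          + (\<Sum>gs\<in>simplices G n. \<phi> gs * bar_d G (bar_h G ?T) gs)"
        unfolding sum.distrib[symmetric]
        by (rule sum.cong)
          (auto simp: bar_B_null_homotopic[OF normalized_tate_chain] simplicesD algebra_simps)
      also have "(\<Sum>gs\<in>simplices G n. \<phi> gs * bar_d G (bar_h G ?T) gs) = 0"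
        by (simp add: bar_d_pairing[OF ar(1) normalized_bar_h[OF normalized_tate_chain]] bd)
      finally show ?thesis using 5 by (simp add: tate_B_def n_def)
    qed
    moreover have "\<psi> \<in> tate_space G (a - 2)" by (simp add: tate_space_def \<psi>_def ar)
    ultimately show ?thesis by blast
  qed
qed

end

section \<open>The embedding as a split chain map\<close>

definition tate_scale :: "'k::field \<Rightarrow> ('g, 'k) tate \<Rightarrow> ('g, 'k) tate"
  where "tate_scale c f = (\<lambda>gs. c * f gs)"

lemma nonzero_sum: "sum f A \<noteq> 0 \<Longrightarrow> \<exists>a\<in>A. f a \<noteq> 0"
  by (meson sum.neutral)

lemma ga_mult_nonzero:
  assumes "ga_mult G u v x \<noteq> 0"
  shows "\<exists>g\<in>carrier G. \<exists>h\<in>carrier G. u g \<noteq> 0 \<and> v h \<noteq> 0 \<and> x = g \<otimes>\<^bsub>G\<^esub> h"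
  using nonzero_sum[OF assms[unfolded ga_mult_def]] by (auto split: prod.splits)

lemma hoch_chain_nonzero:
  "hoch_chain G a ys xs x \<noteq> 0 \<Longrightarrow> xs = ys \<and> \<one>\<^bsub>G\<^esub> \<notin> set xs \<and> a x \<noteq> 0"
  by (auto simp: hoch_chain_def split: if_splits)

context finite_group begin

text \<open>
  The only pair \<open>(g, h)\<close> with \<open>g h = x\<close> and \<open>g = a\<close> is \<open>(a, a\<^sup>-\<^sup>1 x)\<close>.
\<close>

lemma ga_mult_of_left:
  assumes "a \<in> carrier G"
  shows "ga_mult G (ga_of a) u x = (if x \<in> carrier G then u (inv a \<otimes> x) else (0 :: 'k::field))"
proof -
  define P where "P = {(g, h). g \<in> carrier G \<and> h \<in> carrier G \<and> g \<otimes> h = x}"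
  have fin: "finite P"
    by (rule finite_subset[of _ "carrier G \<times> carrier G"]) (auto simp: P_def finite_carrier)
  have "ga_mult G (ga_of a) u x = (\<Sum>p\<in>P. if p = (a, inv a \<otimes> x) then u (inv a \<otimes> x) else 0)"
    unfolding ga_mult_def P_def
    by (rule sum.cong) (auto simp: ga_of_def inv_mult_cancel' split: if_splits)
  also have "\<dots> = (if (a, inv a \<otimes> x) \<in> P then u (inv a \<otimes> x) else 0)"
    using fin by (simp add: sum.delta)
  also have "(a, inv a \<otimes> x) \<in> P \<longleftrightarrow> x \<in> carrier G"
    using assms by (auto simp: P_def inv_mult_cancel) (metis m_closed)
  finally show ?thesis .
qed

lemma ga_mult_of_right:
  assumes "a \<in> carrier G"
  shows "ga_mult G u (ga_of a) x = (if x \<in> carrier G then u (x \<otimes> inv a) else (0 :: 'k::field))"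
proof -
  define P where "P = {(g, h). g \<in> carrier G \<and> h \<in> carrier G \<and> g \<otimes> h = x}"
  have fin: "finite P"
    by (rule finite_subset[of _ "carrier G \<times> carrier G"]) (auto simp: P_def finite_carrier)
  have "ga_mult G u (ga_of a) x = (\<Sum>p\<in>P. if p = (x \<otimes> inv a, a) then u (x \<otimes> inv a) else 0)"
    unfolding ga_mult_def P_def
    by (rule sum.cong) (auto simp: ga_of_def m_assoc split: if_splits)
  also have "\<dots> = (if (x \<otimes> inv a, a) \<in> P then u (x \<otimes> inv a) else 0)"
    using fin by (simp add: sum.delta)
  also have "(x \<otimes> inv a, a) \<in> P \<longleftrightarrow> x \<in> carrier G"
  proof
    assume "(x \<otimes> inv a, a) \<in> P"
    then have "x \<otimes> inv a \<in> carrier G" "x \<otimes> inv a \<otimes> a = x" by (auto simp: P_def)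
    then show "x \<in> carrier G" using m_closed assms by metis
  qed (use assms in \<open>simp add: P_def m_assoc\<close>)
  finally show ?thesis .
qed

lemma tate_iota_eq:
  assumes "\<phi> \<in> tate_space G m"
  shows "tate_iota G m \<phi> = (\<lambda>gs x. \<phi> gs * ga_of (weight G m gs) x)"
proof (intro ext)
  fix xs x
  have \<phi>: "\<phi> gs = 0" if "gs \<notin> simplices G (arity m)" for gs
    using assms that by (auto simp: tate_space_def)
  show "tate_iota G m \<phi> xs x = \<phi> xs * ga_of (weight G m xs) x"
  proof (cases "m \<ge> 0")
    case True
    then show ?thesis by (simp add: tate_iota_def weight_def \<phi>)
  next
    case False
    have "tate_iota G m \<phi> xs x =
        (\<Sum>gs\<in>simplices G (arity m). if gs = xs then \<phi> gs * ga_of (weight G m gs) x else 0)"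
      unfolding tate_iota_def if_not_P[OF False]
      by (rule sum.cong)
        (use False in \<open>auto simp: hoch_chain_def weight_def simplicesD group_prod_inv_rev\<close>)
    then show ?thesis by (simp add: finite_simplices \<phi>)
  qed
qed

lemma supported_iff_iota:
  "supported G m z \<longleftrightarrow> z = (\<lambda>gs x. tate_retract G m z gs * ga_of (weight G m gs) x)"
  by (auto simp: supported_def tate_retract_def ga_of_def fun_eq_iff split: if_splits)

lemma tate_retract_closed:
  "z \<in> th_space G m \<Longrightarrow> tate_retract G m z \<in> tate_space G m"
  by (auto simp: th_space_def hoch_space_def tate_space_def tate_retract_def)

lemma iota_retract:
  assumes "z \<in> th_space G m" "supported G m z"
  shows "tate_iota G m (tate_retract G m z) = z"
  unfolding tate_iota_eq[OF tate_retract_closed[OF assms(1)]]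
  by (rule sym, rule iffD1[OF supported_iff_iota assms(2)])

lemma retract_iota: "\<phi> \<in> tate_space G m \<Longrightarrow> tate_retract G m (tate_iota G m \<phi>) = \<phi>"
  by (simp add: tate_iota_eq tate_retract_def ga_of_def)

lemma supported_iota: "\<phi> \<in> tate_space G m \<Longrightarrow> supported G m (tate_iota G m \<phi>)"
  by (simp add: tate_iota_eq supported_def ga_of_def)

lemma tate_iota_closed:
  assumes "\<phi> \<in> tate_space G m"
  shows "tate_iota G m \<phi> \<in> th_space G m"
proof -
  have "gs \<in> simplices G (arity m) \<and> x \<in> carrier G" if "tate_iota G m \<phi> gs x \<noteq> 0" for gs x
  proof -
    have "\<phi> gs \<noteq> 0" "x = weight G m gs"
      using that by (auto simp: tate_iota_eq[OF assms] ga_of_def split: if_splits)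
    moreover from this have "gs \<in> simplices G (arity m)" using assms by (simp add: tate_space_def)
    ultimately show ?thesis using weight_closed[OF simplicesD(2)[of gs G]] by simp
  qed
  then show ?thesis by (simp add: th_space_def hoch_space_def)
qed

lemma tate_complex:
  "linear_complex (tate_scale :: 'k::field \<Rightarrow> ('g, 'k) tate \<Rightarrow> _) (tate_space G) (tate_diff G)"
proof -
  interpret vector_space "tate_scale :: 'k::field \<Rightarrow> ('g, 'k) tate \<Rightarrow> _"
    by unfold_locales (auto simp: tate_scale_def fun_eq_iff algebra_simps)
  show ?thesis
  proof
    fix n and \<phi> \<psi> :: "('g, 'k) tate" and c
    show "subspace (tate_space G n :: ('g, 'k) tate set)"
    proof (rule subspaceI)
      fix \<phi> \<psi> :: "('g, 'k) tate" assume "\<phi> \<in> tate_space G n" "\<psi> \<in> tate_space G n"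
      then have "\<phi> gs = 0" "\<psi> gs = 0" if "gs \<notin> simplices G (arity n)" for gs
        using that by (auto simp: tate_space_def)
      then have "(\<phi> + \<psi>) gs = 0" if "gs \<notin> simplices G (arity n)" for gs
        using that by simp
      then show "\<phi> + \<psi> \<in> tate_space G n" unfolding tate_space_def by blast
    qed (auto simp: tate_space_def tate_scale_def)
    show "tate_diff G n (\<phi> + \<psi>) = tate_diff G n \<phi> + tate_diff G n \<psi>"
      by (auto simp: tate_diff_def tate_delta_def tate_boundary_def fun_eq_iff distrib_left distrib_right sum.distrib)
    show "tate_diff G n (tate_scale c \<phi>) = tate_scale c (tate_diff G n \<phi>)"
      by (auto simp: tate_diff_def tate_delta_def tate_boundary_def tate_scale_def fun_eq_iff
          distrib_left right_diff_distrib sum_distrib_left mult_ac)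
  qed
qed

lemma hoch_delta_eq:
  "hoch_delta G n f gs x = (if gs \<in> simplices G (n + 1) then
      (if x \<in> carrier G then f (tl gs) (inv (hd gs) \<otimes> x) else 0)
      + (\<Sum>i=1..n. (-1) ^ i * f (merge G i gs) x)
      + (-1) ^ (n + 1) * (if x \<in> carrier G then f (butlast gs) (x \<otimes> inv (last gs)) else 0)
    else (0 :: 'k::field))"
proof (cases "gs \<in> simplices G (n + 1)")
  case True
  then have "gs \<noteq> []" "set gs \<subseteq> carrier G" by (auto dest: simplicesD)
  then have "hd gs \<in> carrier G" "last gs \<in> carrier G" by (auto simp: subset_iff)
  then show ?thesis using True by (simp add: hoch_delta_def ga_mult_of_left ga_mult_of_right)
qed (simp add: hoch_delta_def)

lemma th_complex:
  "linear_complex (th_scale :: 'k::field \<Rightarrow> ('g, 'k) hoch \<Rightarrow> _) (th_space G) (th_diff G)"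
proof -
  interpret vector_space "th_scale :: 'k::field \<Rightarrow> ('g, 'k) hoch \<Rightarrow> _"
    by unfold_locales (auto simp: th_scale_def fun_eq_iff algebra_simps)
  show ?thesis
  proof
    fix n and \<phi> \<psi> :: "('g, 'k) hoch" and c
    show "subspace (th_space G n :: ('g, 'k) hoch set)"
    proof (rule subspaceI)
      fix \<phi> \<psi> :: "('g, 'k) hoch"
      assume *: "\<phi> \<in> th_space G n" "\<psi> \<in> th_space G n"
      have "gs \<in> simplices G (arity n) \<and> x \<in> carrier G" if "(\<phi> + \<psi>) gs x \<noteq> 0" for gs x
      proof (cases "\<phi> gs x = 0")
        case True
        then have "\<psi> gs x \<noteq> 0" using that by simp
        then show ?thesis using *(2) unfolding th_space_def hoch_space_def mem_Collect_eq by simp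
      next
        case False
        then show ?thesis using *(1) unfolding th_space_def hoch_space_def mem_Collect_eq by simp
      qed
      then show "\<phi> + \<psi> \<in> th_space G n"
        unfolding th_space_def hoch_space_def mem_Collect_eq by simp
    qed (auto simp: th_space_def hoch_space_def th_scale_def)
    have "hoch_delta G p (\<phi> + \<psi>) = hoch_delta G p \<phi> + hoch_delta G p \<psi>" for p
      by (simp add: hoch_delta_eq fun_eq_iff distrib_left sum.distrib)
    moreover have "hoch_lin G p F (\<phi> + \<psi>) = hoch_lin G p F \<phi> + hoch_lin G p F \<psi>" for p F
      by (simp add: hoch_lin_def fun_eq_iff distrib_right sum.distrib)
    moreover have "hoch_tau G (\<phi> + \<psi>) = hoch_tau G \<phi> + hoch_tau G \<psi>"
      by (simp add: hoch_tau_def fun_eq_iff distrib_right sum.distrib)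
    ultimately show "th_diff G n (\<phi> + \<psi>) = th_diff G n \<phi> + th_diff G n \<psi>"
      by (auto simp: th_diff_def hoch_boundary_def fun_eq_iff distrib_left)
    have "hoch_delta G p (th_scale c \<phi>) = th_scale c (hoch_delta G p \<phi>)" for p
      by (simp add: hoch_delta_eq th_scale_def fun_eq_iff distrib_left right_diff_distrib sum_distrib_left mult_ac)
    moreover have "hoch_lin G p F (th_scale c \<phi>) = th_scale c (hoch_lin G p F \<phi>)" for p F
      by (simp add: hoch_lin_def th_scale_def fun_eq_iff sum_distrib_left mult_ac)
    moreover have "hoch_tau G (th_scale c \<phi>) = th_scale c (hoch_tau G \<phi>)"
      by (simp add: hoch_tau_def th_scale_def fun_eq_iff sum_distrib_left mult_ac)
    ultimately show "th_diff G n (th_scale c \<phi>) = th_scale c (th_diff G n \<phi>)"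
      by (auto simp: th_diff_def hoch_boundary_def th_scale_def fun_eq_iff mult_ac)
  qed
qed

lemma tate_chain_in_simplices:
  "tate_chain G ys xs \<noteq> (0 :: 'k::field) \<Longrightarrow> set ys \<subseteq> carrier G \<Longrightarrow> length ys = p \<Longrightarrow> xs \<in> simplices G p"
  by (auto simp: tate_chain_def simplices_def split: if_splits)

lemma tate_diff_closed:
  fixes \<phi> :: "('g, 'k::field) tate"
  assumes "\<phi> \<in> tate_space G m"
  shows "tate_diff G m \<phi> \<in> tate_space G (m + 1)"
proof -
  consider "m \<ge> 0" | "m = -1" | "m < -1" by linarith
  then show ?thesis
  proof cases
    case 1
    then have "arity (m + 1) = Suc (nat m)" by (simp add: arity_def)
    then show ?thesis using 1 by (simp add: tate_diff_def tate_space_def tate_delta_def)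
  next
    case 2
    then show ?thesis using assms by (auto simp: tate_diff_def tate_space_def arity_def)
  next
    case 3
    define p where "p = nat (- m - 2)"
    have p: "arity m = Suc p" "arity (m + 1) = p" using 3 by (auto simp: arity_def p_def)
    have "xs \<in> simplices G p" if nz: "tate_boundary G (Suc p) \<phi> xs \<noteq> 0" for xs
    proof (rule ccontr)
      assume xs: "xs \<notin> simplices G p"
      have "bar_d G (\<lambda>ys. tate_chain G ys xs :: 'k) gs = bar_d G (\<lambda>ys. \<Sum>i\<in>{}. 0 * 0) gs"
        if "gs \<in> simplices G (Suc p)" for gs
        using xs simplicesD[OF that] tate_chain_in_simplices[where xs = xs and p = p]
        by (intro bar_d_cong) auto
      moreover have "bar_d G (\<lambda>ys. \<Sum>i\<in>{}. 0 * 0 :: 'k) gs = 0" for gs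
        by (simp add: bar_d_def)
      ultimately have "tate_boundary G (Suc p) \<phi> xs = 0"
        by (simp add: tate_boundary_eq)
      then show False using nz by simp
    qed
    then show ?thesis using 3 by (auto simp: tate_diff_def tate_space_def p)
  qed
qed

text \<open>
  Each face of a tuple carries the weight that its term in the differential requires: merging
  neighbours preserves the product, and moving an outer entry into the coefficient cancels it. In
  degree -1, \<open>g h g\<^sup>-\<^sup>1 = 1\<close> holds for all \<open>g\<close> if \<open>h = 1\<close> and for none otherwise, which turns
  \<open>\<tau>\<close> into multiplication by the group order.
\<close>

lemma retract_diff:
  fixes z :: "('g, 'k::field) hoch"
  assumes "z \<in> th_space G m"
  shows "tate_retract G (m + 1) (th_diff G m z) = tate_diff G m (tate_retract G m z)"
proof -
  consider "m \<ge> 0" | "m = -1" | "m < -1" by linarith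
  then show ?thesis
  proof cases
    case 1
    define n where "n = nat m"
    have "hoch_delta G n z gs (group_prod G gs) = tate_delta G n (tate_retract G m z) gs" for gs
    proof (cases "gs \<in> simplices G (n + 1)")
      case True
      have gs: "set gs \<subseteq> carrier G" "gs \<noteq> []" "length gs = Suc n" using simplicesD[OF True] by auto
      have c: "hd gs \<in> carrier G" "last gs \<in> carrier G" "set (tl gs) \<subseteq> carrier G"
         "set (butlast gs) \<subseteq> carrier G"
        using gs by (auto dest: in_set_butlastD list.set_sel(2) simp: subset_iff)
      have "inv (hd gs) \<otimes> group_prod G gs = group_prod G (tl gs)"
        using c by (simp add: group_prod_hd[OF gs(2)] inv_mult_cancel')
      moreover have "group_prod G gs \<otimes> inv (last gs) = group_prod G (butlast gs)"
        using c by (simp add: group_prod_butlast[OF gs(1,2)] m_assoc)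
      moreover have "group_prod G (merge G i gs) = group_prod G gs" if "i \<in> {1..n}" for i
        using that gs by (intro group_prod_merge) auto
      ultimately show ?thesis
        using True gs 1 by (simp add: hoch_delta_eq tate_delta_def tate_retract_def weight_def)
    qed (simp add: hoch_delta_def tate_delta_def)
    then show ?thesis
      using 1 by (simp add: th_diff_def tate_diff_def tate_retract_def weight_def n_def)
  next
    case 2
    have "hoch_tau G z [] \<one> = of_nat (card (carrier G)) * z [] \<one>"
    proof -
      have "(\<Sum>g\<in>carrier G. ga_of (g \<otimes> h \<otimes> inv g) \<one>) =
          (if h = \<one> then of_nat (card (carrier G)) else (0 :: 'k))" if h: "h \<in> carrier G" for h
      proof -
        have "\<one> = g \<otimes> h \<otimes> inv g \<longleftrightarrow> h = \<one>" if "g \<in> carrier G" for g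
        proof
          assume "\<one> = g \<otimes> h \<otimes> inv g"
          then have "\<one> \<otimes> g = g \<otimes> h \<otimes> inv g \<otimes> g" by simp
          then show "h = \<one>" using that h by (simp add: m_assoc)
        qed (use that in simp)
        then show ?thesis by (simp add: ga_of_def)
      qed
      then have "hoch_tau G z [] \<one> =
          (\<Sum>h\<in>carrier G. if h = \<one> then of_nat (card (carrier G)) * z [] h else 0)"
        unfolding hoch_tau_def by (auto intro!: sum.cong)
      then show ?thesis by (simp add: finite_carrier)
    qed
    moreover have "z gs x = 0" if "gs \<noteq> []" for gs x
      using assms 2 that by (auto simp: th_space_def hoch_space_def arity_def simplices_def)
    ultimately show ?thesis
      using 2 by (auto simp: th_diff_def tate_diff_def tate_retract_def weight_def fun_eq_iff)
        (simp add: hoch_tau_def)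
  next
    case 3
    define p where "p = arity m"
    have p: "p > 0" using 3 by (simp add: p_def arity_def)
    have "hoch_boundary G p z xs (weight G (m + 1) xs) = tate_boundary G p (tate_retract G m z) xs" for xs
    proof -
      let ?T = "\<lambda>ys. tate_chain G ys xs :: 'k" and ?w = "weight G (m + 1) xs"
      have T: "?T ys * ga_of a ?w = ?T ys * ga_of b c"
        if "a = inv (group_prod G ys) \<longleftrightarrow> c = b" for ys a b c
        using that 3 by (auto simp: tate_chain_def weight_def ga_of_def)
      have "(\<Sum>g0\<in>carrier G. z gs g0 *
           (?T (tl gs) * ga_of (g0 \<otimes> hd gs) ?w
            + (\<Sum>i=1..<p. (-1) ^ i * (?T (merge G i gs) * ga_of g0 ?w))
            + (-1) ^ p * (?T (butlast gs) * ga_of (last gs \<otimes> g0) ?w))) =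
          tate_retract G m z gs *
           (?T (tl gs) + (\<Sum>i=1..<p. (-1) ^ i * ?T (merge G i gs)) + (-1) ^ p * ?T (butlast gs))"
        (is "?L = ?R") if "gs \<in> simplices G p" for gs
      proof -
        have gs: "set gs \<subseteq> carrier G" "gs \<noteq> []" "length gs = p" using simplicesD[OF that] p by auto
        have c: "hd gs \<in> carrier G" "last gs \<in> carrier G" "set (tl gs) \<subseteq> carrier G"
           "set (butlast gs) \<subseteq> carrier G"
          using gs by (auto dest: in_set_butlastD list.set_sel(2) simp: subset_iff)
        let ?v = "weight G m gs"
        have v: "?v = inv (group_prod G gs)" using 3 by (simp add: weight_def)
        have "?L = (\<Sum>g0\<in>carrier G. z gs g0 * (ga_of ?v g0 *
           (?T (tl gs) + (\<Sum>i=1..<p. (-1) ^ i * ?T (merge G i gs)) + (-1) ^ p * ?T (butlast gs))))"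
        proof (rule sum.cong[OF refl])
          fix g0 assume g0: "g0 \<in> carrier G"
          have "g0 \<otimes> hd gs = inv (group_prod G (tl gs)) \<longleftrightarrow> g0 = ?v"
            unfolding v group_prod_hd[OF gs(2)] using g0 c
            by (simp add: inv_mult_group) (metis inv_solve_right group_prod_closed inv_closed)
          then have 1: "?T (tl gs) * ga_of (g0 \<otimes> hd gs) ?w = ?T (tl gs) * ga_of ?v g0"
            by (rule T)
          have "last gs \<otimes> g0 = inv (group_prod G (butlast gs)) \<longleftrightarrow> g0 = ?v"
            unfolding v group_prod_butlast[OF gs(1,2)] using g0 c
            by (simp add: inv_mult_group) (metis inv_solve_left group_prod_closed inv_closed)
          then have 2: "?T (butlast gs) * ga_of (last gs \<otimes> g0) ?w = ?T (butlast gs) * ga_of ?v g0"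
            by (rule T)
          have 3: "?T (merge G i gs) * ga_of g0 ?w = ?T (merge G i gs) * ga_of ?v g0"
            if "i \<in> {1..<p}" for i
          proof (rule T)
            have "group_prod G (merge G i gs) = group_prod G gs"
              by (rule group_prod_merge) (use that gs in auto)
            then show "g0 = inv (group_prod G (merge G i gs)) \<longleftrightarrow> g0 = ?v" by (simp add: v)
          qed
          show "z gs g0 * (?T (tl gs) * ga_of (g0 \<otimes> hd gs) ?w
            + (\<Sum>i=1..<p. (-1) ^ i * (?T (merge G i gs) * ga_of g0 ?w))
            + (-1) ^ p * (?T (butlast gs) * ga_of (last gs \<otimes> g0) ?w)) = z gs g0 * (ga_of ?v g0 *
           (?T (tl gs) + (\<Sum>i=1..<p. (-1) ^ i * ?T (merge G i gs)) + (-1) ^ p * ?T (butlast gs)))"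
            by (simp add: 1 2 3 distrib_left right_diff_distrib sum_distrib_left mult_ac)
        qed
        also have "\<dots> = (\<Sum>g0\<in>carrier G. if g0 = ?v then ?R else 0)"
          by (rule sum.cong) (auto simp: ga_of_def tate_retract_def)
        finally show ?thesis using gs by (simp add: finite_carrier)
      qed
      then show ?thesis
        by (simp add: hoch_boundary_def hoch_lin_def tate_boundary_def hoch_chain_ga_of)
    qed
    then show ?thesis
      using 3 by (simp add: th_diff_def tate_diff_def tate_retract_def p_def)
  qed
qed

text \<open>
  A supported chain only feeds the weight of each tuple into a linearly extended map, so support has
  to be checked only there. This covers the boundary and all cup products with a chain.
\<close>

lemma hoch_lin_supported:
  assumes "supported G m c"
    and "\<And>gs. gs \<in> simplices G p \<Longrightarrow> supported G m' (F (weight G m gs) gs)"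
  shows "supported G m' (hoch_lin G p F c)"
  unfolding supported_def
proof (intro allI impI)
  fix xs x assume nz: "hoch_lin G p F c xs x \<noteq> 0"
  obtain gs where gs: "gs \<in> simplices G p" "(\<Sum>g0\<in>carrier G. c gs g0 * F g0 gs xs x) \<noteq> 0"
    using nonzero_sum[OF nz[unfolded hoch_lin_def]] by blast
  obtain g0 where "c gs g0 * F g0 gs xs x \<noteq> 0"
    using nonzero_sum[OF gs(2)] by blast
  then have "c gs g0 \<noteq> 0" "F g0 gs xs x \<noteq> 0" by auto
  then show "x = weight G m' xs"
    using assms(1) assms(2)[OF gs(1)] unfolding supported_def by metis
qed

lemma supported_hoch_chain:
  assumes "\<And>x. a x \<noteq> 0 \<Longrightarrow> x = weight G m gs"
  shows "supported G m (hoch_chain G a gs)"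
  using assms by (auto simp: supported_def dest!: hoch_chain_nonzero)

lemma supported_sum: "(\<And>i. i \<in> I \<Longrightarrow> supported G m (F i)) \<Longrightarrow> supported G m (\<Sum>i\<in>I. F i)"
proof (induction I rule: infinite_finite_induct)
  case (insert i I)
  then have "supported G m (F i)" "supported G m (\<Sum>i\<in>I. F i)" by auto
  then show ?case using insert(1,2) unfolding supported_def by (simp add: plus_fun_def) (metis add_0)
qed (simp_all add: supported_def)

text \<open>
  Since the retraction commutes with the differentials, it only remains to see that the
  differential preserves supports.
\<close>

lemma th_diff_iota:
  assumes "\<phi> \<in> tate_space G m"
  shows "tate_iota G (m + 1) (tate_diff G m \<phi>) = th_diff G m (tate_iota G m \<phi>)"
proof -
  define z where "z = tate_iota G m \<phi>"
  have z: "z gs x = 0" if "x \<noteq> weight G m gs" for gs x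
    using supported_iota[OF assms] that by (auto simp: supported_def z_def)
  have zs: "z \<in> th_space G m" using tate_iota_closed[OF assms] by (simp add: z_def)
  have supp: "supported G (m + 1) (th_diff G m z)"
  proof -
    consider "m \<ge> 0" | "m = -1" | "m < -1" by linarith
    then show ?thesis
    proof cases
      case 1
      have "hoch_delta G n z gs x = 0" if x: "x \<noteq> group_prod G gs" for n gs x
      proof (cases "gs \<in> simplices G (n + 1)")
        case True
        have gs: "set gs \<subseteq> carrier G" "gs \<noteq> []" "length gs = Suc n" using simplicesD[OF True] by auto
        have c: "hd gs \<in> carrier G" "last gs \<in> carrier G" "set (tl gs) \<subseteq> carrier G"
           "set (butlast gs) \<subseteq> carrier G"
          using gs by (auto dest: in_set_butlastD list.set_sel(2) simp: subset_iff)
        have "inv (hd gs) \<otimes> x \<noteq> group_prod G (tl gs)" if "x \<in> carrier G"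
          using c x that group_prod_hd[OF gs(2)] inv_mult_cancel by metis
        moreover have "x \<otimes> inv (last gs) \<noteq> group_prod G (butlast gs)" if "x \<in> carrier G"
        proof
          assume "x \<otimes> inv (last gs) = group_prod G (butlast gs)"
          then have "x = group_prod G (butlast gs) \<otimes> last gs"
            using c that by (metis inv_solve_right' group_prod_closed inv_closed inv_inv m_assoc l_inv r_one)
          then show False using x group_prod_butlast[OF gs(1,2)] by simp
        qed
        moreover have "group_prod G (merge G i gs) = group_prod G gs" if "i \<in> {1..n}" for i
          using that gs by (intro group_prod_merge) auto
        ultimately show ?thesis
          using 1 x by (simp add: hoch_delta_eq z weight_def)
      qed (simp add: hoch_delta_def)
      then show ?thesis using 1 unfolding supported_def th_diff_def weight_def by auto
    next
      case 2
      have "hoch_tau G z [] x = 0" if x: "x \<noteq> \<one>" for x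
      proof -
        have "z [] h * (\<Sum>g\<in>carrier G. ga_of (g \<otimes> h \<otimes> inv g) x) = 0" if "h \<in> carrier G" for h
          using x z[of h "[]"] 2 by (cases "h = \<one>") (auto simp: weight_def ga_of_def)
        then show ?thesis unfolding hoch_tau_def by (simp add: sum.neutral del: mult_eq_0_iff)
      qed
      then show ?thesis using 2 by (auto simp: supported_def th_diff_def weight_def hoch_tau_def)
    next
      case 3
      define p where "p = arity m"
      have p: "p > 0" using 3 by (simp add: p_def arity_def)
      have "supported G (m + 1) (hoch_boundary G p z)"
        unfolding hoch_boundary_def
      proof (rule hoch_lin_supported)
        show "supported G m z" using supported_iota[OF assms] by (simp add: z_def)
        fix gs assume "gs \<in> simplices G p"
        then have gs: "set gs \<subseteq> carrier G" "gs \<noteq> []" "length gs = p" using simplicesD p by fastforce+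
        have c: "hd gs \<in> carrier G" "last gs \<in> carrier G" "set (tl gs) \<subseteq> carrier G"
           "set (butlast gs) \<subseteq> carrier G"
          using gs by (auto dest: in_set_butlastD list.set_sel(2) simp: subset_iff)
        have hd: "weight G m gs \<otimes> hd gs = weight G (m + 1) (tl gs)"
          using 3 c by (simp add: weight_def group_prod_hd[OF gs(2)] inv_mult_group m_assoc)
        have last: "last gs \<otimes> weight G m gs = weight G (m + 1) (butlast gs)"
          using 3 c by (simp add: weight_def group_prod_butlast[OF gs(1,2)] inv_mult_group inv_mult_cancel)
        have mid: "weight G m gs = weight G (m + 1) (merge G i gs)" if "i \<in> {1..<p}" for i
          using 3 that gs by (simp add: weight_def group_prod_merge)
        have K: "hoch_chain G (ga_of (weight G (m + 1) ys)) ys xs x = 0"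
          if "x \<noteq> weight G (m + 1) xs" for ys xs x
          using that by (auto simp: hoch_chain_def ga_of_def)
        have "hoch_chain G (ga_of (weight G m gs \<otimes> hd gs)) (tl gs) xs x
          + (\<Sum>i=1..<p. (-1) ^ i * hoch_chain G (ga_of (weight G m gs)) (merge G i gs) xs x)
          + (-1) ^ p * hoch_chain G (ga_of (last gs \<otimes> weight G m gs)) (butlast gs) xs x = 0"
          if "x \<noteq> weight G (m + 1) xs" for xs x
        proof -
          have "hoch_chain G (ga_of (weight G m gs)) (merge G i gs) xs x = 0" if "i \<in> {1..<p}" for i
            unfolding mid[OF that] by (rule K) fact
          then have "(\<Sum>i=1..<p. (-1) ^ i * hoch_chain G (ga_of (weight G m gs)) (merge G i gs) xs x) = 0"
            by (intro sum.neutral ballI) simp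
          then show ?thesis by (simp only: hd last K[OF that]) simp
        qed
        then show "supported G (m + 1) (\<lambda>xs x.
          hoch_chain G (ga_of (weight G m gs \<otimes> hd gs)) (tl gs) xs x
          + (\<Sum>i=1..<p. (-1) ^ i * hoch_chain G (ga_of (weight G m gs)) (merge G i gs) xs x)
          + (-1) ^ p * hoch_chain G (ga_of (last gs \<otimes> weight G m gs)) (butlast gs) xs x)"
          unfolding supported_def by blast
      qed
      then show ?thesis using 3 by (simp add: supported_def th_diff_def p_def)
    qed
  qed
  have "tate_retract G (m + 1) (th_diff G m z) = tate_diff G m \<phi>"
    using retract_diff[OF zs] retract_iota[OF assms] by (simp add: z_def)
  then have "th_diff G m z = (\<lambda>gs x. tate_diff G m \<phi> gs * ga_of (weight G (m + 1) gs) x)"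
    using iffD1[OF supported_iff_iota supp] by simp
  then show ?thesis
    unfolding tate_iota_eq[OF tate_diff_closed[OF assms]] z_def by (rule sym)
qed

end

section \<open>Cup products and the BV-operator on the image\<close>

context finite_group begin

lemma group_prod_split:
  assumes "set gs \<subseteq> carrier G"
  shows "group_prod G gs = group_prod G (take n gs) \<otimes> group_prod G (drop n gs)"
proof -
  have "set (take n gs) \<subseteq> carrier G" "set (drop n gs) \<subseteq> carrier G"
    using assms by (auto dest: in_set_takeD in_set_dropD)
  from group_prod_append[OF this] show ?thesis by simp
qed

text \<open>
  In each case the free variable \<open>g\<close> of the sum, if any, occurs together with its inverse and
  cancels from the product of the entries and the coefficient.
\<close>

lemma supported_cup:
  fixes \<alpha> \<beta> :: "('g, 'k::field) hoch"
  assumes \<alpha>: "supported G a \<alpha>" and \<beta>: "supported G b \<beta>"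
  shows "supported G (a + b) (th_cup G a b \<alpha> \<beta>)"
proof -
  define n m where "n = arity a" and "m = arity b"
  note cup = th_cup_def Let_def n_def[symmetric] m_def[symmetric]
  have \<alpha>D: "x = weight G a gs" if "\<alpha> gs x \<noteq> 0" for gs x using \<alpha> that by (simp add: supported_def)
  have \<beta>D: "x = weight G b gs" if "\<beta> gs x \<noteq> 0" for gs x using \<beta> that by (simp add: supported_def)
  have td: "set (take i gs) \<subseteq> carrier G" "set (drop i gs) \<subseteq> carrier G"
    if "set gs \<subseteq> carrier G" for i gs
    using that by (auto dest: in_set_takeD in_set_dropD)
  consider "a \<ge> 0" "b \<ge> 0" | "a < 0" "b < 0" | "a \<ge> 0" "b < 0" "n \<le> m" | "a \<ge> 0" "b < 0" "n > m"
    | "a < 0" "b \<ge> 0" "m \<le> n" | "a < 0" "b \<ge> 0" "m > n" by linarith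
  then show ?thesis
  proof cases
    case 1
    have "x = weight G (a + b) gs"
      if gs: "gs \<in> simplices G (n + m)" and nz: "ga_mult G (\<alpha> (take n gs)) (\<beta> (drop n gs)) x \<noteq> 0" for gs x
    proof -
      obtain g h where "\<alpha> (take n gs) g \<noteq> 0" "\<beta> (drop n gs) h \<noteq> 0" "x = g \<otimes> h"
        using ga_mult_nonzero[OF nz] by blast
      then show ?thesis
        using 1 \<alpha>D \<beta>D group_prod_split[OF simplicesD(2)[OF gs], of n] by (simp add: weight_def)
    qed
    then show ?thesis using 1 by (auto simp: cup supported_def)
  next
    case 2
    have "supported G (a + b) (\<Sum>g\<in>carrier G. hoch_chain G (ga_of (g \<otimes> weight G b hs))
        (hs @ [inv g \<otimes> weight G a gs] @ gs) :: ('g, 'k) hoch)"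
      if "gs \<in> simplices G n" "hs \<in> simplices G m" for gs hs
    proof (intro supported_sum supported_hoch_chain)
      fix g x assume g: "g \<in> carrier G" and "ga_of (g \<otimes> weight G b hs) x \<noteq> (0 :: 'k)"
      then have x: "x = g \<otimes> weight G b hs" by (simp add: ga_of_def split: if_splits)
      have c: "set gs \<subseteq> carrier G" "set hs \<subseteq> carrier G" using that simplicesD by blast+
      have "group_prod G (hs @ [inv g \<otimes> weight G a gs] @ gs) = group_prod G hs \<otimes> inv g"
        using 2 c g by (simp add: weight_def group_prod_append m_assoc)
      then show "x = weight G (a + b) (hs @ [inv g \<otimes> weight G a gs] @ gs)"
        using 2 c g x by (simp add: weight_def inv_mult_group)
    qed
    then show ?thesis
      using 2 by (simp add: cup) (intro hoch_lin_supported[OF \<alpha>] hoch_lin_supported[OF \<beta>], simp)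
  next
    case 3
    have neg: "a + b < 0" using 3 by (auto simp: n_def m_def arity_def split: if_splits)
    have "supported G (a + b) (hoch_chain G
        (ga_mult G (\<alpha> (drop (m - n) hs)) (ga_of (weight G b hs))) (take (m - n) hs))"
      if "hs \<in> simplices G m" for hs
    proof (rule supported_hoch_chain)
      fix x assume nz: "ga_mult G (\<alpha> (drop (m - n) hs)) (ga_of (weight G b hs)) x \<noteq> 0"
      have hs: "set hs \<subseteq> carrier G" using that simplicesD by blast
      obtain g where "\<alpha> (drop (m - n) hs) g \<noteq> 0" "x = g \<otimes> weight G b hs"
        using ga_mult_nonzero[OF nz] by (auto simp: ga_of_def split: if_splits)
      then have "x = group_prod G (drop (m - n) hs) \<otimes> inv (group_prod G hs)"
        using 3 \<alpha>D by (simp add: weight_def)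
      also have "\<dots> = inv (group_prod G (take (m - n) hs))"
        using td[OF hs] unfolding group_prod_split[OF hs, of "m - n"]
        by (simp add: inv_mult_group inv_mult_cancel)
      finally show "x = weight G (a + b) (take (m - n) hs)" using neg by (simp add: weight_def)
    qed
    then show ?thesis
      using 3 by (simp add: cup) (intro hoch_lin_supported[OF \<beta>], simp)
  next
    case 4
    have pos: "a + b \<ge> 0" using 4 by (auto simp: n_def m_def arity_def split: if_splits)
    have "supported G (a + b) (\<lambda>hs x. if hs \<in> simplices G (n - m - 1) then
        \<Sum>g\<in>carrier G. ga_mult G (\<alpha> (hs @ [inv g] @ gs)) (ga_of (weight G b gs \<otimes> g)) x else 0)"
      if "gs \<in> simplices G m" for gs
      unfolding supported_def
    proof (intro allI impI)
      fix hs x assume nz: "(if hs \<in> simplices G (n - m - 1) then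
        \<Sum>g\<in>carrier G. ga_mult G (\<alpha> (hs @ [inv g] @ gs)) (ga_of (weight G b gs \<otimes> g)) x else 0) \<noteq> 0"
      then have hs: "set hs \<subseteq> carrier G" using simplicesD(2) by (auto split: if_splits)
      have gs: "set gs \<subseteq> carrier G" using that simplicesD by blast
      obtain g where g: "g \<in> carrier G"
        and nz': "ga_mult G (\<alpha> (hs @ [inv g] @ gs)) (ga_of (weight G b gs \<otimes> g)) x \<noteq> 0"
        using nz nonzero_sum by (metis (mono_tags, lifting))
      obtain h where "\<alpha> (hs @ [inv g] @ gs) h \<noteq> 0" "x = h \<otimes> (weight G b gs \<otimes> g)"
        using ga_mult_nonzero[OF nz'] by (auto simp: ga_of_def split: if_splits)
      then have "x = group_prod G (hs @ [inv g] @ gs) \<otimes> (inv (group_prod G gs) \<otimes> g)"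
        using 4 \<alpha>D by (simp add: weight_def)
      also have "\<dots> = group_prod G hs"
        using hs gs g by (simp add: group_prod_append m_assoc inv_mult_cancel)
      finally show "x = weight G (a + b) hs" using pos by (simp add: weight_def)
    qed
    then show ?thesis
      using 4 by (simp add: cup) (intro hoch_lin_supported[OF \<beta>], simp)
  next
    case 5
    have neg: "a + b < 0" using 5 by (auto simp: n_def m_def arity_def split: if_splits)
    have "supported G (a + b) (hoch_chain G
        (ga_mult G (ga_of (weight G a gs)) (\<beta> (take m gs))) (drop m gs))"
      if "gs \<in> simplices G n" for gs
    proof (rule supported_hoch_chain)
      fix x assume nz: "ga_mult G (ga_of (weight G a gs)) (\<beta> (take m gs)) x \<noteq> 0"
      have gs: "set gs \<subseteq> carrier G" using that simplicesD by blast
      obtain h where "\<beta> (take m gs) h \<noteq> 0" "x = weight G a gs \<otimes> h"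
        using ga_mult_nonzero[OF nz] by (auto simp: ga_of_def split: if_splits)
      then have "x = inv (group_prod G gs) \<otimes> group_prod G (take m gs)"
        using 5 \<beta>D by (simp add: weight_def)
      also have "\<dots> = inv (group_prod G (drop m gs))"
        using td[OF gs] unfolding group_prod_split[OF gs, of m]
        by (simp add: inv_mult_group m_assoc)
      finally show "x = weight G (a + b) (drop m gs)" using neg by (simp add: weight_def)
    qed
    then show ?thesis
      using 5 by (simp add: cup) (intro hoch_lin_supported[OF \<alpha>], simp)
  next
    case 6
    have pos: "a + b \<ge> 0" using 6 by (auto simp: n_def m_def arity_def split: if_splits)
    have "supported G (a + b) (\<lambda>hs x. if hs \<in> simplices G (m - n - 1) then
        \<Sum>g\<in>carrier G. ga_mult G (ga_of (g \<otimes> weight G a gs)) (\<beta> (gs @ [inv g] @ hs)) x else 0)"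
      if "gs \<in> simplices G n" for gs
      unfolding supported_def
    proof (intro allI impI)
      fix hs x assume nz: "(if hs \<in> simplices G (m - n - 1) then
        \<Sum>g\<in>carrier G. ga_mult G (ga_of (g \<otimes> weight G a gs)) (\<beta> (gs @ [inv g] @ hs)) x else 0) \<noteq> 0"
      then have hs: "set hs \<subseteq> carrier G" using simplicesD(2) by (auto split: if_splits)
      have gs: "set gs \<subseteq> carrier G" using that simplicesD by blast
      obtain g where g: "g \<in> carrier G"
        and nz': "ga_mult G (ga_of (g \<otimes> weight G a gs)) (\<beta> (gs @ [inv g] @ hs)) x \<noteq> 0"
        using nz nonzero_sum by (metis (mono_tags, lifting))
      obtain h where "\<beta> (gs @ [inv g] @ hs) h \<noteq> 0" "x = g \<otimes> weight G a gs \<otimes> h"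
        using ga_mult_nonzero[OF nz'] by (auto simp: ga_of_def split: if_splits)
      then have "x = g \<otimes> inv (group_prod G gs) \<otimes> group_prod G (gs @ [inv g] @ hs)"
        using 6 \<beta>D by (simp add: weight_def)
      also have "\<dots> = group_prod G hs"
        using hs gs g by (simp add: group_prod_append m_assoc inv_mult_cancel inv_mult_cancel')
      finally show "x = weight G (a + b) hs" using pos by (simp add: weight_def)
    qed
    then show ?thesis
      using 6 by (simp add: cup) (intro hoch_lin_supported[OF \<alpha>], simp)
  qed
qed

text \<open>
  On chains, \<open>\<iota>\<close> makes \<open>g\<^sub>0\<close> the inverse of the product of the remaining entries, so the rotations
  have product 1, which is the coefficient that Connes' operator gives them. On cochains, the
  pairing with 1 forces the summation variable to be the inverse of the product of the arguments.
\<close>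

lemma th_Delta_iota:
  fixes \<phi> :: "('g, 'k::field) tate"
  assumes \<phi>: "\<phi> \<in> tate_space G a"
  shows "tate_B G a \<phi> \<in> tate_space G (a - 1)"
    and "th_Delta G a (tate_iota G a \<phi>) = tate_iota G (a - 1) (tate_B G a \<phi>)"
proof -
  define n where "n = arity a"
  note iota = tate_iota_eq[OF \<phi>]
  consider "a < 0" | "a = 0" | "a > 0" by linarith
  then have "tate_B G a \<phi> \<in> tate_space G (a - 1) \<and> th_Delta G a (tate_iota G a \<phi>) =
    (\<lambda>gs x. tate_B G a \<phi> gs * ga_of (weight G (a - 1) gs) x)"
  proof cases
    case 1
    define Q where "Q gs j = drop j gs @ [inv (group_prod G gs)] @ take j gs" for gs j
    have Q: "set (Q gs j) \<subseteq> carrier G" "length (Q gs j) = Suc n" "group_prod G (Q gs j) = \<one>"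
      if "gs \<in> simplices G n" for gs j
    proof -
      have gs: "set gs \<subseteq> carrier G" "length gs = n" using simplicesD[OF that] by auto
      have c: "set (take j gs) \<subseteq> carrier G" "set (drop j gs) \<subseteq> carrier G"
        using gs by (auto dest: in_set_takeD in_set_dropD)
      show "set (Q gs j) \<subseteq> carrier G" using c gs by (simp add: Q_def)
      show "length (Q gs j) = Suc n" using gs by (simp add: Q_def)
      show "group_prod G (Q gs j) = \<one>"
        using c gs unfolding Q_def group_prod_split[OF gs(1), of j]
        by (simp add: group_prod_append inv_mult_group m_assoc inv_mult_cancel)
    qed
    have ar: "arity (a - 1) = Suc n" using 1 by (simp add: n_def arity_def)
    have B: "tate_B G a \<phi> xs = (\<Sum>gs\<in>simplices G n. \<phi> gs *
        (\<Sum>j\<le>n. (-1) ^ (Suc j * n) * tate_chain G (Q gs j) xs))" for xs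
      using 1 by (auto simp: tate_B_def n_def bar_B_def Q_def simplicesD intro!: sum.cong)
    have "tate_B G a \<phi> xs = 0" if xs: "xs \<notin> simplices G (Suc n)" for xs
    proof -
      have "tate_chain G (Q gs j) xs = (0 :: 'k)" if "gs \<in> simplices G n" for gs j
        using tate_chain_in_simplices[OF _ Q(1,2)[OF that]] xs by blast
      then show ?thesis by (simp add: B)
    qed
    then have closed: "tate_B G a \<phi> \<in> tate_space G (a - 1)"
      by (auto simp: tate_space_def ar)
    have "th_Delta G a (tate_iota G a \<phi>) xs x = tate_B G a \<phi> xs * ga_of (weight G (a - 1) xs) x" for xs x
    proof -
      have "(\<Sum>i\<le>n. (-1) ^ (i * n) * hoch_chain G (ga_of \<one>) (drop i (w # gs) @ take i (w # gs)) xs x) =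
          (\<Sum>j\<le>n. (-1) ^ (Suc j * n) *
            (tate_chain G (Q gs j) xs * ga_of (weight G (a - 1) xs) x) :: 'k)"
        (is "?L = ?R") if gs: "gs \<in> simplices G n" and w: "w = inv (group_prod G gs)" for gs w
      proof -
        let ?u = "\<lambda>j. hoch_chain G (ga_of \<one>) (Q gs j) xs x :: 'k"
        have len: "length gs = n" using simplicesD[OF gs] by simp
        \<comment> \<open>Connes' sum starts with \<open>g\<^sub>0\<close> in front, which is the last of the rotations \<open>Q\<close>;
          the sign \<open>(-1)\<^bsup>(n + 1) n\<^esup>\<close> of that rotation is 1.\<close>
        have "?L = (\<Sum>i<n. (-1) ^ (Suc i * n) * ?u i) + ?u n"
          by (simp add: lessThan_Suc_atMost[symmetric] sum.lessThan_Suc_shift Q_def w len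
              del: sum.lessThan_Suc)
        also have "?u n = (-1) ^ (Suc n * n) * ?u n" by simp
        also have "(\<Sum>i<n. (-1) ^ (Suc i * n) * ?u i) + \<dots> = (\<Sum>i\<le>n. (-1) ^ (Suc i * n) * ?u i)"
          by (simp flip: lessThan_Suc_atMost)
        also have "\<dots> = ?R"
        proof -
          have "?u j = tate_chain G (Q gs j) xs * ga_of (weight G (a - 1) xs) x" for j
            using Q(3)[OF gs, of j] 1 by (auto simp: hoch_chain_ga_of tate_chain_def weight_def)
          then show ?thesis by simp
        qed
        finally show ?thesis .
      qed
      note inner = this
      have "th_Delta G a (tate_iota G a \<phi>) xs x = (\<Sum>gs\<in>simplices G n. \<Sum>g0\<in>carrier G.
          \<phi> gs * ga_of (weight G a gs) g0 * (\<Sum>i\<le>n. (-1) ^ (i * n) *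
            hoch_chain G (ga_of \<one>) (drop i (g0 # gs) @ take i (g0 # gs)) xs x))"
        using 1 by (simp add: th_Delta_def Let_def n_def hoch_lin_def iota)
      also have "\<dots> = (\<Sum>gs\<in>simplices G n. \<Sum>g0\<in>carrier G. if g0 = weight G a gs then
          \<phi> gs * (\<Sum>j\<le>n. (-1) ^ (Suc j * n) * (tate_chain G (Q gs j) xs * ga_of (weight G (a - 1) xs) x)) else 0)"
      proof (intro sum.cong refl)
        fix gs g0 assume gs: "gs \<in> simplices G n"
        have w: "weight G a gs = inv (group_prod G gs)" using 1 by (simp add: weight_def)
        show "\<phi> gs * ga_of (weight G a gs) g0 * (\<Sum>i\<le>n. (-1) ^ (i * n) *
            hoch_chain G (ga_of \<one>) (drop i (g0 # gs) @ take i (g0 # gs)) xs x) =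
          (if g0 = weight G a gs then \<phi> gs * (\<Sum>j\<le>n. (-1) ^ (Suc j * n) *
            (tate_chain G (Q gs j) xs * ga_of (weight G (a - 1) xs) x)) else 0)"
        proof (cases "g0 = weight G a gs")
          case True
          have "ga_of (weight G a gs) (weight G a gs) = (1 :: 'k)" by (simp add: ga_of_def)
          then show ?thesis unfolding True inner[OF gs w] by simp
        next
          case False
          then have "ga_of (weight G a gs) g0 = (0 :: 'k)" by (simp add: ga_of_def)
          then show ?thesis using False by simp
        qed
      qed
      also have "\<dots> = (\<Sum>gs\<in>simplices G n. \<phi> gs *
          (\<Sum>j\<le>n. (-1) ^ (Suc j * n) * (tate_chain G (Q gs j) xs * ga_of (weight G (a - 1) xs) x)))"
        by (rule sum.cong) (auto simp: finite_carrier simplicesD)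
      also have "\<dots> = tate_B G a \<phi> xs * ga_of (weight G (a - 1) xs) x"
        unfolding B by (simp add: sum_distrib_left sum_distrib_right mult_ac)
      finally show ?thesis .
    qed
    with closed show ?thesis by blast
  next
    case 2
    then show ?thesis by (auto simp: tate_B_def th_Delta_def tate_space_def fun_eq_iff)
  next
    case 3
    then have ar: "arity (a - 1) = n - 1" "n > 0" by (simp_all add: n_def arity_def)
    have closed: "tate_B G a \<phi> \<in> tate_space G (a - 1)"
      using 3 by (auto simp: tate_B_def tate_space_def ar n_def)
    have "th_Delta G a (tate_iota G a \<phi>) gs x = tate_B G a \<phi> gs * ga_of (weight G (a - 1) gs) x" for gs x
    proof (cases "gs \<in> simplices G (n - 1)")
      case True
      note gs = simplicesD[OF True]
      define w where "w = inv (group_prod G gs)"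
      have w: "w \<in> carrier G" "inv w = group_prod G gs" using gs by (simp_all add: w_def)
      define T where "T j g = drop j gs @ g # take j gs" for j g
      have T: "ga_of (weight G a (T j g)) \<one> = (ga_of w g :: 'k)" if g: "g \<in> carrier G" for j g
      proof -
        have c: "set (take j gs) \<subseteq> carrier G" "set (drop j gs) \<subseteq> carrier G"
          using gs by (auto dest: in_set_takeD in_set_dropD)
        let ?t = "group_prod G (take j gs)" and ?d = "group_prod G (drop j gs)"
        have td: "?t \<in> carrier G" "?d \<in> carrier G" using c by simp_all
        have wt: "weight G a (T j g) = ?d \<otimes> (g \<otimes> ?t)"
          using 3 c g by (simp add: T_def weight_def group_prod_append)
        have w': "w = inv ?d \<otimes> inv ?t"
          using td unfolding w_def group_prod_split[OF gs(2), of j] by (simp add: inv_mult_group)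
        have "\<one> = ?d \<otimes> (g \<otimes> ?t) \<longleftrightarrow> g = w"
        proof
          assume "\<one> = ?d \<otimes> (g \<otimes> ?t)"
          then have "inv ?d \<otimes> \<one> \<otimes> inv ?t = inv ?d \<otimes> (?d \<otimes> (g \<otimes> ?t)) \<otimes> inv ?t" by simp
          then show "g = w" using td g by (simp add: inv_mult_cancel' m_assoc w')
        qed (use td in \<open>simp add: w' m_assoc inv_mult_cancel\<close>)
        then show ?thesis by (simp add: ga_of_def wt)
      qed
      have "th_Delta G a (tate_iota G a \<phi>) gs x = (\<Sum>g\<in>carrier G. \<Sum>i=1..n. (-1) ^ (i * (n - 1)) *
          (\<phi> (T (i - 1) g) * ga_of w g) * ga_of (inv g) x)"
        using 3 True by (auto simp: th_Delta_def Let_def n_def[symmetric] iota T T_def[symmetric] intro!: sum.cong)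
      also have "\<dots> = (\<Sum>g\<in>carrier G. if g = w then
          (\<Sum>i=1..n. (-1) ^ (i * (n - 1)) * \<phi> (T (i - 1) w)) * ga_of (group_prod G gs) x else 0)"
        by (intro sum.cong refl) (auto simp: ga_of_def w sum_distrib_right)
      also have "\<dots> = (\<Sum>i=1..n. (-1) ^ (i * (n - 1)) * \<phi> (T (i - 1) w)) * ga_of (group_prod G gs) x"
        using w by (simp add: finite_carrier)
      also have "(\<Sum>i=1..n. (-1) ^ (i * (n - 1)) * \<phi> (T (i - 1) w)) = bar_B G \<phi> gs"
      proof -
        have "{..length gs} = {..<n}" using gs ar by auto
        then show ?thesis
          unfolding bar_B_def by (simp add: sum.atLeast1_atMost_eq gs T_def w_def)
      qed
      finally show ?thesis using 3 True by (simp add: tate_B_def n_def weight_def)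
    next
      case False
      then show ?thesis using 3 by (simp add: th_Delta_def Let_def tate_B_def n_def)
    qed
    with closed show ?thesis by blast
  qed
  then show "tate_B G a \<phi> \<in> tate_space G (a - 1)"
    and "th_Delta G a (tate_iota G a \<phi>) = tate_iota G (a - 1) (tate_B G a \<phi>)"
    by (simp_all add: tate_iota_eq)
qed

lemma split_chain_map_iota:
  "split_chain_map (tate_scale :: 'k::field \<Rightarrow> _) (tate_space G) (tate_diff G)
    th_scale (th_space G) (th_diff G) (tate_iota G) (tate_retract G)"
proof -
  interpret src: linear_complex "tate_scale :: 'k \<Rightarrow> _" "tate_space G" "tate_diff G"
    by (rule tate_complex)
  interpret tgt: linear_complex "th_scale :: 'k \<Rightarrow> _" "th_space G" "th_diff G"
    by (rule th_complex)
  show ?thesis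
  proof
    fix n c and \<phi> \<psi> :: "('g, 'k) tate" assume \<phi>: "\<phi> \<in> tate_space G n"
    show "tate_iota G n (tate_scale c \<phi>) = th_scale c (tate_iota G n \<phi>)"
      using \<phi> src.subspace_scale[OF src.subspace_C \<phi>]
      by (simp add: tate_iota_eq) (simp add: tate_scale_def th_scale_def mult.assoc)
    assume \<psi>: "\<psi> \<in> tate_space G n"
    show "tate_iota G n (\<phi> + \<psi>) = tate_iota G n \<phi> + tate_iota G n \<psi>"
      using \<phi> \<psi> src.subspace_add[OF src.subspace_C \<phi> \<psi>]
      by (simp add: tate_iota_eq fun_eq_iff distrib_right)
  qed (simp_all add: tate_iota_closed th_diff_iota tate_retract_closed retract_diff retract_iota)
qed

text \<open>
  A product of two cocycles in the image is supported, hence \<open>\<iota>\<close> of its retraction, which is a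
  cocycle because the retraction is a chain map.
\<close>

lemma zero_delta_embedding_iota:
  fixes k :: "'k::field itself"
  assumes descend: "th_operations_descend k G"
    and alg: "graded_comm_algebra (tate_hochschild k G)"
  shows "zero_delta_embedding (tate_cohomology k G) (tate_hochschild k G) (iota_class k G)"
proof -
  interpret M: split_chain_map "tate_scale :: 'k \<Rightarrow> _" "tate_space G" "tate_diff G"
    th_scale "th_space G" "th_diff G" "tate_iota G" "tate_retract G"
    by (rule split_chain_map_iota)
  have V: "tate_cohomology k G = M.src.H"
    by (simp add: tate_cohomology_def tate_scale_def[abs_def])
  have iota: "iota_class k G = M.induced"
    by (simp add: iota_class_def M.induced_def fun_eq_iff)
  let ?B = "tate_hochschild k G"
  have B: "homog ?B = homog M.tgt.H" "hadd ?B = hadd M.tgt.H" "hzero ?B = hzero M.tgt.H"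
    "hscale ?B = hscale M.tgt.H"
    by (simp_all add: tate_hochschild_def Let_def)
  have cup: "hcup ?B a b (M.tgt.R a `` {\<alpha>}) (M.tgt.R b `` {\<beta>}) = M.tgt.R (a + b) `` {th_cup G a b \<alpha> \<beta>}"
    and cup_closed: "th_cup G a b \<alpha> \<beta> \<in> M.tgt.Z (a + b)"
    if "\<alpha> \<in> M.tgt.Z a" "\<beta> \<in> M.tgt.Z b" for a b \<alpha> \<beta>
    using descend that UN_equiv_class2[OF M.tgt.equiv_R M.tgt.equiv_R _ that, of
        "\<lambda>\<alpha> \<beta>. M.tgt.R (a + b) `` {th_cup G a b \<alpha> \<beta>}"]
    by (simp_all add: th_operations_descend_def tate_hochschild_def Let_def)
  have delta: "hdelta ?B a (M.tgt.R a `` {\<alpha>}) = M.tgt.R (a - 1) `` {th_Delta G a \<alpha>}"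
    and delta_closed: "th_Delta G a \<alpha> \<in> M.tgt.Z (a - 1)"
    if "\<alpha> \<in> M.tgt.Z a" for a \<alpha>
    using descend that UN_equiv_class[OF M.tgt.equiv_R _ that, of
        "\<lambda>\<alpha>. M.tgt.R (a - 1) `` {th_Delta G a \<alpha>}"]
    by (simp_all add: th_operations_descend_def tate_hochschild_def Let_def)
  show ?thesis
  proof (intro zero_delta_embedding.intro zero_delta_embedding_axioms.intro)
    show "graded_vector_space (tate_cohomology k G)"
      unfolding V by (rule M.src.graded_vector_space_H)
    show "graded_comm_algebra ?B" by (rule alg)
    show "linear_on (tate_cohomology k G) n ?B n (iota_class k G n)" for n
      using M.linear_on_induced[of n] by (simp add: V iota linear_on_def B)
    show "inj_on (iota_class k G n) (homog (tate_cohomology k G) n)" for n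
      unfolding V iota by (rule M.inj_on_induced)
  next
    define u :: "('g, 'k) tate" where "u = (\<lambda>gs. if gs = [] then 1 else 0)"
    have u: "u \<in> tate_space G 0" by (auto simp: u_def tate_space_def arity_def simplices_def)
    have "tate_delta G 0 u gs = 0" for gs
      by (cases gs) (auto simp: tate_delta_def u_def simplices_def)
    then have "u \<in> M.src.Z 0" using u by (auto simp: cocycles_def tate_diff_def)
    moreover have "tate_iota G 0 u = th_unit G"
      unfolding tate_iota_eq[OF u] by (auto simp: th_unit_def u_def weight_def fun_eq_iff)
    then have "hunit ?B = M.tgt.R 0 `` {tate_iota G 0 u}"
      by (simp add: tate_hochschild_def Let_def)
    ultimately show "hunit ?B \<in> iota_class k G 0 ` homog (tate_cohomology k G) 0"
      unfolding V iota M.induced_image by blast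
  next
    fix x y a b
    assume "x \<in> homog (tate_cohomology k G) a" "y \<in> homog (tate_cohomology k G) b"
    then obtain \<phi> \<psi> where \<phi>: "\<phi> \<in> M.src.Z a" "x = M.src.R a `` {\<phi>}"
      and \<psi>: "\<psi> \<in> M.src.Z b" "y = M.src.R b `` {\<psi>}"
      by (auto simp: V M.src.homog_H)
    define z where "z = th_cup G a b (tate_iota G a \<phi>) (tate_iota G b \<psi>)"
    have z: "z \<in> M.tgt.Z (a + b)"
      unfolding z_def by (intro cup_closed M.f_cocycle \<phi> \<psi>)
    then have z_space: "z \<in> th_space G (a + b)" and z_cyc: "th_diff G (a + b) z = 0"
      by (simp_all add: cocycles_def)
    have "supported G (a + b) z"
      unfolding z_def using \<phi> \<psi> by (intro supported_cup supported_iota) (auto simp: cocycles_def)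
    then have z_iota: "tate_iota G (a + b) (tate_retract G (a + b) z) = z"
      by (rule iota_retract[OF z_space])
    have "tate_diff G (a + b) (tate_retract G (a + b) z) = 0"
      using retract_diff[OF z_space] by (simp add: z_cyc tate_retract_def fun_eq_iff)
    then have "tate_retract G (a + b) z \<in> M.src.Z (a + b)"
      using tate_retract_closed[OF z_space] by (simp add: cocycles_def)
    moreover have "hcup ?B a b (iota_class k G a x) (iota_class k G b y) = M.tgt.R (a + b) `` {z}"
      by (simp add: iota \<phi> \<psi> M.induced_class cup M.f_cocycle z_def)
    ultimately show "hcup ?B a b (iota_class k G a x) (iota_class k G b y)
        \<in> iota_class k G (a + b) ` homog (tate_cohomology k G) (a + b)"
      unfolding V iota M.induced_image using z_iota by (metis (no_types, lifting) image_eqI)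
  next
    fix x a assume "x \<in> homog (tate_cohomology k G) a"
    then obtain \<phi> where \<phi>: "\<phi> \<in> M.src.Z a" "x = M.src.R a `` {\<phi>}"
      by (auto simp: V M.src.homog_H)
    then have \<phi>_space: "\<phi> \<in> tate_space G a" by (simp add: cocycles_def)
    obtain \<psi> where \<psi>: "\<psi> \<in> tate_space G (a - 2)" "tate_B G a \<phi> = tate_diff G (a - 2) \<psi>"
      using tate_B_exact[OF \<phi>(1)] by blast
    have "th_Delta G a (tate_iota G a \<phi>) = th_diff G (a - 2) (tate_iota G (a - 2) \<psi>)"
      using th_Delta_iota(2)[OF \<phi>_space] th_diff_iota[OF \<psi>(1)] \<psi>(2) by simp
    then have "M.tgt.R (a - 1) `` {th_Delta G a (tate_iota G a \<phi>)} = M.tgt.R (a - 1) `` {0}"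
      using tate_iota_closed[OF \<psi>(1)] delta_closed[OF M.f_cocycle[OF \<phi>(1)]]
        M.tgt.subspace_0[OF M.tgt.subspace_cocycles]
      by (subst M.tgt.class_eq_iff) auto
    then show "hdelta ?B a (iota_class k G a x) = hzero ?B (a - 1)"
      by (simp add: iota \<phi> M.induced_class delta M.f_cocycle B M.tgt.hzero_H)
  next
    show "hbracket ?B = bv_bracket (hadd ?B) (hscale ?B) (hcup ?B) (hdelta ?B)"
      by (simp add: tate_hochschild_def Let_def)
  qed
qed

end

theorem corollary6p5:
  fixes k :: "'k::field itself" and G :: "('g, 'm) monoid_scheme"
  assumes "group G" and "finite (carrier G)"
    and "th_operations_descend k G"
    and "graded_comm_algebra (tate_hochschild k G)"
  shows
    "(\<forall>n. linear_on (tate_cohomology k G) n (tate_hochschild k G) n (iota_class k G n)) \<and>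
     (\<forall>n. inj_on (iota_class k G n) (homog (tate_cohomology k G) n)) \<and>
     hunit (tate_hochschild k G) \<in> iota_class k G 0 ` homog (tate_cohomology k G) 0 \<and>
     (\<forall>a b. \<forall>x \<in> iota_class k G a ` homog (tate_cohomology k G) a.
            \<forall>y \<in> iota_class k G b ` homog (tate_cohomology k G) b.
        hcup (tate_hochschild k G) a b x y
          \<in> iota_class k G (a + b) ` homog (tate_cohomology k G) (a + b)) \<and>
     (\<forall>a. \<forall>x \<in> iota_class k G a ` homog (tate_cohomology k G) a.
        hdelta (tate_hochschild k G) a x
          \<in> iota_class k G (a - 1) ` homog (tate_cohomology k G) (a - 1)) \<and>
     (\<forall>a b. \<forall>x \<in> iota_class k G a ` homog (tate_cohomology k G) a.
            \<forall>y \<in> iota_class k G b ` homog (tate_cohomology k G) b.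
        hbracket (tate_hochschild k G) a b x y
          \<in> iota_class k G (a + b - 1) ` homog (tate_cohomology k G) (a + b - 1)) \<and>
     bv_algebra (induced_bv_structure (tate_cohomology k G) (tate_hochschild k G) (iota_class k G)) \<and>
     bv_hom (induced_bv_structure (tate_cohomology k G) (tate_hochschild k G) (iota_class k G))
       (tate_hochschild k G) (iota_class k G)"
proof -
  interpret finite_group G
    using assms(1,2) by (simp add: finite_group_def finite_group_axioms_def)
  interpret E: zero_delta_embedding "tate_cohomology k G" "tate_hochschild k G" "iota_class k G"
    by (rule zero_delta_embedding_iota[OF assms(3,4)])
  show ?thesis
    using E.lin E.inj E.unit_in_image E.cup_in_image E.bv_algebra_S E.bv_hom_S
    by (intro conjI allI ballI) (auto simp: E.delta_zero E.bracket_zero E.hzero_in_image)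
qed

end
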